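(* Let $n\ge 0$ be an integer, let $\alpha$ be a flat virtual knot, and let $D$ and $D'$ be flat virtual knot diagrams representing $\alpha$. Let $A$ (of size $k$) and $A'$ (of size $k'$) be coloring matrices over $\mathcal{S}_n$ of $(D,V)$ and $(D',V')$, for some choices of nonempty vertex sets $V,V'$ (i.e. of fake vertices) and of starting arcs. Then there exist units $U,W\in\mathcal{S}_n$ with $\pi_{0,n}(UW)=1$ such that $|A'|_{k',k'}=U\,|A|_{k,k}\,W$. That is, the $\mathcal{S}_n$-coloring invariant $F_\alpha$ of $\alpha$ is independent of the flat virtual knot diagram representing $\alpha$.
   Context: Ring. For a non-negative integer $n$, $\mathcal{S}_n$ is the unital ring $\mathbb{Z}\langle s,\overline{s},t\rangle/I_n$, where $I_n$ is the two-sided ideal generated by $s\overline{s}-1$, $\overline{s}s-1$, $ts-s\sum_{i=1}^{n}t^{i}$, $t\overline{s}-\overline{s}\sum_{i=1}^{n}(-1)^{i-1}t^{i}$ and $t^{n+1}$; the image of $\overline{s}$ is written $s^{-1}$. $\mathcal{S}_0=\mathbb{Z}[s^{\pm1}]$, and $\pi_{0,n}:\mathcal{S}_n\to\mathcal{S}_0$ is the ring homomorphism with $s\mapsto s$, $t\mapsto 0$. Quasideterminant. For an $m\times m$ matrix $A$ over a ring, let $A^{i,j}$ be $A$ with row $i$ and column $j$ deleted, $r_i^{j}(A)$ the $i$-th row with its $j$-th entry deleted, $c^{i}_{j}(A)$ the $j$-th column with its $i$-th entry deleted. If $m=1$, $|A|_{1,1}=(A)_{1,1}$. If $m>1$ and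 $A^{i,j}$ is invertible, $|A|_{i,j}=(A)_{i,j}-r_i^{j}(A)(A^{i,j})^{-1}c^{i}_{j}(A)$. For the coloring matrices below, $|A|_{k,k}$ is always defined. Diagrams. A flat virtual knot diagram is a generic immersion of an oriented circle $S^1$ into $\mathbb{R}^2$ (finitely many multiple points, all transversal double points), each double point being labeled "flat" or "virtual". A flat virtual knot is an equivalence class of flat virtual knot diagrams under planar isotopy and the flat Reidemeister moves (with arbitrary orientations): FR1, FR2, FR3, the ordinary Reidemeister moves 1, 2, 3 with over/under information forgotten and all crossings flat; VR1, VR2, VR3, the same moves with all crossings virtual; and FR4, the triangle move in which a strand having two virtual crossings with two other strands is moved across the flat crossing of these two strands. $V_{flat}$ is the set of flat crossings, and $V_{fake}$ is a (possibly empty) finite set of points of the image that are not double points, called fake vertices; $V=V_{flat}\cup V_{fake}$ is assumed nonempty. The preimage of $V$ cuts $S^1$ into $k$ components, whose images are called the arcs of $(D,V)$ (virtual crossings do not cut arcs). Coloring matrix. Choose a starting arc, label it $1$, and label the other arcs $2,\dots,k$ in order along the orientation; the arc with index $0$ means arc $k$. Let $e_1,\dots,e_k$ be the standard row vectors. At each flat crossing with velocity vectors of its two strands $v_1,v_2$, name the strands so that $(v_1,v_2)$ is a positively oriented basis of $\mathbb{R}^2$. The $i$-th row of $A$ is determined by the vertex at the initial point of arc $i$: (a) if it is a flat crossing and arcs $i-1,i$ lie (before and after the crossing) on its strand 2, the row is $e_i-s\,e_{i-1}-t\,e_j$, where $j$ is the label of the arc entering the crossing along strand 1; (b) if it is a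 flat crossing and arcs $i-1,i$ lie on its strand 1, the row is $e_i-s^{-1}(1-t^2)\,e_{i-1}+s^{-1}ts\,e_j$, where $j$ is the label of the arc entering the crossing along strand 2; (c) if it is a fake vertex, the row is $e_i-e_{i-1}$ (zero if $k=1$). Coefficients are added when indices coincide. The $\mathcal{S}_n$-coloring invariant $F_\alpha$ is the class of $|A|_{k,k}$ under the equivalence relation $F\sim UFW$ for units $U,W\in\mathcal{S}_n$ with $\pi_{0,n}(UW)=1$. *)

theory Defs
  imports
    "HOL-Analysis.Analysis"
    "HOL-Algebra.Algebraic_Closure_Type"
    "HOL-Library.Poly_Mapping"
begin

section \<open>The rings \<open>S\<^sub>n\<close>\<close>

datatype letter = Let_s | Let_sbar | Let_t

text \<open>The free monoid on three letters, written additively so that finitely supported integer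
  functions on it, with the convolution product, are the free ring \<open>\<int>\<langle>s, sbar, t\<rangle>\<close>.\<close>

datatype word = Word "letter list"

instantiation word :: monoid_add
begin

definition zero_word :: word where "0 = Word []"

fun plus_word :: "word \<Rightarrow> word \<Rightarrow> word" where
  "Word u + Word v = Word (u @ v)"

instance
proof
  fix a b c :: word
  show "a + b + c = a + (b + c)" by (cases a; cases b; cases c) simp
  show "0 + a = a" by (cases a) (simp add: zero_word_def)
  show "a + 0 = a" by (cases a) (simp add: zero_word_def)
qed

end

type_synonym free_ring = "word \<Rightarrow>\<^sub>0 int"

definition gen :: "letter \<Rightarrow> free_ring" where
  "gen x = Poly_Mapping.single (Word [x]) 1"

abbreviation "gen_s \<equiv> gen Let_s"
abbreviation "gen_sbar \<equiv> gen Let_sbar"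
abbreviation "gen_t \<equiv> gen Let_t"

abbreviation FreeR :: "free_ring ring" where
  "FreeR \<equiv> ring_of_type_algebra"

definition rels :: "nat \<Rightarrow> free_ring set" where
  "rels n =
     {gen_s * gen_sbar - 1,
      gen_sbar * gen_s - 1,
      gen_t * gen_s - gen_s * (\<Sum>i=1..n. gen_t ^ i),
      gen_t * gen_sbar - gen_sbar * (\<Sum>i=1..n. (-1) ^ (i - 1) * gen_t ^ i),
      gen_t ^ (n + 1)}"

definition relI :: "nat \<Rightarrow> free_ring set" where
  "relI n = Idl\<^bsub>FreeR\<^esub> (rels n)"

definition Sn :: "nat \<Rightarrow> free_ring set ring" where
  "Sn n = FreeR Quot relI n"

definition s_elt :: "nat \<Rightarrow> free_ring set" where "s_elt n = relI n +>\<^bsub>FreeR\<^esub> gen_s"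
definition sinv_elt :: "nat \<Rightarrow> free_ring set" where "sinv_elt n = relI n +>\<^bsub>FreeR\<^esub> gen_sbar"
definition t_elt :: "nat \<Rightarrow> free_ring set" where "t_elt n = relI n +>\<^bsub>FreeR\<^esub> gen_t"

text \<open>Elements of \<open>Sn n\<close> are cosets of \<open>relI n\<close>; since \<open>relI n \<subseteq> relI 0\<close>, the homomorphism with
  \<open>s \<mapsto> s\<close>, \<open>t \<mapsto> 0\<close> enlarges a coset of \<open>relI n\<close> to the coset of \<open>relI 0\<close> containing it
  (see \<open>pi0_ring_hom\<close> and \<open>pi0_generators\<close>).\<close>

definition pi0 :: "free_ring set \<Rightarrow> free_ring set" where
  "pi0 C = (\<Union>x\<in>C. relI 0 +>\<^bsub>FreeR\<^esub> x)"


lemma ring_FreeR: "ring FreeR"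
proof -
  have "\<exists>y. x + y = 0" for x :: free_ring
    using add.right_inverse by blast
  then show ?thesis
    unfolding ring_of_type_algebra_def using add.right_inverse
    by unfold_locales (auto simp: algebra_simps Units_def)
qed

lemma ideal_relI: "ideal (relI n) FreeR"
  unfolding relI_def using ring.genideal_ideal[OF ring_FreeR]
  by (simp add: ring_of_type_algebra_def)

lemma ring_Sn: "ring (Sn n)"
  unfolding Sn_def by (rule ideal.quotient_is_ring[OF ideal_relI])

lemma relI_add: "x \<in> relI n \<Longrightarrow> y \<in> relI n \<Longrightarrow> x + y \<in> relI n"
  using additive_subgroup.a_closed[OF ideal.axioms(1)[OF ideal_relI]]
  by (simp add: ring_of_type_algebra_def)

lemma relI_mult: "x \<in> relI n \<Longrightarrow> y * x \<in> relI n" "x \<in> relI n \<Longrightarrow> x * y \<in> relI n"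
  using ideal.I_l_closed[OF ideal_relI, of x n y] ideal.I_r_closed[OF ideal_relI, of x n y]
  by (simp_all add: ring_of_type_algebra_def)

lemma relI_uminus: "x \<in> relI n \<Longrightarrow> - x \<in> relI n"
  using relI_mult(1)[of x n "-1"] by simp

lemma relI_zero: "0 \<in> relI n"
  using additive_subgroup.zero_closed[OF ideal.axioms(1)[OF ideal_relI]]
  by (simp add: ring_of_type_algebra_def)

lemma relI_sum: "(\<And>i. i \<in> A \<Longrightarrow> f i \<in> relI n) \<Longrightarrow> sum f A \<in> relI n"
  by (induction A rule: infinite_finite_induct) (auto simp: relI_zero relI_add)

lemma rels_subset_relI: "rels n \<subseteq> relI n"
  unfolding relI_def using ring.genideal_self[OF ring_FreeR]
  by (simp add: ring_of_type_algebra_def)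

lemma relI_subset: "relI n \<subseteq> relI 0"
proof -
  have t: "gen_t \<in> relI 0"
    using rels_subset_relI[of 0] by (simp add: rels_def)
  have tp: "gen_t ^ i \<in> relI 0" if "i \<ge> 1" for i
    using that t relI_mult(2)[of gen_t 0 "gen_t ^ (i - 1)"] by (cases i) auto
  have "gen_s * gen_sbar - 1 \<in> relI 0" "gen_sbar * gen_s - 1 \<in> relI 0"
    using rels_subset_relI[of 0] by (simp_all add: rels_def)
  moreover have "gen_t * gen_s - gen_s * (\<Sum>i=1..n. gen_t ^ i) \<in> relI 0"
    unfolding diff_conv_add_uminus
    by (intro relI_add relI_uminus relI_mult(1) relI_sum relI_mult(2)[OF t] tp) auto
  moreover have "gen_t * gen_sbar - gen_sbar * (\<Sum>i=1..n. (-1) ^ (i - 1) * gen_t ^ i) \<in> relI 0"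
    unfolding diff_conv_add_uminus
    by (intro relI_add relI_uminus relI_mult(1) relI_sum relI_mult(2)[OF t] tp) auto
  ultimately have "rels n \<subseteq> relI 0"
    using tp[of "n + 1"] by (simp add: rels_def)
  then show ?thesis
    unfolding relI_def[of n] using ring.genideal_minimal[OF ring_FreeR ideal_relI] by blast
qed

lemma coset_relI: "relI n +>\<^bsub>FreeR\<^esub> x = {h + x | h. h \<in> relI n}"
  by (auto simp: a_r_coset_def r_coset_def ring_of_type_algebra_def)

lemma pi0_coset: "pi0 (relI n +>\<^bsub>FreeR\<^esub> x) = relI 0 +>\<^bsub>FreeR\<^esub> x"
proof -
  have "h + (h' + x) \<in> {h + x | h. h \<in> relI 0}" if "h \<in> relI 0" "h' \<in> relI n" for h h'
    using that relI_subset relI_add[of h 0 h'] by (auto simp: add.assoc[symmetric])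
  moreover have "\<exists>h'. h' \<in> relI n" using relI_zero by blast
  moreover have "h + x \<in> pi0 (relI n +>\<^bsub>FreeR\<^esub> x)" if "h \<in> relI 0" for h
    unfolding pi0_def coset_relI using that relI_zero[of n] by force
  ultimately show ?thesis
    unfolding pi0_def coset_relI by (auto simp: pi0_def coset_relI)
qed

lemma pi0_ring_hom: "pi0 \<in> ring_hom (Sn n) (Sn 0)"
proof -
  have c: "carrier (Sn n) = range (\<lambda>x. relI n +>\<^bsub>FreeR\<^esub> x)" for n
    by (auto simp: Sn_def FactRing_simps ring_of_type_algebra_def a_r_coset_def)
  have h: "(\<lambda>x. relI n +>\<^bsub>FreeR\<^esub> x) \<in> ring_hom FreeR (Sn n)" for n
    unfolding Sn_def by (rule ideal.rcos_ring_hom[OF ideal_relI])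
  have F: "x \<in> carrier FreeR" "x \<otimes>\<^bsub>FreeR\<^esub> y = x * y" "x \<oplus>\<^bsub>FreeR\<^esub> y = x + y" for x y
    by (simp_all add: ring_of_type_algebra_def)
  note m = ring_hom_mult[OF h F(1) F(1), symmetric] ring_hom_add[OF h F(1) F(1), symmetric]
    ring_hom_one[OF h, symmetric]
  show ?thesis
    by (rule ring_hom_memI) (auto simp: c m pi0_coset)
qed

lemma pi0_generators:
  "pi0 (s_elt n) = s_elt 0" "pi0 (sinv_elt n) = sinv_elt 0" "pi0 (t_elt n) = \<zero>\<^bsub>Sn 0\<^esub>"
proof -
  have t: "gen_t \<in> relI 0" using rels_subset_relI[of 0] by (simp add: rels_def)
  have "\<exists>h. x = h + gen_t \<and> h \<in> relI 0" if "x \<in> relI 0" for x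
    using relI_add[OF that relI_uminus[OF t]] by (intro exI[of _ "x + - gen_t"]) simp
  with t have "relI 0 +>\<^bsub>FreeR\<^esub> gen_t = relI 0"
    by (auto simp: coset_relI relI_add)
  then show "pi0 (t_elt n) = \<zero>\<^bsub>Sn 0\<^esub>"
    by (simp add: t_elt_def pi0_coset Sn_def FactRing_def)
qed (simp_all add: s_elt_def sinv_elt_def pi0_coset)


section \<open>Quasideterminants\<close>

text \<open>A matrix is a function of a row and a column index, of which only the values on
  \<open>I \<times> J\<close> matter. Deleting rows and columns shrinks the index sets without renumbering.\<close>

definition is_mat_inverse ::
  "('a, 'b) ring_scheme \<Rightarrow> nat set \<Rightarrow> nat set \<Rightarrow> (nat \<Rightarrow> nat \<Rightarrow> 'a) \<Rightarrow> (nat \<Rightarrow> nat \<Rightarrow> 'a) \<Rightarrow> bool" where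
  "is_mat_inverse R I J A B \<longleftrightarrow>
     (\<forall>j\<in>J. \<forall>i\<in>I. B j i \<in> carrier R) \<and>
     (\<forall>i\<in>I. \<forall>i'\<in>I. (\<Oplus>\<^bsub>R\<^esub>j\<in>J. A i j \<otimes>\<^bsub>R\<^esub> B j i') = (if i = i' then \<one>\<^bsub>R\<^esub> else \<zero>\<^bsub>R\<^esub>)) \<and>
     (\<forall>j\<in>J. \<forall>j'\<in>J. (\<Oplus>\<^bsub>R\<^esub>i\<in>I. B j i \<otimes>\<^bsub>R\<^esub> A i j') = (if j = j' then \<one>\<^bsub>R\<^esub> else \<zero>\<^bsub>R\<^esub>))"

definition quasidet ::
  "('a, 'b) ring_scheme \<Rightarrow> nat \<Rightarrow> (nat \<Rightarrow> nat \<Rightarrow> 'a) \<Rightarrow> nat \<Rightarrow> nat \<Rightarrow> 'a" where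
  "quasidet R m A i j =
     (let I = {1..m} - {i}; J = {1..m} - {j} in
      if m = 1 then A i j
      else if \<exists>B. is_mat_inverse R I J A B then
        let B = (SOME B. is_mat_inverse R I J A B) in
        A i j \<ominus>\<^bsub>R\<^esub> (\<Oplus>\<^bsub>R\<^esub>l\<in>J. \<Oplus>\<^bsub>R\<^esub>h\<in>I. A i l \<otimes>\<^bsub>R\<^esub> B l h \<otimes>\<^bsub>R\<^esub> A h j)
      else undefined)"


section \<open>Flat virtual knot diagrams\<close>

text \<open>The oriented circle is \<open>\<real>/\<int>\<close> and the plane is \<^typ>\<open>complex\<close>: a closed curve is a
  1-periodic function. Immersions, reparametrisations and isotopies are of class \<open>C\<^sup>1\<close>.\<close>

definition velocity :: "(real \<Rightarrow> complex) \<Rightarrow> real \<Rightarrow> complex" where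
  "velocity \<gamma> x = vector_derivative \<gamma> (at x)"

definition immersed_circle :: "(real \<Rightarrow> complex) \<Rightarrow> bool" where
  "immersed_circle \<gamma> \<longleftrightarrow>
     (\<forall>x. \<gamma> (x + 1) = \<gamma> x) \<and> \<gamma> C1_differentiable_on UNIV \<and> (\<forall>x. velocity \<gamma> x \<noteq> 0)"

definition preimages :: "(real \<Rightarrow> complex) \<Rightarrow> complex \<Rightarrow> real set" where
  "preimages \<gamma> p = {x \<in> {0..<1}. \<gamma> x = p}"

definition multiple_points :: "(real \<Rightarrow> complex) \<Rightarrow> complex set" where
  "multiple_points \<gamma> = {p. \<exists>x\<in>preimages \<gamma> p. \<exists>y\<in>preimages \<gamma> p. x \<noteq> y}"

text \<open>\<open>orient v w\<close> is the determinant of the pair \<open>(v, w)\<close> of plane vectors.\<close>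

definition orient :: "complex \<Rightarrow> complex \<Rightarrow> real" where
  "orient v w = Re v * Im w - Im v * Re w"

definition generic_immersion :: "(real \<Rightarrow> complex) \<Rightarrow> bool" where
  "generic_immersion \<gamma> \<longleftrightarrow>
     immersed_circle \<gamma> \<and>
     finite (multiple_points \<gamma>) \<and>
     (\<forall>p\<in>multiple_points \<gamma>. card (preimages \<gamma> p) = 2 \<and>
        (\<forall>x\<in>preimages \<gamma> p. \<forall>y\<in>preimages \<gamma> p. x \<noteq> y \<longrightarrow>
           orient (velocity \<gamma> x) (velocity \<gamma> y) \<noteq> 0))"

text \<open>The double points outside \<open>flat D\<close> are the virtual crossings.\<close>

record diagram =
  curve :: "real \<Rightarrow> complex"
  flat :: "complex set"

definition is_diagram :: "diagram \<Rightarrow> bool" where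
  "is_diagram D \<longleftrightarrow> generic_immersion (curve D) \<and> flat D \<subseteq> multiple_points (curve D)"


section \<open>Flat virtual knots\<close>

definition reparametrised :: "diagram \<Rightarrow> diagram \<Rightarrow> bool" where
  "reparametrised D D' \<longleftrightarrow>
     (\<exists>\<rho>. \<rho> C1_differentiable_on UNIV \<and>
        (\<forall>x. vector_derivative \<rho> (at x) > 0) \<and> (\<forall>x. \<rho> (x + 1) = \<rho> x + 1) \<and>
        curve D' = curve D \<circ> \<rho> \<and> flat D' = flat D)"

definition ambient_isotopy :: "(real \<Rightarrow> complex \<Rightarrow> complex) \<Rightarrow> bool" where
  "ambient_isotopy H \<longleftrightarrow>
     H 0 = id \<and>
     (\<forall>\<tau>\<in>{0..1}. bij (H \<tau>)) \<and>
     continuous_on ({0..1} \<times> UNIV) (\<lambda>(\<tau>, z). H \<tau> z) \<and>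
     (\<exists>H'. (\<forall>\<tau>\<in>{0..1}. \<forall>z. (H \<tau> has_derivative H' \<tau> z) (at z) \<and> bij (H' \<tau> z)) \<and>
           (\<forall>v. continuous_on ({0..1} \<times> UNIV) (\<lambda>(\<tau>, z). H' \<tau> z v)))"

definition planar_isotopic :: "diagram \<Rightarrow> diagram \<Rightarrow> bool" where
  "planar_isotopic D D' \<longleftrightarrow>
     (\<exists>H. ambient_isotopy H \<and> curve D' = H 1 \<circ> curve D \<and> flat D' = H 1 ` flat D)"

text \<open>Pictures of the moves, drawn in the square \<open>[-1,1]\<^sup>2\<close>. The strands are parametrised by
  \<open>u \<in> [-1,1]\<close> and run between the left and the right side; before and after the move they have
  the same end points and end velocities, because \<open>bump\<close> vanishes to first order at \<open>\<plusminus>1\<close>.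
  A picture is a list of strands and its set of flat crossings; all other crossings in it are
  virtual.\<close>

definition square :: "complex set" where
  "square = {z. \<bar>Re z\<bar> \<le> 1 \<and> \<bar>Im z\<bar> \<le> 1}"

definition bump :: "real \<Rightarrow> real" where
  "bump u = (1 - u\<^sup>2)\<^sup>2 / 2"

type_synonym picture = "(real \<Rightarrow> complex) list \<times> complex set"

text \<open>Move 1: a straight strand becomes the loop \<open>kink\<close>, which crosses itself for \<open>u = \<plusminus>1/2\<close>.\<close>

definition kink :: "real \<Rightarrow> complex" where
  "kink u = Complex (u * (1 - 32/9 * bump u)) (bump u)"

definition pic1_before :: "(real \<Rightarrow> complex) list" where
  "pic1_before = [\<lambda>u. Complex u 0]"
definition pic1_after :: "(real \<Rightarrow> complex) list" where
  "pic1_after = [kink]"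
definition crossing1 :: complex where
  "crossing1 = Complex 0 (9/32)"

text \<open>Move 2: the upper one of two parallel strands is pushed down across the lower one.\<close>

definition pic2_before :: "(real \<Rightarrow> complex) list" where
  "pic2_before = [\<lambda>u. Complex u 0, \<lambda>u. Complex u (9/32)]"
definition pic2_after :: "(real \<Rightarrow> complex) list" where
  "pic2_after = [\<lambda>u. Complex u 0, \<lambda>u. Complex u (9/32 - bump u)]"
definition crossings2 :: "complex set" where
  "crossings2 = {Complex (-1/2) 0, Complex (1/2) 0}"

text \<open>Triangle moves: two lines crossing at \<open>0\<close>; the third strand passes above \<open>0\<close> before and
  below \<open>0\<close> after the move.\<close>

definition pic3_before :: "(real \<Rightarrow> complex) list" where
  "pic3_before = [\<lambda>u. Complex u (9/16 * u), \<lambda>u. Complex u (- 9/16 * u), \<lambda>u. Complex u (bump u)]"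
definition pic3_after :: "(real \<Rightarrow> complex) list" where
  "pic3_after = [\<lambda>u. Complex u (9/16 * u), \<lambda>u. Complex u (- 9/16 * u), \<lambda>u. Complex u (- bump u)]"
definition crossings3_before :: "complex set" where
  "crossings3_before = {0, Complex (-1/2) (9/32), Complex (1/2) (9/32)}"
definition crossings3_after :: "complex set" where
  "crossings3_after = {0, Complex (-1/2) (-9/32), Complex (1/2) (-9/32)}"

inductive move :: "picture \<Rightarrow> picture \<Rightarrow> bool" where
  FR1: "move (pic1_before, {}) (pic1_after, {crossing1})"
| VR1: "move (pic1_before, {}) (pic1_after, {})"
| FR2: "move (pic2_before, {}) (pic2_after, crossings2)"
| VR2: "move (pic2_before, {}) (pic2_after, {})"
| FR3: "move (pic3_before, crossings3_before) (pic3_after, crossings3_after)"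
| VR3: "move (pic3_before, {}) (pic3_after, {})"
| FR4: "move (pic3_before, {0}) (pic3_after, {0})"

text \<open>\<open>D\<close> and \<open>D'\<close> agree outside the square and show the two pictures of a move inside it. The
  circle meets the square in disjoint closed intervals, the \<open>j\<close>-th one centred at \<open>c j\<close> with
  half-length \<open>\<bar>r j\<bar>\<close>, and traverses the \<open>j\<close>-th strand from left to right if \<open>r j > 0\<close> and from
  right to left if \<open>r j < 0\<close>; so all orientations and all cyclic orders of the strands occur.
  Every other position of a move in the plane is reached by planar isotopy and
  reparametrisation.\<close>

definition reidemeister_related :: "diagram \<Rightarrow> diagram \<Rightarrow> bool" where
  "reidemeister_related D D' \<longleftrightarrow>
     (\<exists>ps F qs F' c r. move (ps, F) (qs, F') \<and>
        (\<forall>j<length ps. r j \<noteq> 0) \<and>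
        bij_betw (\<lambda>(j, u). frac (c j + r j * u)) ({..<length ps} \<times> {-1..1})
                 {x \<in> {0..<1}. curve D x \<in> square} \<and>
        (\<forall>j<length ps. \<forall>u\<in>{-1..1}.
           curve D (c j + r j * u) = (ps ! j) u \<and> curve D' (c j + r j * u) = (qs ! j) u) \<and>
        (\<forall>x. curve D x \<notin> square \<longrightarrow> curve D' x = curve D x) \<and>
        flat D \<inter> square = F \<and> flat D' \<inter> square = F' \<and> flat D - square = flat D' - square)"

definition flat_step :: "diagram \<Rightarrow> diagram \<Rightarrow> bool" where
  "flat_step D D' \<longleftrightarrow> is_diagram D \<and> is_diagram D' \<and>
     (reparametrised D D' \<or> planar_isotopic D D' \<or> reidemeister_related D D')"

definition flat_virtual_knots :: "diagram set set" where
  "flat_virtual_knots =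
     {D. is_diagram D} // {(D, D'). is_diagram D \<and> is_diagram D' \<and> equivclp flat_step D D'}"


section \<open>Coloring matrices\<close>

definition is_vertex_set :: "diagram \<Rightarrow> complex set \<Rightarrow> bool" where
  "is_vertex_set D V \<longleftrightarrow>
     (\<exists>fake. finite fake \<and> fake \<subseteq> range (curve D) - multiple_points (curve D) \<and>
        V = flat D \<union> fake) \<and> V \<noteq> {}"

text \<open>\<open>\<theta> 1 < \<dots> < \<theta> k\<close> are the points of the preimage of \<open>V\<close> on one turn of the circle. Arc \<open>i\<close>
  is the image of the open interval from \<open>\<theta> i\<close> to \<open>\<theta> (i + 1)\<close>, where \<open>\<theta> (k + 1)\<close> means
  \<open>\<theta> 1 + 1\<close>; the choice of \<open>\<theta> 1\<close> is the choice of the starting arc.\<close>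

definition arc_labelling :: "diagram \<Rightarrow> complex set \<Rightarrow> nat \<Rightarrow> (nat \<Rightarrow> real) \<Rightarrow> bool" where
  "arc_labelling D V k \<theta> \<longleftrightarrow>
     k \<ge> 1 \<and> strict_mono_on {1..k} \<theta> \<and> \<theta> k < \<theta> 1 + 1 \<and>
     {x. curve D x \<in> V} = {\<theta> i + of_int z | i z. i \<in> {1..k}}"

text \<open>The arc that ends where arc \<open>i\<close> begins.\<close>

definition prev_arc :: "nat \<Rightarrow> nat \<Rightarrow> nat" where
  "prev_arc k i = (if i = 1 then k else i - 1)"

text \<open>For arc \<open>i\<close> beginning at a flat crossing: the arc that begins at the same crossing on the
  other strand.\<close>

definition partner :: "diagram \<Rightarrow> nat \<Rightarrow> (nat \<Rightarrow> real) \<Rightarrow> nat \<Rightarrow> nat" where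
  "partner D k \<theta> i = (THE j. j \<in> {1..k} \<and> j \<noteq> i \<and> curve D (\<theta> j) = curve D (\<theta> i))"

definition unit_row :: "('a, 'b) ring_scheme \<Rightarrow> nat \<Rightarrow> nat \<Rightarrow> 'a" where
  "unit_row R i l = (if l = i then \<one>\<^bsub>R\<^esub> else \<zero>\<^bsub>R\<^esub>)"

text \<open>In the first case \<open>(v\<^sub>1, v\<^sub>2)\<close>, the velocities of the other strand and of the strand of the
  arcs \<open>i - 1\<close> and \<open>i\<close>, is positively oriented, so these arcs lie on strand 2; in the second case
  they lie on strand 1.\<close>

definition coloring_entry :: "nat \<Rightarrow> diagram \<Rightarrow> nat \<Rightarrow> (nat \<Rightarrow> real) \<Rightarrow> nat \<Rightarrow> nat \<Rightarrow> free_ring set" where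
  "coloring_entry n D k \<theta> i l =
     (let R = Sn n; e = (\<lambda>h. unit_row R h l); p = prev_arc k i; m = partner D k \<theta> i;
          j = prev_arc k m in
      if curve D (\<theta> i) \<in> flat D then
        if orient (velocity (curve D) (\<theta> m)) (velocity (curve D) (\<theta> i)) > 0 then
          e i \<ominus>\<^bsub>R\<^esub> s_elt n \<otimes>\<^bsub>R\<^esub> e p \<ominus>\<^bsub>R\<^esub> t_elt n \<otimes>\<^bsub>R\<^esub> e j
        else
          e i \<ominus>\<^bsub>R\<^esub> sinv_elt n \<otimes>\<^bsub>R\<^esub> (\<one>\<^bsub>R\<^esub> \<ominus>\<^bsub>R\<^esub> t_elt n [^]\<^bsub>R\<^esub> (2::nat)) \<otimes>\<^bsub>R\<^esub> e p
            \<oplus>\<^bsub>R\<^esub> sinv_elt n \<otimes>\<^bsub>R\<^esub> t_elt n \<otimes>\<^bsub>R\<^esub> s_elt n \<otimes>\<^bsub>R\<^esub> e j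
      else e i \<ominus>\<^bsub>R\<^esub> e p)"

definition is_coloring_matrix ::
  "nat \<Rightarrow> diagram \<Rightarrow> complex set \<Rightarrow> nat \<Rightarrow> (nat \<Rightarrow> nat \<Rightarrow> free_ring set) \<Rightarrow> bool" where
  "is_coloring_matrix n D V k A \<longleftrightarrow>
     is_vertex_set D V \<and>
     (\<exists>\<theta>. arc_labelling D V k \<theta> \<and>
        (\<forall>i\<in>{1..k}. \<forall>l\<in>{1..k}. A i l = coloring_entry n D k \<theta> i l))"

end

theory Submission
  imports Defs
begin

text \<open>Cut the oriented circle open at a parameter \<open>b\<close> that is not a flat crossing, give the strand
leaving \<open>b\<close> the color \<open>1\<close>, and propagate colors through the crossings by the rows of the coloring
matrix, without asking that the colors match when the circle closes up. If \<open>out\<close> is the color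
with which the strand returns to \<open>b\<close>, then \<open>1 - out\<close> is the quasideterminant \<open>|A|\<^sub>i\<^sub>i\<close> for the arc
\<open>i\<close> that contains \<open>b\<close> (\<open>coloring_defect\<close>). Indeed \<open>|A|\<^sub>i\<^sub>i\<close> is the \<open>i\<close>-th entry of \<open>A x\<close> for the vector
\<open>x\<close> with \<open>x\<^sub>i = 1\<close> for which all other entries of \<open>A x\<close> vanish (\<open>quasidet_eq_defect\<close>, for the last index). Such a vector
exists because the matrix without row and column \<open>i\<close> is, modulo the nilpotent ideal generated
by \<open>t\<close>, unitriangular for the order in which the arcs follow \<open>i\<close>; a geometric series inverts it
(\<open>matrix_inverse_exists\<close>). Fake vertices are invisible to colorings of the circle, so only the
choice of \<open>i\<close> remains. If \<open>y\<close> is a row vector with \<open>y\<^sub>k = 1\<close> such that only the \<open>k\<close>-th entry of \<open>y A\<close>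
is nonzero, associativity of \<open>y A x\<close> gives \<open>y\<^sub>i |A|\<^sub>i\<^sub>i = |A|\<^sub>k\<^sub>k x\<^sub>k\<close>. Modulo \<open>t\<close> both \<open>y\<^sub>i\<close> and \<open>x\<^sub>k\<close> are
the product of the factors \<open>s\<close>, \<open>s\<^sup>-\<^sup>1\<close> and \<open>1\<close> met on the way from \<open>i\<close> to \<open>k\<close>, hence they are congruent
units, and this is why the unit factors \<open>U\<close>, \<open>W\<close> satisfy \<open>\<pi>(U W) = 1\<close> (\<open>defect_move_to_last\<close>).

It remains to compare two diagrams related by a step, and by the above it is enough to find
colorings of both with the same \<open>out\<close>. Reparametrisations and isotopies transport colorings.
For a Reidemeister move take \<open>b\<close> outside the square and change the coloring inside only; this
asks that a coloring of the picture before the move can be replaced by one of the picture after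
the move with the same colors at the boundary. At a crossing where strand 1 changes from \<open>p\<close> to
\<open>p'\<close> and strand 2 from \<open>q\<close> to \<open>q'\<close> the two rows of the matrix amount to \<open>q' = s q + t p\<close> and
\<open>p = s p' + t q'\<close>. In this form the two crossings of a second move impose the same equations
(\<open>crossing_bigon\<close>). For the third move, rescaling each color by a power of \<open>s\<close> leaves only the two
coefficients \<open>t\<close> and \<open>s\<^sup>-\<^sup>1 t s = t/(1 - t)\<close>, which commute, so that the move becomes a linear
identity over a commutative ring (\<open>acyclic_triangle\<close>, \<open>cyclic_triangle\<close>).

The rings \<open>S\<^sub>n\<close> are cosets inside a fixed type and their relations involve \<open>n\<close>. All computations
therefore take place in their product over all \<open>n\<close>, which is a type with ring operations; there
the relations read \<open>t s (1 - t) = s t\<close> and \<open>t s\<^sup>-\<^sup>1 (1 + t) = s\<^sup>-\<^sup>1 t\<close>, and only the last step projects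
to the component in question.\<close>

section \<open>The product of the rings\<close>

lemma relI_diff: "x \<in> relI n \<Longrightarrow> y \<in> relI n \<Longrightarrow> x - y \<in> relI n"
  using relI_add[of x n "- y"] relI_uminus[of y n] by simp

lemma relI_congruence:
  assumes "x - x' \<in> relI n"
  shows "y - y' \<in> relI n \<Longrightarrow> x + y - (x' + y') \<in> relI n"
    and "- x - - x' \<in> relI n"
    and "y - y' \<in> relI n \<Longrightarrow> x - y - (x' - y') \<in> relI n"
    and "y - y' \<in> relI n \<Longrightarrow> x * y - x' * y' \<in> relI n"
proof -
  show "- x - - x' \<in> relI n"
    using relI_uminus[OF assms] by (simp add: algebra_simps)
  assume y: "y - y' \<in> relI n"
  show "x + y - (x' + y') \<in> relI n"
    using relI_add[OF assms y] by (simp add: algebra_simps)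
  show "x - y - (x' - y') \<in> relI n"
    using relI_diff[OF assms y] by (simp add: algebra_simps)
  show "x * y - x' * y' \<in> relI n"
    using relI_add[OF relI_mult(2)[OF assms, of y] relI_mult(1)[OF y, of x']]
    by (simp add: algebra_simps)
qed

text \<open>The product of all \<open>S\<^sub>n\<close>. It is only given the classes ring and monoid with unit: that
\<open>0 \<noteq> 1\<close> would require a nonzero representation of \<open>S\<^sub>0\<close>.\<close>

quotient_type sring = "nat \<Rightarrow> free_ring" / "\<lambda>f g. \<forall>n. f n - g n \<in> relI n"
proof (rule equivpI)
  show "reflp (\<lambda>f g. \<forall>n. f n - g n \<in> relI n)"
    by (auto intro!: reflpI simp: relI_zero)
  show "symp (\<lambda>f g. \<forall>n. f n - g n \<in> relI n)"
    by (intro sympI allI) (metis relI_uminus minus_diff_eq)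
  show "transp (\<lambda>f g. \<forall>n. f n - g n \<in> relI n)"
  proof (rule transpI)
    fix f g h :: "nat \<Rightarrow> free_ring"
    assume *: "\<forall>n. f n - g n \<in> relI n" "\<forall>n. g n - h n \<in> relI n"
    have "f n - h n \<in> relI n" for n
      using relI_add[OF *[THEN spec, of n]] by simp
    then show "\<forall>n. f n - h n \<in> relI n" ..
  qed
qed

instantiation sring :: "{ring, monoid_mult}"
begin

lift_definition zero_sring :: sring is "\<lambda>_. 0" .
lift_definition one_sring :: sring is "\<lambda>_. 1" .

lift_definition plus_sring :: "sring \<Rightarrow> sring \<Rightarrow> sring" is "\<lambda>f g n. f n + g n"
  by (blast intro: relI_congruence(1))

lift_definition uminus_sring :: "sring \<Rightarrow> sring" is "\<lambda>f n. - f n"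
  by (blast intro: relI_congruence(2))

lift_definition minus_sring :: "sring \<Rightarrow> sring \<Rightarrow> sring" is "\<lambda>f g n. f n - g n"
  by (blast intro: relI_congruence(3))

lift_definition times_sring :: "sring \<Rightarrow> sring \<Rightarrow> sring" is "\<lambda>f g n. f n * g n"
  by (blast intro: relI_congruence(4))

instance
  by standard (transfer; simp add: relI_zero algebra_simps)+

end

lift_definition qs :: sring is "\<lambda>_. gen_s" .
lift_definition qsi :: sring is "\<lambda>_. gen_sbar" .
lift_definition qt :: sring is "\<lambda>_. gen_t" .

lemma s_sbar_relation: "gen_s * gen_sbar - 1 \<in> relI n" "gen_sbar * gen_s - 1 \<in> relI n"
  using rels_subset_relI[of n] by (auto simp: rels_def)

lemma qs_inverse: "qs * qsi = 1" and qsi_inverse: "qsi * qs = 1"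
  by (transfer, simp add: s_sbar_relation)+

lemma geometric_telescope: "(\<Sum>i=1..n. (x::'a::ring_1) ^ i) * (1 - x) = x - x ^ (n + 1)"
proof (induction n)
  case (Suc n)
  have "(\<Sum>i=1..Suc n. x ^ i) * (1 - x) = (\<Sum>i=1..n. x ^ i) * (1 - x) + x ^ Suc n * (1 - x)"
    by (simp add: distrib_right)
  then show ?case
    unfolding Suc by (simp add: right_diff_distrib power_Suc2 mult.assoc del: power_Suc)
qed simp

lemma alternating_telescope: "(\<Sum>i=1..n. (-1) ^ (i - 1) * (x::'a::ring_1) ^ i) * (1 + x) = x - (-1) ^ n * x ^ (n + 1)"
proof (induction n)
  case (Suc n)
  have "(\<Sum>i=1..Suc n. (-1) ^ (i - 1) * x ^ i) * (1 + x)
      = (\<Sum>i=1..n. (-1) ^ (i - 1) * x ^ i) * (1 + x) + (-1) ^ n * x ^ Suc n * (1 + x)"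
    by (simp add: distrib_right)
  then show ?case
    unfolding Suc by (simp add: distrib_left power_Suc2 mult.assoc del: power_Suc)
qed simp

text \<open>The sum \<open>t + \<dots> + t\<^sup>n\<close> becomes \<open>t/(1 - t)\<close> once \<open>t\<^sup>n\<^sup>+\<^sup>1 = 0\<close>; clearing the denominator gives a relation
that no longer mentions \<open>n\<close>.\<close>

lemma t_s_relation: "gen_t * gen_s * (1 - gen_t) - gen_s * gen_t \<in> relI n"
proof -
  let ?S = "\<Sum>i=1..n. gen_t ^ i"
  have "gen_t * gen_s - gen_s * ?S \<in> relI n" "gen_t ^ (n + 1) \<in> relI n"
    using rels_subset_relI[of n] by (auto simp: rels_def)
  from relI_diff[OF relI_mult(2)[OF this(1), of "1 - gen_t"] relI_mult(1)[OF this(2), of gen_s]]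
  have "(gen_t * gen_s - gen_s * ?S) * (1 - gen_t) - gen_s * gen_t ^ (n + 1) \<in> relI n" .
  also have "(gen_t * gen_s - gen_s * ?S) * (1 - gen_t) =
      gen_t * gen_s * (1 - gen_t) - gen_s * (?S * (1 - gen_t))"
    by (simp only: left_diff_distrib mult.assoc)
  finally show ?thesis
    unfolding geometric_telescope by (simp add: right_diff_distrib)
qed

lemma t_sbar_relation: "gen_t * gen_sbar * (1 + gen_t) - gen_sbar * gen_t \<in> relI n"
proof -
  let ?S = "\<Sum>i=1..n. (-1) ^ (i - 1) * gen_t ^ i"
  have "gen_t * gen_sbar - gen_sbar * ?S \<in> relI n" "gen_t ^ (n + 1) \<in> relI n"
    using rels_subset_relI[of n] by (auto simp: rels_def)
  from relI_diff[OF relI_mult(2)[OF this(1), of "1 + gen_t"]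
      relI_mult(1)[OF relI_mult(1)[OF this(2), of "(-1) ^ n"], of gen_sbar]]
  have "(gen_t * gen_sbar - gen_sbar * ?S) * (1 + gen_t)
      - gen_sbar * ((-1) ^ n * gen_t ^ (n + 1)) \<in> relI n" .
  also have "(gen_t * gen_sbar - gen_sbar * ?S) * (1 + gen_t) =
      gen_t * gen_sbar * (1 + gen_t) - gen_sbar * (?S * (1 + gen_t))"
    by (simp only: left_diff_distrib mult.assoc)
  finally show ?thesis
    unfolding alternating_telescope by (simp add: right_diff_distrib)
qed

lemma qt_qs: "qt * qs * (1 - qt) = qs * qt" and qt_qsi: "qt * qsi * (1 + qt) = qsi * qt"
  by (transfer, simp add: t_s_relation t_sbar_relation)+

section \<open>The t-adic filtration\<close>

section \<open>The t-adic filtration\<close>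

lemma free_ring_induct:
  assumes "\<And>c. P (Poly_Mapping.single 0 c)" "\<And>x. P (gen x)"
    and "\<And>x y. P x \<Longrightarrow> P y \<Longrightarrow> P (x + y)" "\<And>x y. P x \<Longrightarrow> P y \<Longrightarrow> P (x * y)"
  shows "P (x :: free_ring)"
proof -
  have single: "P (Poly_Mapping.single (Word u) c)" for u c
  proof (induction u)
    case Nil
    then show ?case using assms(1) by (simp add: zero_word_def)
  next
    case (Cons a u)
    have "Poly_Mapping.single (Word (a # u)) c = gen a * Poly_Mapping.single (Word u) c"
      by (simp add: gen_def mult_single)
    then show ?case using assms(2,4) Cons by metis
  qed
  have sum: "P (sum f A)" if "finite A" "\<And>i. i \<in> A \<Longrightarrow> P (f i)" for f :: "word \<Rightarrow> free_ring" and A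
    using that by (induction A rule: finite_induct)
      (auto intro: assms(3) simp: assms(1)[of 0, simplified])
  have "x = (\<Sum>w\<in>Poly_Mapping.keys x. Poly_Mapping.single w (Poly_Mapping.lookup x w))"
    by (rule poly_mapping_eqI)
      (auto simp: lookup_sum lookup_single when_def in_keys_iff)
  moreover have "P \<dots>"
    by (intro sum finite_keys) (metis single word.exhaust)
  ultimately show ?thesis by metis
qed

text \<open>Moving \<open>t\<close> to the left past any element is possible since it is possible for the three
generators. This makes the left multiples of a power of \<open>t\<close> a two-sided ideal.\<close>

lemma t_normal: "\<exists>r'. r * gen_t - gen_t * r' \<in> relI n"
proof (induction r rule: free_ring_induct)
  case (1 c)
  have "Poly_Mapping.single 0 c * gen_t - gen_t * Poly_Mapping.single 0 c = 0"
    by (simp add: gen_def mult_single)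
  then show ?case using relI_zero by metis
next
  case (2 x)
  show ?case
  proof (cases x)
    case Let_s
    then show ?thesis
      using relI_uminus[OF t_s_relation[of n]]
      by (intro exI[of _ "gen_s * (1 - gen_t)"]) (simp add: mult.assoc)
  next
    case Let_sbar
    then show ?thesis
      using relI_uminus[OF t_sbar_relation[of n]]
      by (intro exI[of _ "gen_sbar * (1 + gen_t)"]) (simp add: mult.assoc)
  next
    case Let_t
    then show ?thesis
      by (intro exI[of _ gen_t]) (simp add: relI_zero)
  qed
next
  case (3 x y)
  then obtain x' y' where "x * gen_t - gen_t * x' \<in> relI n" "y * gen_t - gen_t * y' \<in> relI n"
    by blast
  from relI_add[OF this] show ?case
    by (intro exI[of _ "x' + y'"]) (simp add: algebra_simps)
next
  case (4 x y)
  then obtain x' y' where *: "x * gen_t - gen_t * x' \<in> relI n" "y * gen_t - gen_t * y' \<in> relI n"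
    by blast
  from relI_add[OF relI_mult(1)[OF *(2), of x] relI_mult(2)[OF *(1), of y']] show ?case
    by (intro exI[of _ "x' * y'"]) (simp add: algebra_simps)
qed

lemma t_power_normal: "\<exists>r'. r * gen_t ^ a - gen_t ^ a * r' \<in> relI n"
proof (induction a arbitrary: r)
  case 0
  then show ?case by (intro exI[of _ r]) (simp add: relI_zero)
next
  case (Suc a)
  obtain r1 where r1: "r * gen_t - gen_t * r1 \<in> relI n" using t_normal by blast
  obtain r2 where r2: "r1 * gen_t ^ a - gen_t ^ a * r2 \<in> relI n" using Suc by blast
  from relI_add[OF relI_mult(2)[OF r1, of "gen_t ^ a"] relI_mult(1)[OF r2, of gen_t]] show ?case
    by (intro exI[of _ r2]) (simp add: algebra_simps)
qed

text \<open>The preimage in the free ring of the ideal of \<open>S\<^sub>n\<close> generated by the \<open>a\<close>-th power of \<open>t\<close>.\<close>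

definition tpow :: "nat \<Rightarrow> nat \<Rightarrow> free_ring set" where
  "tpow n a = {x. \<exists>r. x - gen_t ^ a * r \<in> relI n}"

lemma tpow_add: "x \<in> tpow n a \<Longrightarrow> y \<in> tpow n a \<Longrightarrow> x + y \<in> tpow n a"
proof -
  assume "x \<in> tpow n a" "y \<in> tpow n a"
  then obtain r q where "x - gen_t ^ a * r \<in> relI n" "y - gen_t ^ a * q \<in> relI n"
    by (auto simp: tpow_def)
  from relI_add[OF this] show ?thesis
    unfolding tpow_def by (intro CollectI exI[of _ "r + q"]) (simp add: algebra_simps)
qed

lemma tpow_mult: "x \<in> tpow n a \<Longrightarrow> y \<in> tpow n b \<Longrightarrow> x * y \<in> tpow n (a + b)"
proof -
  assume "x \<in> tpow n a" "y \<in> tpow n b"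
  then obtain r q where *: "x - gen_t ^ a * r \<in> relI n" "y - gen_t ^ b * q \<in> relI n"
    by (auto simp: tpow_def)
  obtain r' where r': "r * gen_t ^ b - gen_t ^ b * r' \<in> relI n" using t_power_normal by blast
  have "gen_t ^ a * (r * gen_t ^ b - gen_t ^ b * r') * q \<in> relI n"
    by (intro relI_mult r')
  from relI_add[OF relI_congruence(4)[OF *] this] show ?thesis
    unfolding tpow_def
    by (intro CollectI exI[of _ "r' * q"]) (simp add: algebra_simps power_add)
qed

lemma relI_tpow: "x \<in> relI n \<Longrightarrow> x \<in> tpow n a"
  unfolding tpow_def by (intro CollectI exI[of _ 0]) simp

lemma tpow_0: "x \<in> tpow n 0"
  unfolding tpow_def by (intro CollectI exI[of _ x]) (simp add: relI_zero)

lemma tpow_above: "tpow n (Suc n) = relI n"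
proof -
  have "gen_t ^ Suc n * r \<in> relI n" for r
    using rels_subset_relI[of n] by (intro relI_mult) (auto simp: rels_def)
  then have "x \<in> relI n" if "x - gen_t ^ Suc n * r \<in> relI n" for x r
    using relI_add[OF that, of "gen_t ^ Suc n * r"] by simp
  then show ?thesis
    using relI_tpow[of _ n "Suc n"] by (auto simp: tpow_def)
qed

text \<open>Divisibility by \<open>t\<close> in \<open>S\<^sub>n\<close> is the same as vanishing in \<open>S\<^sub>0\<close>, so the condition on
\<open>\<pi>\<^sub>0\<^sub>,\<^sub>n\<close> becomes a congruence modulo \<open>t\<close>.\<close>

lemma tpow_1: "tpow n 1 = relI 0"
proof
  have t: "gen_t \<in> relI 0"
    using rels_subset_relI[of 0] by (simp add: rels_def)
  show "tpow n 1 \<subseteq> relI 0"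
  proof
    fix x assume "x \<in> tpow n 1"
    then obtain r where "x - gen_t * r \<in> relI n" by (auto simp: tpow_def)
    then show "x \<in> relI 0"
      using relI_add[of "x - gen_t * r" 0 "gen_t * r"] relI_subset relI_mult(2)[OF t, of r] by auto
  qed
  have mult: "x * y \<in> tpow n 1" "y * x \<in> tpow n 1" if "x \<in> tpow n 1" for x y
    using tpow_mult[OF that tpow_0[of y]] tpow_mult[OF tpow_0[of y] that] by simp_all
  have uminus: "- x \<in> tpow n 1" if "x \<in> tpow n 1" for x
    using mult(1)[OF that, of "-1"] by simp
  have inv: "\<ominus>\<^bsub>FreeR\<^esub> x = - x" for x
    using abelian_group.minus_equality[OF ring.is_abelian_group[OF ring_FreeR], of "- x" x]
    by (simp add: ring_of_type_algebra_def)
  have "subgroup (tpow n 1) (add_monoid FreeR)"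
  proof (rule group.subgroupI[OF abelian_group.a_group[OF ring.is_abelian_group[OF ring_FreeR]]])
    show "inv\<^bsub>add_monoid FreeR\<^esub> x \<in> tpow n 1" if "x \<in> tpow n 1" for x
      using uminus[OF that] inv[of x] by (simp add: a_inv_def)
  qed (use relI_tpow[OF relI_zero] in \<open>auto simp: ring_of_type_algebra_def tpow_add\<close>)
  then have "ideal (tpow n 1) FreeR"
    by (intro idealI ring_FreeR) (simp_all add: ring_of_type_algebra_def mult del: One_nat_def)
  moreover have "gen_t \<in> tpow n 1"
    unfolding tpow_def by (intro CollectI exI[of _ 1]) (simp add: relI_zero)
  moreover have "rels 0 \<subseteq> tpow n 1"
  proof -
    have "gen_s * gen_sbar - 1 \<in> relI n" "gen_sbar * gen_s - 1 \<in> relI n"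
      using rels_subset_relI[of n] by (auto simp: rels_def)
    then show ?thesis
      using calculation(2) by (auto simp: rels_def relI_tpow mult simp del: One_nat_def)
  qed
  ultimately show "relI 0 \<subseteq> tpow n 1"
    unfolding relI_def[of 0] using ring.genideal_minimal[OF ring_FreeR] by blast
qed

lemma tpow_cong: "x - y \<in> relI n \<Longrightarrow> x \<in> tpow n a \<longleftrightarrow> y \<in> tpow n a"
  using tpow_add[of "x - y" n a y] tpow_add[of "- (x - y)" n a x] relI_tpow relI_uminus
  by fastforce

lift_definition tdiv :: "nat \<Rightarrow> nat \<Rightarrow> sring \<Rightarrow> bool" is "\<lambda>n a f. f n \<in> tpow n a"
  by (simp add: tpow_cong)

lemma tdiv_0: "tdiv n 0 x"
  by (induct x rule: sring.abs_induct) (simp add: tdiv.abs_eq tpow_0)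

lemma tdiv_zero: "tdiv n a 0"
  by transfer (simp add: relI_tpow[OF relI_zero])

lemma tdiv_add: "tdiv n a x \<Longrightarrow> tdiv n a y \<Longrightarrow> tdiv n a (x + y)"
  by transfer (simp add: tpow_add)

lemma tdiv_mult: "tdiv n a x \<Longrightarrow> tdiv n b y \<Longrightarrow> tdiv n (a + b) (x * y)"
  by transfer (simp add: tpow_mult)

lemma tdiv_mult_left: "tdiv n a y \<Longrightarrow> tdiv n a (x * y)"
  using tdiv_mult[OF tdiv_0, of n a y x] by simp

lemma tdiv_mult_right: "tdiv n a x \<Longrightarrow> tdiv n a (x * y)"
  using tdiv_mult[OF _ tdiv_0, of n a x y] by simp

lemma tdiv_uminus: "tdiv n a x \<Longrightarrow> tdiv n a (- x)"
  using tdiv_mult_left[of n a x "- 1"] by simp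

lemma tdiv_diff: "tdiv n a x \<Longrightarrow> tdiv n a y \<Longrightarrow> tdiv n a (x - y)"
  using tdiv_add[OF _ tdiv_uminus, of n a x y] by simp

lemma tdiv_sum: "(\<And>i. i \<in> A \<Longrightarrow> tdiv n a (f i)) \<Longrightarrow> tdiv n a (sum f A)"
  by (induction A rule: infinite_finite_induct) (auto simp: tdiv_zero tdiv_add)

lemma tdiv_eq: "\<forall>n. tdiv n (Suc n) (x - y) \<Longrightarrow> x = y"
  by transfer (simp add: tpow_above)

text \<open>Elements of the product ring can be chosen componentwise. With \<open>c n\<close> the partial sums of a
series this yields its limit, although no topology is present.\<close>

lemma tdiv_glue: "\<exists>b. \<forall>n. tdiv n (Suc n) (b - c n)"
proof -
  have "\<exists>b. \<forall>n. b n - r n n \<in> tpow n (Suc n)" for r :: "nat \<Rightarrow> nat \<Rightarrow> free_ring"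
    by (rule exI[of _ "\<lambda>n. r n n"]) (simp add: relI_tpow relI_zero)
  then show ?thesis by transfer
qed

abbreviation tsmall :: "sring \<Rightarrow> bool" where
  "tsmall x \<equiv> \<forall>n. tdiv n 1 x"

lemma tsmall_qt: "tsmall qt"
  by transfer (auto simp: tpow_def intro!: exI[of _ 1] relI_zero)

section \<open>Matrices that are unitriangular modulo t\<close>

definition delta :: "'i \<Rightarrow> 'i \<Rightarrow> sring" where
  "delta i l = (if i = l then 1 else 0)"

lemma sum_delta [simp]:
  assumes "finite I" "i \<in> I"
  shows "(\<Sum>h\<in>I. delta i h * f h) = f i" "(\<Sum>h\<in>I. f h * delta h i) = f i"
  using assms by (simp_all add: delta_def if_distrib[of "\<lambda>x. x * _"] if_distrib[of "\<lambda>x. _ * x"] cong: if_cong)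

text \<open>Put \<open>A = 1 - M\<close>. Each factor of a product of entries of \<open>M\<close> along a path of indices either goes
down in rank or is divisible by \<open>t\<close>, so the entries of \<open>M\<^sup>p\<close> are divisible by high powers of \<open>t\<close>
for large \<open>p\<close>. In every component the geometric series of \<open>M\<close> is a finite sum, and it is a
two-sided inverse.\<close>

lemma matrix_inverse_exists:
  fixes A :: "'i \<Rightarrow> 'i \<Rightarrow> sring" and \<rho> :: "'i \<Rightarrow> nat"
  assumes fin: "finite I"
    and small: "\<And>i h. i \<in> I \<Longrightarrow> h \<in> I \<Longrightarrow> \<rho> i \<le> \<rho> h \<Longrightarrow> tsmall (delta i h - A i h)"
  shows "\<exists>B. \<forall>i\<in>I. \<forall>l\<in>I. (\<Sum>h\<in>I. A i h * B h l) = delta i l \<and> (\<Sum>h\<in>I. B i h * A h l) = delta i l"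
proof -
  define M where "M i h = delta i h - A i h" for i h
  define mp where "mp = rec_nat (delta :: 'i \<Rightarrow> 'i \<Rightarrow> sring) (\<lambda>_ P i l. \<Sum>h\<in>I. M i h * P h l)"
  have mp0: "mp 0 = delta" and mpS: "mp (Suc p) = (\<lambda>i l. \<Sum>h\<in>I. M i h * mp p h l)" for p
    by (simp_all add: mp_def)
  have mpS': "mp (Suc p) i l = (\<Sum>h\<in>I. mp p i h * M h l)" if "i \<in> I" "l \<in> I" for p i l
    using that
  proof (induction p arbitrary: i)
    case 0
    then show ?case by (simp add: mp0 mpS fin)
  next
    case (Suc p)
    have "mp (Suc (Suc p)) i l = (\<Sum>h\<in>I. M i h * mp (Suc p) h l)"
      by (subst mpS) simp
    also have "\<dots> = (\<Sum>h\<in>I. \<Sum>h'\<in>I. M i h * mp p h h' * M h' l)"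
      using Suc by (intro sum.cong refl) (simp add: sum_distrib_left mult.assoc)
    also have "\<dots> = (\<Sum>h'\<in>I. \<Sum>h\<in>I. M i h * mp p h h' * M h' l)"
      by (rule sum.swap)
    also have "\<dots> = (\<Sum>h'\<in>I. mp (Suc p) i h' * M h' l)"
      by (simp add: mpS sum_distrib_right)
    finally show ?case .
  qed
  obtain K where K: "\<rho> i < K" if "i \<in> I" for i
    using fin by (metis finite_imageI finite_nat_set_iff_bounded imageI)
  \<comment> \<open>A path with at most \<open>a - 1\<close> factors \<open>t\<close> raises the rank by less than \<open>K\<close> at each of them and
    lowers it at all the other steps, which bounds its length.\<close>
  have div: "tdiv n a (mp p i l)" if "i \<in> I" "l \<in> I" "\<rho> i + K * a < p + \<rho> l + K" for n a p i l
    using that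
  proof (induction p arbitrary: i a)
    case 0
    show ?case
    proof (cases "a = 0")
      case True
      then show ?thesis by (simp add: tdiv_0)
    next
      case False
      then have "K * 1 \<le> K * a" by (intro mult_le_mono2) simp
      then have "i \<noteq> l" using 0 by auto
      then show ?thesis by (simp add: mp0 delta_def tdiv_zero)
    qed
  next
    case (Suc p)
    have "tdiv n a (M i h * mp p h l)" if h: "h \<in> I" for h
    proof (cases "\<rho> h < \<rho> i")
      case True
      then show ?thesis
        using Suc.prems h by (intro tdiv_mult_left Suc.IH) auto
    next
      case False
      show ?thesis
      proof (cases a)
        case 0
        then show ?thesis by (simp add: tdiv_0)
      next
        case (Suc a')
        have "tdiv n a' (mp p h l)"
          using Suc.prems h K[OF h] Suc by (intro Suc.IH) auto
        moreover have "tdiv n 1 (M i h)"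
          using small[OF Suc.prems(1) h] False by (simp add: M_def)
        ultimately show ?thesis using tdiv_mult Suc by fastforce
      qed
    qed
    then show ?case by (simp add: mpS tdiv_sum)
  qed
  define N where "N n = K * (n + 2)" for n
  have N: "tdiv n (Suc n) (mp (N n) i l)" if "i \<in> I" "l \<in> I" for n i l
    using K[OF that(1)] that by (intro div) (auto simp: N_def algebra_simps)
  define C where "C n i l = (\<Sum>p<N n. mp p i l)" for n i l
  have "\<exists>B. \<forall>i l n. tdiv n (Suc n) (B i l - C n i l)"
    using tdiv_glue[of "\<lambda>n. C n i l" for i l] by metis
  then obtain B where B: "tdiv n (Suc n) (B i l - C n i l)" for i l n by blast
  have tele: "(\<Sum>p<m. mp p i l) - (\<Sum>p<m. mp (Suc p) i l) = delta i l - mp m i l" for m i l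
    by (induction m) (simp_all add: mp0 algebra_simps)
  have A: "A i h = delta i h - M i h" for i h
    by (simp add: M_def)
  have L: "(\<Sum>h\<in>I. A i h * C n h l) = delta i l - mp (N n) i l" if "i \<in> I" for n i l
  proof -
    have "(\<Sum>h\<in>I. M i h * C n h l) = (\<Sum>h\<in>I. \<Sum>p<N n. M i h * mp p h l)"
      by (simp add: C_def sum_distrib_left)
    also have "\<dots> = (\<Sum>p<N n. mp (Suc p) i l)"
      by (subst sum.swap) (simp add: mpS)
    finally show ?thesis
      using that tele[where m = "N n" and i = i and l = l] by (simp add: A left_diff_distrib sum_subtractf fin C_def)
  qed
  have R: "(\<Sum>h\<in>I. C n i h * A h l) = delta i l - mp (N n) i l" if "i \<in> I" "l \<in> I" for n i l
  proof -
    have "(\<Sum>h\<in>I. C n i h * M h l) = (\<Sum>h\<in>I. \<Sum>p<N n. mp p i h * M h l)"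
      by (simp add: C_def sum_distrib_right)
    also have "\<dots> = (\<Sum>p<N n. mp (Suc p) i l)"
      using that by (subst sum.swap) (simp add: mpS')
    finally show ?thesis
      using that tele[where m = "N n" and i = i and l = l] by (simp add: A right_diff_distrib sum_subtractf fin C_def)
  qed
  have "(\<Sum>h\<in>I. A i h * B h l) = delta i l" if "i \<in> I" "l \<in> I" for i l
  proof (intro tdiv_eq allI)
    fix n
    have "(\<Sum>h\<in>I. A i h * B h l) - delta i l
        = (\<Sum>h\<in>I. A i h * (B h l - C n h l)) - mp (N n) i l"
      using L[OF that(1), of n l] by (simp add: right_diff_distrib sum_subtractf)
    then show "tdiv n (Suc n) ((\<Sum>h\<in>I. A i h * B h l) - delta i l)"
      using that by (simp add: tdiv_diff tdiv_sum tdiv_mult_left B N)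
  qed
  moreover have "(\<Sum>h\<in>I. B i h * A h l) = delta i l" if "i \<in> I" "l \<in> I" for i l
  proof (intro tdiv_eq allI)
    fix n
    have "(\<Sum>h\<in>I. B i h * A h l) - delta i l
        = (\<Sum>h\<in>I. (B i h - C n i h) * A h l) - mp (N n) i l"
      using R[OF that, of n] by (simp add: left_diff_distrib sum_subtractf)
    then show "tdiv n (Suc n) ((\<Sum>h\<in>I. B i h * A h l) - delta i l)"
      using that by (simp add: tdiv_diff tdiv_sum tdiv_mult_right B N)
  qed
  ultimately show ?thesis by blast
qed

definition is_unit_q :: "sring \<Rightarrow> bool" where
  "is_unit_q u \<longleftrightarrow> (\<exists>v. u * v = 1 \<and> v * u = 1)"

lemma is_unit_q_one_plus: "tsmall x \<Longrightarrow> is_unit_q (1 + x)"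
  using matrix_inverse_exists[of "{()}" "\<lambda>_. 0" "\<lambda>_ _. 1 + x"]
  by (auto simp: is_unit_q_def delta_def tdiv_uminus)

lemma is_unit_q_mult: "is_unit_q u \<Longrightarrow> is_unit_q v \<Longrightarrow> is_unit_q (u * v)"
  unfolding is_unit_q_def by (metis mult.assoc mult_1)

lemma is_unit_q_cong:
  assumes u: "is_unit_q u" and small: "tsmall (v - u)"
  shows "is_unit_q v"
proof -
  obtain w where w: "u * w = 1" "w * u = 1" using u by (auto simp: is_unit_q_def)
  have "v = u * (1 + w * (v - u))"
    by (simp add: distrib_left mult.assoc[symmetric] w)
  moreover have "is_unit_q (1 + w * (v - u))"
    using small by (intro is_unit_q_one_plus) (simp add: tdiv_mult_left)
  ultimately show ?thesis using is_unit_q_mult[OF u] by metis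
qed

section \<open>Projection to the component n\<close>

lemma coset_eq_iff: "relI n +>\<^bsub>FreeR\<^esub> x = relI n +>\<^bsub>FreeR\<^esub> y \<longleftrightarrow> x - y \<in> relI n"
proof
  assume "relI n +>\<^bsub>FreeR\<^esub> x = relI n +>\<^bsub>FreeR\<^esub> y"
  moreover have "x \<in> relI n +>\<^bsub>FreeR\<^esub> x"
    using relI_zero by (force simp: coset_relI)
  ultimately show "x - y \<in> relI n" by (auto simp: coset_relI)
next
  assume *: "x - y \<in> relI n"
  have "\<exists>h'. h + x = h' + y \<and> h' \<in> relI n" "\<exists>h'. h + y = h' + x \<and> h' \<in> relI n"
    if "h \<in> relI n" for h
    using relI_add[OF that *] relI_diff[OF that *]
    by (intro exI[of _ "h + (x - y)"] exI[of _ "h - (x - y)"]; simp)+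
  then show "relI n +>\<^bsub>FreeR\<^esub> x = relI n +>\<^bsub>FreeR\<^esub> y"
    by (auto simp: coset_relI)
qed

lift_definition proj :: "nat \<Rightarrow> sring \<Rightarrow> free_ring set" is "\<lambda>n f. relI n +>\<^bsub>FreeR\<^esub> f n"
  by (simp add: coset_eq_iff)

lemma proj_eq_iff: "proj n x = proj n y \<longleftrightarrow> tdiv n (Suc n) (x - y)"
  by transfer (simp add: coset_eq_iff tpow_above)

lemma carrier_Sn: "carrier (Sn n) = range (\<lambda>x. relI n +>\<^bsub>FreeR\<^esub> x)"
  by (auto simp: Sn_def FactRing_simps ring_of_type_algebra_def a_r_coset_def)

lemma proj_closed: "proj n x \<in> carrier (Sn n)"
  unfolding carrier_Sn by transfer auto

lemma proj_surj: "c \<in> carrier (Sn n) \<Longrightarrow> \<exists>x. proj n x = c"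
proof -
  assume "c \<in> carrier (Sn n)"
  then obtain r where "c = relI n +>\<^bsub>FreeR\<^esub> r" by (auto simp: carrier_Sn)
  then have "proj n (abs_sring (\<lambda>_. r)) = c"
    by (simp add: proj.abs_eq)
  then show ?thesis by blast
qed

lemma proj_hom:
  "proj n (x + y) = proj n x \<oplus>\<^bsub>Sn n\<^esub> proj n y"
  "proj n (x * y) = proj n x \<otimes>\<^bsub>Sn n\<^esub> proj n y"
  "proj n 1 = \<one>\<^bsub>Sn n\<^esub>" "proj n 0 = \<zero>\<^bsub>Sn n\<^esub>"
proof -
  have h: "(\<lambda>x. relI n +>\<^bsub>FreeR\<^esub> x) \<in> ring_hom FreeR (Sn n)"
    unfolding Sn_def by (rule ideal.rcos_ring_hom[OF ideal_relI])
  have F: "x \<in> carrier FreeR" "x \<otimes>\<^bsub>FreeR\<^esub> y = x * y" "x \<oplus>\<^bsub>FreeR\<^esub> y = x + y" "\<one>\<^bsub>FreeR\<^esub> = 1" for x y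
    by (simp_all add: ring_of_type_algebra_def)
  note m = ring_hom_mult[OF h F(1) F(1)] ring_hom_add[OF h F(1) F(1)] ring_hom_one[OF h]
  show "proj n (x + y) = proj n x \<oplus>\<^bsub>Sn n\<^esub> proj n y" "proj n (x * y) = proj n x \<otimes>\<^bsub>Sn n\<^esub> proj n y"
      "proj n 1 = \<one>\<^bsub>Sn n\<^esub>"
    using m by (transfer; simp add: F)+
  have "proj n 0 = relI n"
    by transfer (auto simp: coset_relI)
  then show "proj n 0 = \<zero>\<^bsub>Sn n\<^esub>"
    by (simp add: Sn_def FactRing_def)
qed

lemma proj_uminus: "proj n (- x) = \<ominus>\<^bsub>Sn n\<^esub> proj n x"
  using abelian_group.minus_equality[OF ring.is_abelian_group[OF ring_Sn], of n "proj n (- x)" "proj n x"]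
  by (simp add: proj_closed proj_hom[symmetric])

lemma proj_diff: "proj n (x - y) = proj n x \<ominus>\<^bsub>Sn n\<^esub> proj n y"
  using proj_hom(1)[of n x "- y"] by (simp add: proj_uminus a_minus_def)

lemma proj_sum: "finite I \<Longrightarrow> proj n (sum f I) = (\<Oplus>\<^bsub>Sn n\<^esub>i\<in>I. proj n (f i))"
proof (induction I rule: finite_induct)
  case empty
  then show ?case
    by (simp add: proj_hom ring_Sn abelian_monoid.finsum_empty abelian_group.axioms(1) ring.is_abelian_group)
next
  case (insert i I)
  then show ?case
    by (simp add: proj_hom proj_closed abelian_monoid.finsum_insert[OF abelian_group.axioms(1)[OF ring.is_abelian_group[OF ring_Sn]]])
qed

lemma proj_generators: "proj n qs = s_elt n" "proj n qsi = sinv_elt n" "proj n qt = t_elt n"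
  unfolding s_elt_def sinv_elt_def t_elt_def by (transfer, simp)+

lemma pi0_proj_eq_one:
  assumes "tdiv n 1 (x - 1)"
  shows "pi0 (proj n x) = \<one>\<^bsub>Sn 0\<^esub>"
proof -
  have "pi0 (proj n x) = proj 0 1"
    using assms by transfer (simp only: pi0_coset coset_eq_iff tpow_1)
  then show ?thesis by (simp add: proj_hom)
qed

section \<open>The crossing relation\<close>

text \<open>Strand 1 enters with color \<open>p\<close> and leaves with \<open>p'\<close>, strand 2 enters with \<open>q\<close> and leaves with
\<open>q'\<close>. The second equation is the row \<open>p' = s\<^sup>-\<^sup>1 (1 - t\<^sup>2) p - s\<^sup>-\<^sup>1 t s q\<close> rewritten with the first one.\<close>

definition crossing :: "sring \<Rightarrow> sring \<Rightarrow> sring \<Rightarrow> sring \<Rightarrow> bool" where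
  "crossing p p' q q' \<longleftrightarrow> q' = qs * q + qt * p \<and> p = qs * p' + qt * q'"

text \<open>This is \<open>t/(1 - t)\<close>.\<close>

definition qk :: sring where "qk = qsi * qt * qs"

lemma qs_cancel [simp]: "qs * (qsi * x) = x" "qsi * (qs * x) = x"
  by (simp_all add: mult.assoc[symmetric] qs_inverse qsi_inverse)

lemma qk_qt: "qk * qt = qk - qt" and qt_qk: "qt * qk = qk - qt"
proof -
  have "qk - qk * qt = qsi * (qt * qs * (1 - qt))"
    by (simp add: qk_def right_diff_distrib mult.assoc)
  also have "\<dots> = qt"
    by (simp add: qt_qs)
  finally show "qk * qt = qk - qt"
    by (metis diff_diff_eq2 add_diff_cancel_left')
  have "qt + qt * qk = qt * qsi * (1 + qt) * qs"
    by (simp add: qk_def distrib_left distrib_right mult.assoc qsi_inverse)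
  also have "\<dots> = qk"
    by (simp add: qt_qsi qk_def)
  finally show "qt * qk = qk - qt"
    by (metis add_diff_cancel_left')
qed

text \<open>The same relation for the colors of \<open>p\<close> and \<open>q'\<close> divided by \<open>s\<close>: the coefficient \<open>t\<close> is replaced
by its conjugate.\<close>

lemma crossing_shift:
  "crossing p p' q q' \<longleftrightarrow> qsi * q' = q + qk * (qsi * p) \<and> qsi * p = p' + qk * (qsi * q')"
proof -
  have eq: "qsi * x = y \<longleftrightarrow> x = qs * y" for x y
    by (metis qs_cancel)
  show ?thesis
    unfolding crossing_def eq by (simp add: qk_def algebra_simps mult.assoc)
qed

lemma qk_qt_left: "qk * (qt * x) = qk * x - qt * x" "qt * (qk * x) = qk * x - qt * x"
  by (simp_all add: mult.assoc[symmetric] qk_qt qt_qk left_diff_distrib)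

text \<open>With commuting coefficients \<open>a\<close>, \<open>b\<close> subject to \<open>a b = a - b\<close> every polynomial in them is a
combination of powers of \<open>a\<close> and powers of \<open>b\<close>, so linear identities are checked by rewriting.
The colors on the inner edges determine all others without division.\<close>

lemma acyclic_triangle_commuting:
  fixes a b :: sring
  assumes ab: "\<And>x. a * (b * x) = a * x - b * x" "\<And>x. b * (a * x) = a * x - b * x"
    and M1: "M1 = m0 + a * T0" and T0: "T0 = t1 + a * M1" and b1: "b1 = B0 + b * t1"
    and t1: "t1 = T2 + b * b1" and B2: "B2 = b1 + a * M1" and M1': "M1 = m2 + a * B2"
  shows "\<exists>M1' b1' t1'. b1' = B0 + b * m0 \<and> m0 = M1' + b * b1' \<and> B2 = b1' + a * T0 \<and>
      T0 = t1' + a * B2 \<and> t1' = T2 + b * m2 \<and> m2 = M1' + b * t1'"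
proof -
  have e: "m0 = M1 - a * T0" "B0 = b1 - b * t1" "T2 = t1 - b * b1" "m2 = M1 - a * B2"
    using M1 b1 t1 M1' by (simp_all add: eq_diff_eq)
  show ?thesis
    unfolding e unfolding B2 unfolding T0
    by (rule exI[of _ "M1 - a * (t1 + a * M1) - b * (b1 - b * t1 + b * (M1 - a * (t1 + a * M1)))"],
        rule exI[of _ "b1 - b * t1 + b * (M1 - a * (t1 + a * M1))"],
        rule exI[of _ "t1 + a * M1 - a * (b1 + a * M1)"])
      (simp add: algebra_simps ab)
qed

lemma acyclic_triangle_commuting_converse:
  fixes a b :: sring
  assumes ab: "\<And>x. a * (b * x) = a * x - b * x" "\<And>x. b * (a * x) = a * x - b * x"
    and b1: "b1' = B0 + b * m0" and m0: "m0 = M1' + b * b1'" and B2: "B2 = b1' + a * T0"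
    and T0: "T0 = t1' + a * B2" and t1: "t1' = T2 + b * m2" and m2: "m2 = M1' + b * t1'"
  shows "\<exists>M1 b1 t1. M1 = m0 + a * T0 \<and> T0 = t1 + a * M1 \<and> b1 = B0 + b * t1 \<and> t1 = T2 + b * b1 \<and>
      B2 = b1 + a * M1 \<and> M1 = m2 + a * B2"
proof -
  have e: "T2 = t1' - b * m2" "M1' = m0 - b * b1'" "t1' = T0 - a * B2"
    using t1 m0 T0 by (simp_all add: eq_diff_eq)
  show ?thesis
    unfolding e(1) unfolding m2 unfolding e(2,3) unfolding B2 unfolding b1
    by (rule exI[of _ "m0 + a * T0"],
        rule exI[of _ "B0 + b * (T0 - a * (m0 + a * T0))"],
        rule exI[of _ "T0 - a * (m0 + a * T0)"])
      (simp add: algebra_simps ab)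
qed

lemma cyclic_triangle_commuting:
  fixes a b :: sring
  assumes ab: "\<And>x. a * (b * x) = a * x - b * x" "\<And>x. b * (a * x) = a * x - b * x"
    and x1: "x1 = x0 + a * y1" and y1: "y1 = y2 + a * x1" and z1: "z1 = z0 + a * x1"
    and x1': "x1 = x2 + a * z1" and y1': "y1 = y0 + a * z1" and z1': "z1 = z2 + a * y1"
  shows "\<exists>x1' y1' z1'. z2 = z1' + b * x0 \<and> x0 = x1' + b * z2 \<and> y2 = y1' + b * z0 \<and> z0 = z1' + b * y2 \<and>
      x2 = x1' + b * y0 \<and> y0 = y1' + b * x2"
proof -
  have e: "x0 = x1 - a * y1" "y2 = y1 - a * x1" "z0 = z1 - a * x1" "x2 = x1 - a * z1"
      "y0 = y1 - a * z1" "z2 = z1 - a * y1"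
    using x1 apply (simp add: eq_diff_eq)
    using y1 apply (simp add: eq_diff_eq)
    using z1 apply (simp add: eq_diff_eq)
    using x1' apply (simp add: eq_diff_eq)
    using y1' apply (simp add: eq_diff_eq)
    using z1' apply (simp add: eq_diff_eq)
    done
  show ?thesis
    unfolding e
    by (rule exI[of _ "x1 - a * y1 - b * (z1 - a * y1)"],
        rule exI[of _ "y1 - a * x1 - b * (z1 - a * x1)"],
        rule exI[of _ "z1 - a * y1 - b * (x1 - a * y1)"])
      (simp add: algebra_simps ab)
qed

text \<open>The incoming color of strand 1 and the outgoing color of strand 2 can be solved for once
\<open>1 - a\<^sup>2\<close> is invertible.\<close>

lemma solve_crossing:
  fixes a u p' q :: sring
  assumes u: "u * (1 - a * a) = 1" "(1 - a * a) * u = 1"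
  defines "p \<equiv> u * (p' + a * q)" and "q' \<equiv> u * (q + a * p')"
  shows "q' = q + a * p" "p = p' + a * q'"
proof -
  have ua: "a * u = u * a"
  proof -
    have "u * ((1 - a * a) * a) * u = u * (a * (1 - a * a)) * u"
      by (simp add: algebra_simps)
    then show ?thesis
      using u by (simp add: mult.assoc[symmetric]) (simp add: mult.assoc)
  qed
  have x: "x = u * x - u * (a * (a * x))" for x
    using arg_cong[OF u(1), of "\<lambda>y. y * x"] by (simp add: algebra_simps)
  have "q + a * p = q + u * (a * p') + u * (a * (a * q))"
    by (simp add: p_def mult.assoc[symmetric] ua) (simp add: algebra_simps)
  also have "\<dots> = q'"
    using x[of q] by (simp add: q'_def algebra_simps)
  finally show "q' = q + a * p" ..
  have "p' + a * q' = p' + u * (a * q) + u * (a * (a * p'))"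
    by (simp add: q'_def mult.assoc[symmetric] ua) (simp add: algebra_simps)
  also have "\<dots> = p"
    using x[of p'] by (simp add: p_def algebra_simps)
  finally show "p = p' + a * q'" ..
qed

text \<open>Here the inner colors cannot be eliminated without division. Adding the three equations for
the boundary colors shows, since \<open>1 + b\<close> is a unit, that the incoming and the outgoing colors
have the same sum; this turns the equations with coefficient \<open>b\<close> into those with coefficient
\<open>a\<close>.\<close>

lemma cyclic_triangle_commuting_converse:
  fixes a b :: sring
  assumes ab: "\<And>x. a * (b * x) = a * x - b * x" "\<And>x. b * (a * x) = a * x - b * x"
    and units: "is_unit_q (1 - a * a)" "is_unit_q (1 + b)"
    and E: "z2 = z1' + b * x0" "x0 = x1' + b * z2" "y2 = y1' + b * z0" "z0 = z1' + b * y2"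
      "x2 = x1' + b * y0" "y0 = y1' + b * x2"
  shows "\<exists>x1 y1 z1. x1 = x0 + a * y1 \<and> y1 = y2 + a * x1 \<and> z1 = z0 + a * x1 \<and> x1 = x2 + a * z1 \<and>
      y1 = y0 + a * z1 \<and> z1 = z2 + a * y1"
proof -
  obtain u c where u: "u * (1 - a * a) = 1" "(1 - a * a) * u = 1" and c: "c * (1 + b) = 1"
    using units by (auto simp: is_unit_q_def)
  have E1: "z2 - z0 = b * (x0 - y2)"
    using E(1,4) by (simp add: right_diff_distrib)
  have E2: "y2 - y0 = b * (z0 - x2)"
    using E(3,6) by (simp add: right_diff_distrib)
  have E3: "x2 - x0 = b * (y0 - z2)"
    using E(2,5) by (simp add: right_diff_distrib)
  define w where "w = x2 + y2 + z2 - (x0 + y0 + z0)"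
  have "w = (x2 - x0) + (y2 - y0) + (z2 - z0)"
    by (simp add: w_def algebra_simps)
  also have "\<dots> = - (b * w)"
    unfolding E1 E2 E3 by (simp add: w_def algebra_simps)
  finally have "w + b * w = 0"
    by (metis add.right_inverse add.commute)
  then have "c * ((1 + b) * w) = 0"
    by (simp add: distrib_right)
  then have sum: "w = 0"
    using c by (simp add: mult.assoc[symmetric])
  have step: "v = a * w" if "v = b * (v + w)" for v w
  proof -
    have "a * v = a * (b * (v + w))"
      by (rule arg_cong[OF that])
    also have "\<dots> = a * v + a * w - v"
      by (subst (3) that) (simp add: algebra_simps ab)
    finally show ?thesis
      by (simp add: algebra_simps)
  qed
  have F1: "x2 - x0 = a * (y2 - z0)" and F2: "y2 - y0 = a * (z2 - x0)" and F3: "z2 - z0 = a * (x2 - y0)"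
  proof -
    have *: "y0 - z2 = x2 - x0 + (y2 - z0)" "z0 - x2 = y2 - y0 + (z2 - x0)" "x0 - y2 = z2 - z0 + (x2 - y0)"
    proof -
      have "x2 - x0 + (y2 - z0) - (y0 - z2) = w" "y2 - y0 + (z2 - x0) - (z0 - x2) = w"
          "z2 - z0 + (x2 - y0) - (x0 - y2) = w"
        by (simp_all add: w_def algebra_simps)
      then show "y0 - z2 = x2 - x0 + (y2 - z0)" and "z0 - x2 = y2 - y0 + (z2 - x0)"
          "x0 - y2 = z2 - z0 + (x2 - y0)"
        unfolding sum right_minus_eq by metis+
    qed
    show "x2 - x0 = a * (y2 - z0)"
      by (rule step) (simp only: *[symmetric] E3[symmetric])
    show "y2 - y0 = a * (z2 - x0)"
      by (rule step) (simp only: *[symmetric] E2[symmetric])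
    show "z2 - z0 = a * (x2 - y0)"
      by (rule step) (simp only: *[symmetric] E1[symmetric])
  qed
  have G: "x0 + a * y2 = x2 + a * z0" "y2 + a * x0 = y0 + a * z2" "z0 + a * x2 = z2 + a * y0"
    subgoal using F1 by (simp add: algebra_simps)
    subgoal using F2 by (simp add: algebra_simps)
    subgoal using F3 by (simp add: algebra_simps)
    done
  show ?thesis
    using solve_crossing[OF u, where p' = y2 and q = x0]
      solve_crossing[OF u, where p' = x2 and q = z0]
      solve_crossing[OF u, where p' = z2 and q = y0]
    unfolding G
    by (intro exI[of _ "u * (x2 + a * z0)"] exI[of _ "u * (y0 + a * z2)"]
        exI[of _ "u * (z2 + a * y0)"] conjI)
qed

lemma is_unit_q_one_minus: "tsmall x \<Longrightarrow> is_unit_q (1 - x)"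
  using is_unit_q_one_plus[of "- x"] by (simp add: tdiv_uminus)

lemma tsmall_qk: "tsmall qk"
  by (simp add: qk_def tdiv_mult_left tdiv_mult_right tsmall_qt del: One_nat_def)

text \<open>The third move when one of the strands, \<open>t\<close>, is strand 1 at both of its crossings and another
one, \<open>b\<close>, is strand 2 at both. Indices 0, 1, 2 number the colors of a strand along its
orientation, and the two sides list the crossings before and after the move.\<close>

lemma acyclic_triangle:
  "(\<exists>t1 m1 b1. crossing t0 t1 m0 m1 \<and> crossing t1 t2 b0 b1 \<and> crossing m1 m2 b1 b2) \<longleftrightarrow>
   (\<exists>t1 m1 b1. crossing m0 m1 b0 b1 \<and> crossing t0 t1 b1 b2 \<and> crossing t1 t2 m1 m2)"
proof
  assume "\<exists>t1 m1 b1. crossing t0 t1 m0 m1 \<and> crossing t1 t2 b0 b1 \<and> crossing m1 m2 b1 b2"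
  then obtain t1 m1 b1 where *: "crossing t0 t1 m0 m1" "crossing t1 t2 b0 b1" "crossing m1 m2 b1 b2"
    by blast
  have "\<exists>M1' b1' t1'. b1' = qs * b0 + qt * m0 \<and> m0 = M1' + qt * b1' \<and> qsi * b2 = b1' + qk * (qsi * t0) \<and>
      qsi * t0 = t1' + qk * (qsi * b2) \<and> t1' = qs * t2 + qt * m2 \<and> m2 = M1' + qt * t1'"
    by (rule acyclic_triangle_commuting[where a = qk and b = qt and ?m0.0 = m0 and ?T0.0 = "qsi * t0" and ?t1.0 = t1
        and ?M1.0 = "qsi * m1" and ?b1.0 = b1 and ?B0.0 = "qs * b0" and ?T2.0 = "qs * t2"
        and ?B2.0 = "qsi * b2" and ?m2.0 = m2, OF qk_qt_left];
        insert *(2)[unfolded crossing_def]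
      *(1,3)[unfolded crossing_shift], elim conjE, assumption)
  then obtain M1' b1' t1' where "b1' = qs * b0 + qt * m0 \<and> m0 = M1' + qt * b1' \<and> qsi * b2 = b1' + qk * (qsi * t0) \<and>
      qsi * t0 = t1' + qk * (qsi * b2) \<and> t1' = qs * t2 + qt * m2 \<and> m2 = M1' + qt * t1'"
    by blast
  then show "\<exists>t1 m1 b1. crossing m0 m1 b0 b1 \<and> crossing t0 t1 b1 b2 \<and> crossing t1 t2 m1 m2"
    by (intro exI[of _ t1'] exI[of _ "qsi * M1'"] exI[of _ b1'])
      (unfold crossing_shift[of t0] crossing_def[of m0] crossing_def[of t1'] qs_cancel, elim conjE, intro conjI; assumption)
next
  assume "\<exists>t1 m1 b1. crossing m0 m1 b0 b1 \<and> crossing t0 t1 b1 b2 \<and> crossing t1 t2 m1 m2"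
  then obtain t1 m1 b1 where *: "crossing m0 m1 b0 b1" "crossing t0 t1 b1 b2" "crossing t1 t2 m1 m2"
    by blast
  have "\<exists>M1' b1' t1'. M1' = m0 + qk * (qsi * t0) \<and> qsi * t0 = t1' + qk * M1' \<and>
      b1' = qs * b0 + qt * t1' \<and> t1' = qs * t2 + qt * b1' \<and>
      qsi * b2 = b1' + qk * M1' \<and> M1' = m2 + qk * (qsi * b2)"
    by (rule acyclic_triangle_commuting_converse[where a = qk and b = qt and ?m0.0 = m0 and ?T0.0 = "qsi * t0" and ?t1'.0 = t1
        and ?M1'.0 = "qs * m1" and ?b1'.0 = b1 and ?B0.0 = "qs * b0" and ?T2.0 = "qs * t2"
        and ?B2.0 = "qsi * b2" and ?m2.0 = m2, OF qk_qt_left];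
        insert *(1,3)[unfolded crossing_def]
      *(2)[unfolded crossing_shift], elim conjE, assumption)
  then obtain M1' b1' t1' where "M1' = m0 + qk * (qsi * t0) \<and> qsi * t0 = t1' + qk * M1' \<and>
      b1' = qs * b0 + qt * t1' \<and> t1' = qs * t2 + qt * b1' \<and>
      qsi * b2 = b1' + qk * M1' \<and> M1' = m2 + qk * (qsi * b2)"
    by blast
  then show "\<exists>t1 m1 b1. crossing t0 t1 m0 m1 \<and> crossing t1 t2 b0 b1 \<and> crossing m1 m2 b1 b2"
    by (intro exI[of _ t1'] exI[of _ "qs * M1'"] exI[of _ b1'])
      (unfold crossing_shift[of t0] crossing_def[of t1'] crossing_shift[of "qs * M1'"] qs_cancel, elim conjE, intro conjI; assumption)
qed

text \<open>The third move when every strand is strand 1 at one crossing and strand 2 at the other.\<close>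

lemma cyclic_triangle:
  "(\<exists>x1 y1 z1. crossing y1 y2 x0 x1 \<and> crossing x1 x2 z0 z1 \<and> crossing z1 z2 y0 y1) \<longleftrightarrow>
   (\<exists>x1 y1 z1. crossing x0 x1 z1 z2 \<and> crossing z0 z1 y1 y2 \<and> crossing y0 y1 x1 x2)"
proof
  assume "\<exists>x1 y1 z1. crossing y1 y2 x0 x1 \<and> crossing x1 x2 z0 z1 \<and> crossing z1 z2 y0 y1"
  then obtain x1 y1 z1 where *: "crossing y1 y2 x0 x1" "crossing x1 x2 z0 z1" "crossing z1 z2 y0 y1"
    by blast
  have "\<exists>x1' y1' z1'. z2 = z1' + qt * x0 \<and> x0 = x1' + qt * z2 \<and> y2 = y1' + qt * z0 \<and>
      z0 = z1' + qt * y2 \<and> x2 = x1' + qt * y0 \<and> y0 = y1' + qt * x2"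
    by (rule cyclic_triangle_commuting[where a = qk and b = qt and ?x0.0 = x0 and ?x1.0 = "qsi * x1" and ?x2.0 = x2
        and ?y0.0 = y0 and ?y1.0 = "qsi * y1" and ?y2.0 = y2 and ?z0.0 = z0 and ?z1.0 = "qsi * z1"
        and ?z2.0 = z2, OF qk_qt_left];
        insert *[unfolded crossing_shift], elim conjE, assumption)
  then obtain x1' y1' z1' where "z2 = z1' + qt * x0 \<and> x0 = x1' + qt * z2 \<and> y2 = y1' + qt * z0 \<and>
      z0 = z1' + qt * y2 \<and> x2 = x1' + qt * y0 \<and> y0 = y1' + qt * x2"
    by blast
  then show "\<exists>x1 y1 z1. crossing x0 x1 z1 z2 \<and> crossing z0 z1 y1 y2 \<and> crossing y0 y1 x1 x2"
    by (intro exI[of _ "qsi * x1'"] exI[of _ "qsi * y1'"] exI[of _ "qsi * z1'"])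
      (unfold crossing_def qs_cancel, elim conjE, intro conjI; assumption)
next
  assume "\<exists>x1 y1 z1. crossing x0 x1 z1 z2 \<and> crossing z0 z1 y1 y2 \<and> crossing y0 y1 x1 x2"
  then obtain x1 y1 z1 where *: "crossing x0 x1 z1 z2" "crossing z0 z1 y1 y2" "crossing y0 y1 x1 x2"
    by blast
  have units: "is_unit_q (1 - qk * qk)" "is_unit_q (1 + qt)"
    using tsmall_qk tsmall_qt
    by (auto intro!: is_unit_q_one_minus is_unit_q_one_plus tdiv_mult_left simp del: One_nat_def)
  have "\<exists>x1' y1' z1'. x1' = x0 + qk * y1' \<and> y1' = y2 + qk * x1' \<and> z1' = z0 + qk * x1' \<and>
      x1' = x2 + qk * z1' \<and> y1' = y0 + qk * z1' \<and> z1' = z2 + qk * y1'"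
    by (rule cyclic_triangle_commuting_converse[where a = qk and b = qt and ?x0.0 = x0 and ?x1'.0 = "qs * x1" and ?x2.0 = x2
        and ?y0.0 = y0 and ?y1'.0 = "qs * y1" and ?y2.0 = y2 and ?z0.0 = z0 and ?z1'.0 = "qs * z1"
        and ?z2.0 = z2, OF qk_qt_left units];
        insert *[unfolded crossing_def], elim conjE, assumption)
  then obtain x1' y1' z1' where "x1' = x0 + qk * y1' \<and> y1' = y2 + qk * x1' \<and> z1' = z0 + qk * x1' \<and>
      x1' = x2 + qk * z1' \<and> y1' = y0 + qk * z1' \<and> z1' = z2 + qk * y1'"
    by blast
  then show "\<exists>x1 y1 z1. crossing y1 y2 x0 x1 \<and> crossing x1 x2 z0 z1 \<and> crossing z1 z2 y0 y1"
    by (intro exI[of _ "qs * x1'"] exI[of _ "qs * y1'"] exI[of _ "qs * z1'"])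
      (unfold crossing_shift qs_cancel, elim conjE, intro conjI; assumption)
qed

lemma crossing_kink_strand1_first: "\<exists>m. crossing a m m a"
  by (rule exI[of _ "qsi * (a - qt * a)"]) (simp add: crossing_def algebra_simps)

lemma crossing_kink_strand2_first: "\<exists>m. crossing m a a m"
proof -
  obtain u where u: "(1 - qt) * u = 1"
    using is_unit_q_one_minus[OF tsmall_qt] by (auto simp: is_unit_q_def)
  define m where "m = u * (qs * a)"
  have "(1 - qt) * m = qs * a"
    by (simp add: m_def u mult.assoc[symmetric])
  then have "m = qs * a + qt * m"
    by (simp add: algebra_simps)
  then show ?thesis
    unfolding crossing_def by (intro exI[of _ m] conjI)
qed

lemma crossing_forward: "\<exists>p' q'. crossing p p' q q'"
  by (rule exI[of _ "qsi * (p - qt * (qs * q + qt * p))"], rule exI[of _ "qs * q + qt * p"])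
    (simp add: crossing_def)

text \<open>The equations at the second crossing of a second move are those at the first one in the other
order, whether the strands are parallel or antiparallel.\<close>

lemma crossing_bigon: "crossing p p' q q' \<Longrightarrow> crossing q' q p' p"
  unfolding crossing_def by (rule conj_commute[THEN iffD1])

lemma crossing_sideways: "\<exists>p' q. crossing p p' q q'"
  by (rule exI[of _ "qsi * (p - qt * q')"], rule exI[of _ "qsi * (q' - qt * p)"])
    (simp add: crossing_def)

section \<open>Quasideterminants as defects\<close>

definition q_equiv :: "sring \<Rightarrow> sring \<Rightarrow> bool" where
  "q_equiv q q' \<longleftrightarrow> (\<exists>u w. is_unit_q u \<and> is_unit_q w \<and> tsmall (u * w - 1) \<and> q' = u * q * w)"

text \<open>If \<open>u w\<close> is congruent to 1 then so is \<open>w u\<close>, by conjugation; this replaces commutativity of \<open>S\<^sub>0\<close>.\<close>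

lemma q_equiv_sym:
  assumes "q_equiv q q'"
  shows "q_equiv q' q"
proof -
  obtain u w where u: "is_unit_q u" and w: "is_unit_q w" and uw: "tsmall (u * w - 1)" and q': "q' = u * q * w"
    using assms by (auto simp: q_equiv_def)
  obtain u' w' where u': "u * u' = 1" "u' * u = 1" and w': "w * w' = 1" "w' * w = 1"
    using u w by (auto simp: is_unit_q_def)
  have "u' * w' - 1 = - (u' * w' * ((w * (u * w - 1)) * w'))"
  proof -
    have "u' * w' * ((w * (u * w - 1)) * w') = u' * (w' * w) * (u * (w * w')) - u' * (w' * w) * w'"
      by (simp add: algebra_simps)
    then show ?thesis
      by (simp add: u' w')
  qed
  then have "tsmall (u' * w' - 1)"
    using uw by (simp add: tdiv_uminus tdiv_mult_left tdiv_mult_right del: One_nat_def)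
  moreover have "u' * q' * w' = (u' * u) * q * (w * w')"
    by (simp add: q' mult.assoc)
  moreover have "is_unit_q u'" "is_unit_q w'"
    using u' w' by (auto simp: is_unit_q_def)
  ultimately show ?thesis
    unfolding q_equiv_def by (metis mult_1_left mult_1_right u'(2) w'(1))
qed

lemma q_equiv_trans:
  assumes "q_equiv q q'" "q_equiv q' q''"
  shows "q_equiv q q''"
proof -
  obtain u w where u: "is_unit_q u" "is_unit_q w" "tsmall (u * w - 1)" "q' = u * q * w"
    using assms by (auto simp: q_equiv_def)
  obtain v z where v: "is_unit_q v" "is_unit_q z" "tsmall (v * z - 1)" "q'' = v * q' * z"
    using assms by (auto simp: q_equiv_def)
  have eq: "v * u * (w * z) - 1 = v * ((u * w - 1) * z) + (v * z - 1)"
    by (simp add: algebra_simps)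
  have "tsmall (v * ((u * w - 1) * z) + (v * z - 1))"
    using u(3) v(3) by (intro allI tdiv_add tdiv_mult_left tdiv_mult_right) blast+
  then have "tsmall (v * u * (w * z) - 1)"
    unfolding eq .
  moreover have "q'' = v * u * q * (w * z)"
    by (simp add: u v mult.assoc)
  ultimately show ?thesis
    unfolding q_equiv_def
    by (intro exI[of _ "v * u"] exI[of _ "w * z"] conjI is_unit_q_mult u(1,2) v(1,2))
qed

text \<open>Modulo \<open>t\<close> each row has entry \<open>1\<close> on the diagonal and minus a unit in the column of the preceding
arc. If these two columns coincide then \<open>k = 1\<close>, and the only entry is arbitrary.\<close>

definition cyclic_matrix :: "nat \<Rightarrow> (nat \<Rightarrow> nat \<Rightarrow> sring) \<Rightarrow> bool" where
  "cyclic_matrix k A \<longleftrightarrow>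
     (\<forall>i\<in>{1..k}. (\<forall>l\<in>{1..k}. l \<noteq> prev_arc k i \<longrightarrow> tsmall (delta i l - A i l)) \<and>
        (prev_arc k i \<noteq> i \<longrightarrow> is_unit_q (- A i (prev_arc k i))))"

text \<open>\<open>A x\<close> equals \<open>q\<close> times the \<open>i\<close>-th unit vector for some \<open>x\<close> with \<open>x\<^sub>i = 1\<close>; then \<open>q\<close> is \<open>|A|\<^sub>i\<^sub>i\<close>.\<close>

definition defect :: "nat \<Rightarrow> (nat \<Rightarrow> nat \<Rightarrow> sring) \<Rightarrow> nat \<Rightarrow> sring \<Rightarrow> bool" where
  "defect k A i q \<longleftrightarrow>
     (\<exists>x. x i = 1 \<and> (\<forall>h\<in>{1..k}. (\<Sum>l\<in>{1..k}. A h l * x l) = (if h = i then q else 0)))"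

text \<open>Ranked by their distance from \<open>i0\<close> along the cyclic order, arcs other than \<open>i0\<close> come after the
arcs that precede them.\<close>

lemma cyclic_matrix_inverse:
  assumes A: "cyclic_matrix k A" and i0: "i0 \<in> {1..k}"
  defines "I \<equiv> {1..k} - {i0}"
  shows "\<exists>B. \<forall>i\<in>I. \<forall>l\<in>I. (\<Sum>h\<in>I. A i h * B h l) = delta i l \<and> (\<Sum>h\<in>I. B i h * A h l) = delta i l"
proof (rule matrix_inverse_exists[where \<rho> = "\<lambda>l. if i0 < l then l - i0 else l + k - i0"])
  fix i h
  assume *: "i \<in> I" "h \<in> I"
    and le: "(if i0 < i then i - i0 else i + k - i0) \<le> (if i0 < h then h - i0 else h + k - i0)"
  have "h \<noteq> prev_arc k i"
    using * le i0 by (auto simp: I_def prev_arc_def split: if_splits)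
  then show "tsmall (delta i h - A i h)"
    using A * unfolding cyclic_matrix_def I_def by blast
qed (simp add: I_def)

lemma defect_exists:
  assumes A: "cyclic_matrix k A" and i0: "i0 \<in> {1..k}"
  shows "\<exists>q. defect k A i0 q"
proof -
  define I where "I = {1..k} - {i0}"
  have I: "finite I" "i0 \<notin> I" "{1..k} = insert i0 I"
    using i0 by (auto simp: I_def)
  obtain B where B: "\<And>i l. i \<in> I \<Longrightarrow> l \<in> I \<Longrightarrow> (\<Sum>h\<in>I. A i h * B h l) = delta i l"
    using cyclic_matrix_inverse[OF assms] unfolding I_def by metis
  define x where "x l = (if l = i0 then 1 else - (\<Sum>h\<in>I. B l h * A h i0))" for l
  have "(\<Sum>l\<in>{1..k}. A i l * x l) = 0" if i: "i \<in> I" for i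
  proof -
    have "(\<Sum>l\<in>I. A i l * x l) = - (\<Sum>l\<in>I. \<Sum>h\<in>I. A i l * B l h * A h i0)"
      using I(2) by (subst sum_negf[symmetric], intro sum.cong refl)
        (auto simp: x_def sum_distrib_left mult.assoc)
    also have "\<dots> = - (\<Sum>h\<in>I. delta i h * A h i0)"
      using i by (subst sum.swap) (simp add: sum_distrib_right[symmetric] B)
    finally show ?thesis
      using I i by (simp add: x_def)
  qed
  then show ?thesis
    unfolding defect_def
    by (intro exI[of _ "\<Sum>l\<in>{1..k}. A i0 l * x l"] exI[of _ x]) (auto simp: x_def I_def)
qed

lemma left_defect_exists:
  assumes A: "cyclic_matrix k A" and i0: "i0 \<in> {1..k}"
  shows "\<exists>y q. y i0 = 1 \<and> (\<forall>l\<in>{1..k}. (\<Sum>h\<in>{1..k}. y h * A h l) = (if l = i0 then q else 0))"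
proof -
  define I where "I = {1..k} - {i0}"
  have I: "finite I" "i0 \<notin> I" "{1..k} = insert i0 I"
    using i0 by (auto simp: I_def)
  obtain B where B: "\<And>i l. i \<in> I \<Longrightarrow> l \<in> I \<Longrightarrow> (\<Sum>h\<in>I. B i h * A h l) = delta i l"
    using cyclic_matrix_inverse[OF assms] unfolding I_def by metis
  define y where "y l = (if l = i0 then 1 else - (\<Sum>h\<in>I. A i0 h * B h l))" for l
  have "(\<Sum>h\<in>{1..k}. y h * A h l) = 0" if l: "l \<in> I" for l
  proof -
    have "(\<Sum>h\<in>I. y h * A h l) = - (\<Sum>h\<in>I. \<Sum>i\<in>I. A i0 i * (B i h * A h l))"
      using I(2) by (subst sum_negf[symmetric], intro sum.cong refl)
        (auto simp: y_def sum_distrib_right mult.assoc)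
    also have "\<dots> = - (\<Sum>i\<in>I. A i0 i * delta i l)"
      using l by (subst sum.swap) (simp add: sum_distrib_left[symmetric] B)
    finally show ?thesis
      using I l by (simp add: y_def)
  qed
  then show ?thesis
    by (intro exI[of _ y] exI[of _ "\<Sum>h\<in>{1..k}. y h * A h i0"]) (auto simp: y_def I_def)
qed

lemma sum_congruent_single:
  assumes "finite I" "p \<in> I" "\<And>l. l \<in> I \<Longrightarrow> l \<noteq> p \<Longrightarrow> tsmall (f l)"
  shows "tsmall (sum f I - f p)"
  using assms by (subst sum.remove[of I p]) (auto intro!: tdiv_sum simp del: One_nat_def)

text \<open>Evaluating \<open>y A x\<close> in two ways gives \<open>y\<^sub>i q = q' x\<^sub>k\<close>. Modulo \<open>t\<close>, the \<open>l\<close>-th row of \<open>A x = 0\<close> gives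
\<open>x\<^sub>l = w x\<^sub>l\<^sub>-\<^sub>1\<close> and the column \<open>l - 1\<close> of \<open>y A = 0\<close> gives \<open>y\<^sub>l\<^sub>-\<^sub>1 = y\<^sub>l w\<close> with the same \<open>w\<close>, so \<open>y\<^sub>l x\<^sub>l\<close> is
constant for \<open>l\<close> from \<open>i\<close> to \<open>k\<close>.\<close>

lemma defect_move_to_last:
  assumes A: "cyclic_matrix k A" and i: "i \<in> {1..k}"
    and q: "defect k A i q" and q': "defect k A k q'"
  shows "q_equiv q' q"
proof -
  obtain x where x: "x i = 1" "\<And>h. h \<in> {1..k} \<Longrightarrow> (\<Sum>l\<in>{1..k}. A h l * x l) = (if h = i then q else 0)"
    using q unfolding defect_def by blast
  obtain z where z: "z k = 1" "\<And>h. h \<in> {1..k} \<Longrightarrow> (\<Sum>l\<in>{1..k}. A h l * z l) = (if h = k then q' else 0)"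
    using q' unfolding defect_def by blast
  have k: "k \<in> {1..k}" using i by auto
  obtain y r where y: "y k = 1" "\<And>l. l \<in> {1..k} \<Longrightarrow> (\<Sum>h\<in>{1..k}. y h * A h l) = (if l = k then r else 0)"
    using left_defect_exists[OF A k] by blast
  have assoc: "(\<Sum>h\<in>{1..k}. y h * (\<Sum>l\<in>{1..k}. A h l * v l)) = (\<Sum>l\<in>{1..k}. (\<Sum>h\<in>{1..k}. y h * A h l) * v l)" for v
    by (simp add: sum_distrib_left sum_distrib_right mult.assoc) (rule sum.swap)
  have pick: "(\<Sum>h\<in>{1..k}. f h * (if h = j then c else 0)) = f j * c"
    "(\<Sum>h\<in>{1..k}. (if h = j then c else 0) * f h) = c * f j" if "j \<in> {1..k}" for f :: "nat \<Rightarrow> sring" and c j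
  proof -
    have "(\<Sum>h\<in>{1..k}. f h * (if h = j then c else 0)) = (\<Sum>h\<in>{1..k}. if h = j then f j * c else 0)"
      "(\<Sum>h\<in>{1..k}. (if h = j then c else 0) * f h) = (\<Sum>h\<in>{1..k}. if h = j then c * f j else 0)"
      by (intro sum.cong; simp)+
    then show "(\<Sum>h\<in>{1..k}. f h * (if h = j then c else 0)) = f j * c"
      "(\<Sum>h\<in>{1..k}. (if h = j then c else 0) * f h) = c * f j"
      using that by simp_all
  qed
  have pairing: "y j * c = r * v k"
    if j: "j \<in> {1..k}" and v: "\<And>h. h \<in> {1..k} \<Longrightarrow> (\<Sum>l\<in>{1..k}. A h l * v l) = (if h = j then c else 0)"
    for v c j
  proof -
    have "y j * c = (\<Sum>h\<in>{1..k}. y h * (\<Sum>l\<in>{1..k}. A h l * v l))"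
      unfolding pick(1)[OF j, symmetric] by (intro sum.cong refl) (simp only: v)
    also have "\<dots> = (\<Sum>l\<in>{1..k}. (if l = k then r else 0) * v l)"
      unfolding assoc by (intro sum.cong refl) (simp only: y)
    finally show ?thesis
      unfolding pick(2)[OF k] .
  qed
  have "y i * q = r * x k" "y k * q' = r * z k"
    using pairing[OF i x(2)] pairing[OF k z(2)] by blast+
  then have main: "y i * q = q' * x k"
    by (simp add: y z)
  have step: "is_unit_q (x l) \<and> tsmall (y i * x i - y l * x l)" if "i \<le> l" "l \<le> k" for l
    using that
  proof (induction l rule: dec_induct)
    case base
    have "is_unit_q 1" by (auto simp: is_unit_q_def)
    then show ?case by (simp add: x tdiv_zero)
  next
    case (step l)
    have l: "l \<in> {1..k}" "Suc l \<in> {1..k}" "prev_arc k (Suc l) = l" "l \<noteq> k"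
      using i step by (auto simp: prev_arc_def)
    define w where "w = - A (Suc l) l"
    have w: "is_unit_q w"
    proof -
      have "prev_arc k (Suc l) \<noteq> Suc l \<longrightarrow> is_unit_q (- A (Suc l) (prev_arc k (Suc l)))"
        using A l(2) unfolding cyclic_matrix_def by blast
      then show ?thesis by (simp add: l(3) w_def)
    qed
    have small: "tsmall (delta (Suc l) h - A (Suc l) h)" if "h \<in> {1..k}" "h \<noteq> l" for h
    proof -
      have "h \<noteq> prev_arc k (Suc l)" using that l(3) by simp
      then show ?thesis
        using A l(2) that(1) unfolding cyclic_matrix_def by blast
    qed
    have small': "tsmall (delta h l - A h l)" if "h \<in> {1..k}" "h \<noteq> Suc l" for h
    proof -
      have "l \<noteq> prev_arc k h"
        using that l by (auto simp: prev_arc_def split: if_splits)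
      then show ?thesis
        using A l(1) that(1) unfolding cyclic_matrix_def by blast
    qed
    have "x (Suc l) = (\<Sum>h\<in>{1..k}. (delta (Suc l) h - A (Suc l) h) * x h)"
      using x(2)[OF l(2)] l step by (simp add: left_diff_distrib sum_subtractf)
    moreover have "tsmall ((\<Sum>h\<in>{1..k}. (delta (Suc l) h - A (Suc l) h) * x h) - (delta (Suc l) l - A (Suc l) l) * x l)"
      using small l by (intro sum_congruent_single) (auto simp: tdiv_mult_right simp del: One_nat_def)
    ultimately have X: "tsmall (x (Suc l) - w * x l)"
      by (simp add: w_def delta_def del: One_nat_def)
    have "y l = (\<Sum>h\<in>{1..k}. y h * (delta h l - A h l))"
      using y(2)[OF l(1)] l by (simp add: right_diff_distrib sum_subtractf)
    moreover have "tsmall ((\<Sum>h\<in>{1..k}. y h * (delta h l - A h l)) - y (Suc l) * (delta (Suc l) l - A (Suc l) l))"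
      using small' l by (intro sum_congruent_single) (auto simp: tdiv_mult_left simp del: One_nat_def)
    ultimately have Y: "tsmall (y l - y (Suc l) * w)"
      by (simp add: w_def delta_def del: One_nat_def)
    have eq: "y i * x i - y (Suc l) * x (Suc l)
        = (y i * x i - y l * x l) + (y l - y (Suc l) * w) * x l - y (Suc l) * (x (Suc l) - w * x l)"
      by (simp add: algebra_simps)
    have "tsmall (y i * x i - y (Suc l) * x (Suc l))"
      unfolding eq using X Y step.IH l(4) step.prems
      by (intro allI tdiv_diff[OF tdiv_add[OF _ tdiv_mult_right] tdiv_mult_left]; simp)
    moreover have "is_unit_q (x (Suc l))"
      using is_unit_q_cong[OF is_unit_q_mult[OF w] X] step.IH l by auto
    ultimately show ?case by blast
  qed
  have xk: "is_unit_q (x k)" and yx: "tsmall (y i - x k)"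
    using step[of k] i by (auto simp: x y)
  have "is_unit_q (y i)"
    by (rule is_unit_q_cong[OF xk yx])
  then obtain v where v: "y i * v = 1" "v * y i = 1"
    by (auto simp: is_unit_q_def)
  have "q = v * q' * x k"
    using main v by (metis mult.assoc mult_1_left)
  moreover have "v * x k - 1 = - (v * (y i - x k))"
    using v by (simp add: right_diff_distrib)
  then have "tsmall (v * x k - 1)"
    using yx by (simp add: tdiv_uminus tdiv_mult_left del: One_nat_def)
  moreover have "is_unit_q v"
    using v by (auto simp: is_unit_q_def)
  ultimately show ?thesis
    using xk unfolding q_equiv_def by blast
qed

lemma defect_equiv:
  assumes "cyclic_matrix k A" "i \<in> {1..k}" "j \<in> {1..k}" "defect k A i q" "defect k A j q'"
  shows "q_equiv q q'"
proof -
  have "k \<in> {1..k}" using assms by auto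
  then obtain r where "defect k A k r" using defect_exists assms(1) by blast
  then show ?thesis
    using defect_move_to_last[OF assms(1)] assms(2-) q_equiv_sym q_equiv_trans by blast
qed

text \<open>The inverse chosen in the definition of the quasideterminant is the projection of the one over
the product ring, because inverses are unique; applied to the last column of \<open>A\<close> it yields the
coordinates of \<open>x\<close> other than the last one.\<close>

lemma quasidet_eq_defect:
  assumes A: "cyclic_matrix k A" and k: "k \<ge> 1" and q: "defect k A k q"
    and A': "\<And>i l. i \<in> {1..k} \<Longrightarrow> l \<in> {1..k} \<Longrightarrow> A' i l = proj n (A i l)"
  shows "quasidet (Sn n) k A' k k = proj n q"
proof (cases "k = 1")
  case True
  obtain x where "x k = 1" "\<And>h. h \<in> {1..k} \<Longrightarrow> (\<Sum>l\<in>{1..k}. A h l * x l) = (if h = k then q else 0)"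
    using q unfolding defect_def by blast
  from this(2)[of 1] this(1) have "A 1 1 = q"
    using True by simp
  moreover have "quasidet (Sn n) k A' k k = A' 1 1"
    unfolding quasidet_def Let_def True by simp
  ultimately show ?thesis
    using A'[of 1 1] True by simp
next
  case False
  define I where "I = {1..k} - {k}"
  have I: "finite I" "k \<notin> I" "{1..k} = insert k I"
    using k by (auto simp: I_def)
  interpret R: ring "Sn n" by (rule ring_Sn)
  have "k \<in> {1..k}" using k by simp
  from cyclic_matrix_inverse[OF A this]
  obtain B where "\<forall>i\<in>I. \<forall>l\<in>I. (\<Sum>h\<in>I. A i h * B h l) = delta i l \<and> (\<Sum>h\<in>I. B i h * A h l) = delta i l"
    unfolding I_def by blast
  then have B1: "\<And>i l. i \<in> I \<Longrightarrow> l \<in> I \<Longrightarrow> (\<Sum>h\<in>I. A i h * B h l) = delta i l"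
    and B2: "\<And>i l. i \<in> I \<Longrightarrow> l \<in> I \<Longrightarrow> (\<Sum>h\<in>I. B i h * A h l) = delta i l"
    by blast+
  have AI: "A' i l = proj n (A i l)" if "i \<in> insert k I" "l \<in> insert k I" for i l
    using A' that I by metis
  have delta: "proj n (delta i l) = (if i = l then \<one>\<^bsub>Sn n\<^esub> else \<zero>\<^bsub>Sn n\<^esub>)" for i l :: nat
    by (simp add: delta_def proj_hom)
  have "is_mat_inverse (Sn n) I I A' (\<lambda>l h. proj n (B l h))"
    unfolding is_mat_inverse_def
  proof (intro conjI ballI)
    fix i l assume il: "i \<in> I" "l \<in> I"
    have "(\<Oplus>\<^bsub>Sn n\<^esub>h\<in>I. A' i h \<otimes>\<^bsub>Sn n\<^esub> proj n (B h l)) = proj n (\<Sum>h\<in>I. A i h * B h l)"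
      using il by (simp add: proj_sum I proj_hom AI proj_closed cong: R.finsum_cong)
    then show "(\<Oplus>\<^bsub>Sn n\<^esub>h\<in>I. A' i h \<otimes>\<^bsub>Sn n\<^esub> proj n (B h l)) = (if i = l then \<one>\<^bsub>Sn n\<^esub> else \<zero>\<^bsub>Sn n\<^esub>)"
      by (simp add: B1 il delta)
    have "(\<Oplus>\<^bsub>Sn n\<^esub>h\<in>I. proj n (B i h) \<otimes>\<^bsub>Sn n\<^esub> A' h l) = proj n (\<Sum>h\<in>I. B i h * A h l)"
      using il by (simp add: proj_sum I proj_hom AI proj_closed cong: R.finsum_cong)
    then show "(\<Oplus>\<^bsub>Sn n\<^esub>h\<in>I. proj n (B i h) \<otimes>\<^bsub>Sn n\<^esub> A' h l) = (if i = l then \<one>\<^bsub>Sn n\<^esub> else \<zero>\<^bsub>Sn n\<^esub>)"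
      by (simp add: B2 il delta)
  qed (simp add: proj_closed)
  then have ex: "\<exists>C. is_mat_inverse (Sn n) I I A' C" by blast
  define C where "C = (SOME C. is_mat_inverse (Sn n) I I A' C)"
  have C: "is_mat_inverse (Sn n) I I A' C"
    unfolding C_def by (rule someI_ex[OF ex])
  have "\<exists>c. C l h = proj n c" if "l \<in> I" "h \<in> I" for l h
    using C that proj_surj unfolding is_mat_inverse_def by metis
  then obtain c where c: "\<And>l h. l \<in> I \<Longrightarrow> h \<in> I \<Longrightarrow> C l h = proj n (c l h)"
    by metis
  have C_eq: "C l h = proj n (B l h)" if lh: "l \<in> I" "h \<in> I" for l h
  proof -
    have small: "tdiv n (Suc n) ((\<Sum>i\<in>I. c l i * A i j) - delta l j)" if "j \<in> I" for j
    proof -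
      have "proj n (\<Sum>i\<in>I. c l i * A i j) = (\<Oplus>\<^bsub>Sn n\<^esub>i\<in>I. C l i \<otimes>\<^bsub>Sn n\<^esub> A' i j)"
        using that lh by (simp add: proj_sum I proj_hom AI c proj_closed cong: R.finsum_cong)
      also have "\<dots> = proj n (delta l j)"
        using C that lh unfolding is_mat_inverse_def delta by simp
      finally show ?thesis by (simp add: proj_eq_iff)
    qed
    have "c l h = (\<Sum>i\<in>I. c l i * (\<Sum>j\<in>I. A i j * B j h))"
      using lh I by (simp add: B1)
    also have "\<dots> = (\<Sum>j\<in>I. (\<Sum>i\<in>I. c l i * A i j) * B j h)"
      by (simp add: sum_distrib_left sum_distrib_right mult.assoc) (rule sum.swap)
    finally have "c l h - B l h = (\<Sum>j\<in>I. ((\<Sum>i\<in>I. c l i * A i j) - delta l j) * B j h)"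
      using lh I by (simp add: left_diff_distrib sum_subtractf)
    then have "tdiv n (Suc n) (c l h - B l h)"
      using small by (simp add: tdiv_sum tdiv_mult_right)
    then show ?thesis
      using c lh by (simp add: proj_eq_iff)
  qed
  obtain x where x: "x k = 1" "\<And>h. h \<in> {1..k} \<Longrightarrow> (\<Sum>l\<in>{1..k}. A h l * x l) = (if h = k then q else 0)"
    using q unfolding defect_def by blast
  have xl: "x l = - (\<Sum>h\<in>I. B l h * A h k)" if l: "l \<in> I" for l
  proof -
    have r: "(\<Sum>j\<in>I. A h j * x j) = - A h k" if "h \<in> I" for h
    proof -
      have "A h k + (\<Sum>j\<in>I. A h j * x j) = 0"
        using x(2)[of h, unfolded I(3)] that I(1,2) x(1) by (auto split: if_splits)
      then show ?thesis by (simp add: add_eq_0_iff)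
    qed
    have "x l = (\<Sum>j\<in>I. (\<Sum>h\<in>I. B l h * A h j) * x j)"
      using l I by (simp add: B2)
    also have "\<dots> = (\<Sum>h\<in>I. B l h * (\<Sum>j\<in>I. A h j * x j))"
      by (simp add: sum_distrib_left sum_distrib_right mult.assoc) (rule sum.swap)
    finally show ?thesis
      by (simp add: r sum_negf)
  qed
  have "q = A k k + (\<Sum>l\<in>I. A k l * x l)"
    using x(2)[of k] x(1) I k by auto
  also have "\<dots> = A k k - (\<Sum>l\<in>I. \<Sum>h\<in>I. A k l * B l h * A h k)"
    by (simp add: xl sum_negf sum_distrib_left mult.assoc)
  finally have "proj n q = A' k k \<ominus>\<^bsub>Sn n\<^esub> (\<Oplus>\<^bsub>Sn n\<^esub>l\<in>I. \<Oplus>\<^bsub>Sn n\<^esub>h\<in>I. A' k l \<otimes>\<^bsub>Sn n\<^esub> C l h \<otimes>\<^bsub>Sn n\<^esub> A' h k)"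
    by (simp add: proj_diff proj_sum I proj_hom AI C_eq proj_closed cong: R.finsum_cong)
  then show ?thesis
    unfolding quasidet_def Let_def I_def[symmetric] C_def[symmetric] using False ex by simp
qed

section \<open>Colorings of the circle cut open\<close>

text \<open>The parameters \<open>x\<close> and \<open>y\<close> lie on strand 1 and strand 2 of a flat crossing.\<close>

definition crossing_pair :: "diagram \<Rightarrow> real \<Rightarrow> real \<Rightarrow> bool" where
  "crossing_pair D x y \<longleftrightarrow> curve D x = curve D y \<and> curve D x \<in> flat D \<and>
     orient (velocity (curve D) x) (velocity (curve D) y) > 0"

text \<open>\<open>f x\<close> is the color just after the parameter \<open>x\<close> and \<open>g x\<close> the one just before it. Both are
functions on the real line rather than on arcs, and constancy on arcs is expressed locally, so
that a coloring can be changed in one place without renumbering anything.\<close>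

definition coloring :: "diagram \<Rightarrow> real \<Rightarrow> (real \<Rightarrow> sring) \<Rightarrow> (real \<Rightarrow> sring) \<Rightarrow> bool" where
  "coloring D b f g \<longleftrightarrow>
     (\<forall>x\<in>{b..<b+1}. \<forall>\<^sub>F y in at_right x. f y = f x \<and> g y = f x) \<and>
     (\<forall>x\<in>{b<..b+1}. \<forall>\<^sub>F y in at_left x. f y = g x \<and> g y = g x) \<and>
     (\<forall>x\<in>{b<..<b+1}. curve D x \<notin> flat D \<longrightarrow> f x = g x) \<and>
     (\<forall>x\<in>{b<..<b+1}. \<forall>y\<in>{b<..<b+1}. crossing_pair D x y \<longrightarrow> crossing (g x) (f x) (g y) (f y))"

definition knot_value :: "diagram \<Rightarrow> sring \<Rightarrow> bool" where
  "knot_value D q \<longleftrightarrow>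
     (\<exists>b f g. curve D b \<notin> flat D \<and> coloring D b f g \<and> f b = 1 \<and> q = 1 - g (b + 1))"

lemma coloring_right: "coloring D b f g \<Longrightarrow> b \<le> x \<Longrightarrow> x < b + 1 \<Longrightarrow> \<forall>\<^sub>F y in at_right x. f y = f x \<and> g y = f x"
  and coloring_left: "coloring D b f g \<Longrightarrow> b < x \<Longrightarrow> x \<le> b + 1 \<Longrightarrow> \<forall>\<^sub>F y in at_left x. f y = g x \<and> g y = g x"
  and coloring_plain: "coloring D b f g \<Longrightarrow> b < x \<Longrightarrow> x < b + 1 \<Longrightarrow> curve D x \<notin> flat D \<Longrightarrow> f x = g x"
  and coloring_crossing: "coloring D b f g \<Longrightarrow> b < x \<Longrightarrow> x < b + 1 \<Longrightarrow> b < y \<Longrightarrow> y < b + 1 \<Longrightarrow>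
    crossing_pair D x y \<Longrightarrow> crossing (g x) (f x) (g y) (f y)"
  by (simp_all add: coloring_def)

lemma coloring_constant:
  assumes c: "coloring D b f g" and xy: "b \<le> x" "x < y" "y \<le> b + 1"
    and no: "\<And>z. x < z \<Longrightarrow> z < y \<Longrightarrow> curve D z \<notin> flat D"
  shows "g y = f x"
proof -
  have local: "\<forall>\<^sub>F w in at z within {x<..<y}. f z = f w" if z: "z \<in> {x<..<y}" for z
  proof -
    have "f z = g z"
      using z xy by (intro coloring_plain[OF c] no) auto
    then have "\<forall>\<^sub>F w in at_left z. f z = f w" "\<forall>\<^sub>F w in at_right z. f z = f w"
      using eventually_mono[OF coloring_left[OF c, of z]] eventually_mono[OF coloring_right[OF c, of z]] z xy
      by auto
    then have "\<forall>\<^sub>F w in at z. f z = f w"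
      by (simp add: eventually_at_split)
    then show ?thesis
      using filter_leD[OF at_le[OF subset_UNIV]] by blast
  qed
  obtain u where u: "x < u" "u < y" "f u = f x"
    using eventually_happens'[OF _ eventually_conj[OF eventually_at_right_real[OF xy(2)] coloring_right[OF c xy(1)]]] xy
    by auto
  obtain v where v: "x < v" "v < y" "f v = g y"
    using eventually_happens'[OF _ eventually_conj[OF eventually_at_left_real[OF xy(2)] coloring_left[OF c _ xy(3)]]] xy
    by auto
  have "f u = f v"
    using connected_local_const[of "{x<..<y}" u v f] local u v by auto
  then show ?thesis using u v by simp
qed

text \<open>Colorings of \<open>D'\<close> are colorings of \<open>D\<close> composed with the reparametrisation.\<close>

lemma knot_value_reparametrised:
  assumes D: "is_diagram D" and r: "reparametrised D D'" and v: "\<And>b. curve D b \<notin> flat D \<Longrightarrow> \<exists>f g. coloring D b f g \<and> f b = 1"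
    and b: "curve D' b \<notin> flat D'"
  shows "\<exists>q. knot_value D q \<and> knot_value D' q"
proof -
  obtain \<rho> where C1: "\<rho> C1_differentiable_on UNIV" and pos: "\<And>x. vector_derivative \<rho> (at x) > 0"
    and per: "\<And>x. \<rho> (x + 1) = \<rho> x + 1" and cD': "curve D' = curve D \<circ> \<rho>" and fD': "flat D' = flat D"
    using r unfolding reparametrised_def by blast
  have diff: "\<rho> differentiable at x" for x
    using C1 by (simp add: C1_differentiable_on_eq)
  have deriv: "(\<rho> has_real_derivative vector_derivative \<rho> (at x)) (at x)" for x
    using diff[of x] by (simp add: has_real_derivative_iff_has_vector_derivative vector_derivative_works)
  have mono: "\<rho> x < \<rho> y" if "x < y" for x y
    by (rule DERIV_pos_imp_increasing[OF that]) (rule exI, rule conjI, rule deriv, rule pos)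
  have lim: "(\<rho> \<longlongrightarrow> \<rho> x) (at x)" for x
    using deriv DERIV_isCont isCont_def by blast
  have right: "filterlim \<rho> (at_right (\<rho> x)) (at_right x)" for x
  proof -
    have "\<forall>\<^sub>F y in at_right x. \<rho> y \<in> {\<rho> x<..} \<and> \<rho> y \<noteq> \<rho> x"
      using mono by (auto simp: eventually_at_filter intro!: always_eventually) (metis less_irrefl)
    then show ?thesis
      unfolding filterlim_at using tendsto_mono[OF at_le[OF subset_UNIV] lim] by blast
  qed
  have left: "filterlim \<rho> (at_left (\<rho> x)) (at_left x)" for x
  proof -
    have "\<forall>\<^sub>F y in at_left x. \<rho> y \<in> {..<\<rho> x} \<and> \<rho> y \<noteq> \<rho> x"
      using mono by (auto simp: eventually_at_filter intro!: always_eventually) (metis less_irrefl)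
    then show ?thesis
      unfolding filterlim_at using tendsto_mono[OF at_le[OF subset_UNIV] lim] by blast
  qed
  have gdiff: "curve D differentiable at x" for x
    using D by (simp add: is_diagram_def generic_immersion_def immersed_circle_def C1_differentiable_on_eq)
  have vel: "velocity (curve D') x = vector_derivative \<rho> (at x) *\<^sub>R velocity (curve D) (\<rho> x)" for x
    unfolding velocity_def cD' by (rule vector_derivative_chain_at[OF diff gdiff])
  have pair: "crossing_pair D (\<rho> x) (\<rho> y)" if "crossing_pair D' x y" for x y
  proof -
    have "orient (velocity (curve D') x) (velocity (curve D') y) =
        (vector_derivative \<rho> (at x) * vector_derivative \<rho> (at y)) * orient (velocity (curve D) (\<rho> x)) (velocity (curve D) (\<rho> y))"
      by (simp add: vel orient_def algebra_simps)
    then show ?thesis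
      using that mult_pos_pos[OF pos pos, of x y] unfolding crossing_pair_def cD' fD'
      by (auto simp: zero_less_mult_iff)
  qed
  obtain f g where c: "coloring D (\<rho> b) f g" "f (\<rho> b) = 1"
    using v[of "\<rho> b"] b by (auto simp: cD' fD')
  have iv: "\<rho> x \<in> {\<rho> b..<\<rho> b + 1}" if "x \<in> {b..<b+1}" for x
    using that mono[of b x] mono[of x "b + 1"] by (cases "x = b") (auto simp: per)
  have iv': "\<rho> x \<in> {\<rho> b<..\<rho> b + 1}" if "x \<in> {b<..b+1}" for x
    using that mono[of b x] mono[of x "b + 1"] by (cases "x = b + 1") (auto simp: per)
  have "coloring D' b (f \<circ> \<rho>) (g \<circ> \<rho>)"
    unfolding coloring_def
  proof (intro conjI ballI impI)
    fix x assume "x \<in> {b..<b+1}"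
    from iv[OF this] show "\<forall>\<^sub>F y in at_right x. (f \<circ> \<rho>) y = (f \<circ> \<rho>) x \<and> (g \<circ> \<rho>) y = (f \<circ> \<rho>) x"
      using filterlim_iff[THEN iffD1, OF right, rule_format, OF coloring_right[OF c(1)], of x] by simp
  next
    fix x assume "x \<in> {b<..b+1}"
    from iv'[OF this] show "\<forall>\<^sub>F y in at_left x. (f \<circ> \<rho>) y = (g \<circ> \<rho>) x \<and> (g \<circ> \<rho>) y = (g \<circ> \<rho>) x"
      using filterlim_iff[THEN iffD1, OF left, rule_format, OF coloring_left[OF c(1)], of x] by simp
  next
    fix x assume "x \<in> {b<..<b+1}" "curve D' x \<notin> flat D'"
    then show "(f \<circ> \<rho>) x = (g \<circ> \<rho>) x"
      using iv[of x] iv'[of x] coloring_plain[OF c(1), of "\<rho> x"] by (auto simp: cD' fD')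
  next
    fix x y assume "x \<in> {b<..<b+1}" "y \<in> {b<..<b+1}" "crossing_pair D' x y"
    then show "crossing ((g \<circ> \<rho>) x) ((f \<circ> \<rho>) x) ((g \<circ> \<rho>) y) ((f \<circ> \<rho>) y)"
      using iv[of x] iv'[of x] iv[of y] iv'[of y] pair[of x y]
        coloring_crossing[OF c(1), of "\<rho> x" "\<rho> y"] by auto
  qed
  then have "knot_value D' (1 - g (\<rho> b + 1))"
    unfolding knot_value_def using b c(2) per by (intro exI[of _ b] exI[of _ "f \<circ> \<rho>"] exI[of _ "g \<circ> \<rho>"]) auto
  moreover have "knot_value D (1 - g (\<rho> b + 1))"
    unfolding knot_value_def using b c by (intro exI[of _ "\<rho> b"] exI[of _ f] exI[of _ g]) (auto simp: cD' fD')
  ultimately show ?thesis by blast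
qed

lemma orient_linear:
  assumes "linear L"
  shows "orient (L v) (L w) = orient (L 1) (L \<i>) * orient v w"
proof -
  have "L z = Re z *\<^sub>R L 1 + Im z *\<^sub>R L \<i>" for z
  proof -
    have "z = Re z *\<^sub>R 1 + Im z *\<^sub>R \<i>"
      by (simp add: complex_eq_iff)
    then show ?thesis
      using assms by (metis linear_add linear_scale)
  qed
  from this[of v] this[of w] show ?thesis
    by (simp add: orient_def algebra_simps)
qed

text \<open>The left-hand side is the determinant of \<open>L\<close>.\<close>

lemma orient_linear_nonzero:
  assumes L: "linear L" "inj L"
  shows "orient (L 1) (L \<i>) \<noteq> 0"
proof
  assume 0: "orient (L 1) (L \<i>) = 0"
  have comb: "L (Complex a c) = a *\<^sub>R L 1 + c *\<^sub>R L \<i>" for a c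
  proof -
    have "Complex a c = a *\<^sub>R 1 + c *\<^sub>R \<i>"
      by (simp add: complex_eq_iff)
    then show ?thesis
      using L(1) by (metis linear_add linear_scale)
  qed
  have inj: "Complex a c = 0" if "a *\<^sub>R L 1 + c *\<^sub>R L \<i> = 0" for a c
    using that comb L linear_injective_0 by metis
  have "Re (L \<i>) *\<^sub>R L 1 + (- Re (L 1)) *\<^sub>R L \<i> = 0" "Im (L \<i>) *\<^sub>R L 1 + (- Im (L 1)) *\<^sub>R L \<i> = 0"
    using 0 by (simp_all add: complex_eq_iff orient_def algebra_simps)
  from inj[OF this(1)] inj[OF this(2)] have "L 1 = 0"
    by (simp add: complex_eq_iff)
  then show False
    using inj[of 1 0] by (simp add: complex_eq_iff)
qed

text \<open>The Jacobian determinant of an ambient isotopy is 1 at time 0 and never vanishes, so it is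
positive at time 1 and orientations at crossings are preserved.\<close>

lemma knot_value_planar_isotopic:
  assumes D: "is_diagram D" and p: "planar_isotopic D D'"
    and v: "knot_value D q"
  shows "knot_value D' q"
proof -
  obtain H where amb: "ambient_isotopy H"
    and cD': "curve D' = H 1 \<circ> curve D" and fD': "flat D' = H 1 ` flat D"
    using p unfolding planar_isotopic_def by blast
  have H0: "H 0 = id" and bij: "bij (H 1)"
    using amb by (simp_all add: ambient_isotopy_def)
  obtain H' where H'_all: "\<forall>\<tau>\<in>{0..1}. \<forall>z. (H \<tau> has_derivative H' \<tau> z) (at z) \<and> bij (H' \<tau> z)"
    and cont_all: "\<forall>v. continuous_on ({0..1} \<times> UNIV) (\<lambda>(\<tau>, z). H' \<tau> z v)"
    using amb unfolding ambient_isotopy_def by (elim conjE exE)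
  have H': "(H \<tau> has_derivative H' \<tau> z) (at z) \<and> bij (H' \<tau> z)" if "\<tau> \<in> {0..1}" for \<tau> z
    using H'_all that by (simp only:)
  have cont: "continuous_on ({0..1} \<times> UNIV) (\<lambda>(\<tau>, z). H' \<tau> z v)" for v
    using cont_all by (rule spec)
  have lin: "linear (H' \<tau> z)" if "\<tau> \<in> {0..1}" for \<tau> z
    by (rule bounded_linear.linear[OF has_derivative_bounded_linear[OF conjunct1[OF H'[OF that]]]])
  define d where "d z \<tau> = orient (H' \<tau> z 1) (H' \<tau> z \<i>)" for z \<tau>
  have d_cont: "continuous_on {0..1} (d z)" for z
  proof -
    have "continuous_on {0..1} (\<lambda>\<tau>. H' \<tau> z v)" for v
    proof -
      have "continuous_on {0..1} (\<lambda>\<tau>. (\<tau>, z))"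
        by (intro continuous_intros)
      from continuous_on_compose2[OF cont[of v] this] show ?thesis by auto
    qed
    then show ?thesis
      unfolding d_def orient_def by (intro continuous_intros)
  qed
  have d_nz: "d z \<tau> \<noteq> 0" if "\<tau> \<in> {0..1}" for z \<tau>
    unfolding d_def using lin[OF that] H'[OF that] bij_is_inj by (intro orient_linear_nonzero) blast+
  have d0: "d z 0 = 1" for z
  proof -
    have "(id has_derivative H' 0 z) (at z)"
      using H'[of 0 z] H0 by simp
    then have "H' 0 z = id"
      using has_derivative_unique has_derivative_id by blast
    then show ?thesis
      by (simp add: d_def orient_def)
  qed
  have d1: "d z 1 > 0" for z
  proof (rule ccontr)
    assume "\<not> d z 1 > 0"
    then obtain \<tau> where "0 \<le> \<tau>" "\<tau> \<le> 1" "d z \<tau> = 0"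
      using IVT2'[of "d z" 1 0 0] d0[of z] d_cont[of z] by auto
    then show False using d_nz by auto
  qed
  have vel: "velocity (curve D') x = H' 1 (curve D x) (velocity (curve D) x)" for x
  proof -
    have "curve D differentiable at x"
      using D by (simp add: is_diagram_def generic_immersion_def immersed_circle_def C1_differentiable_on_eq)
    then have "(curve D has_derivative (\<lambda>h. h *\<^sub>R velocity (curve D) x)) (at x)"
      by (simp add: velocity_def vector_derivative_works has_vector_derivative_def)
    from diff_chain_at[OF this, of "H 1" "H' 1 (curve D x)"] H'[of 1 "curve D x"]
    have "(curve D' has_derivative (H' 1 (curve D x) \<circ> (\<lambda>h. h *\<^sub>R velocity (curve D) x))) (at x)"
      by (simp add: cD')
    moreover have "H' 1 (curve D x) \<circ> (\<lambda>h. h *\<^sub>R velocity (curve D) x) =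
        (\<lambda>h. h *\<^sub>R H' 1 (curve D x) (velocity (curve D) x))"
      using lin[of 1] by (auto simp: linear_scale)
    ultimately show ?thesis
      unfolding velocity_def by (intro vector_derivative_at) (simp add: has_vector_derivative_def)
  qed
  have same: "H 1 z \<in> flat D' \<longleftrightarrow> z \<in> flat D" "H 1 z = H 1 w \<longleftrightarrow> z = w" for z w
    using bij by (auto simp: fD' bij_def inj_def)
  have pair: "crossing_pair D' x y \<longleftrightarrow> crossing_pair D x y" for x y
  proof (cases "curve D x = curve D y")
    case True
    have "orient (velocity (curve D') x) (velocity (curve D') y) =
        d (curve D x) 1 * orient (velocity (curve D) x) (velocity (curve D) y)"
      unfolding vel d_def True[symmetric] by (rule orient_linear[OF lin]) simp
    then have "orient (velocity (curve D') x) (velocity (curve D') y) > 0 \<longleftrightarrow>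
        orient (velocity (curve D) x) (velocity (curve D) y) > 0"
      using d1[of "curve D x"] by (simp only: zero_less_mult_iff) auto
    moreover have "curve D' z = H 1 (curve D z)" for z
      by (simp add: cD')
    ultimately show ?thesis
      unfolding crossing_pair_def by (simp only: same)
  qed (simp add: crossing_pair_def cD' same)
  have "coloring D' b f g \<longleftrightarrow> coloring D b f g" for b f g
    unfolding coloring_def pair by (simp add: cD' same)
  then show ?thesis
    using v unfolding knot_value_def by (simp add: cD' same)
qed

section \<open>Coloring matrices over the product ring\<close>

definition coloring_matrix :: "diagram \<Rightarrow> nat \<Rightarrow> (nat \<Rightarrow> real) \<Rightarrow> nat \<Rightarrow> nat \<Rightarrow> sring" where
  "coloring_matrix D k \<theta> i l =
     (let p = prev_arc k i; m = partner D k \<theta> i; j = prev_arc k m in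
      if curve D (\<theta> i) \<in> flat D then
        if orient (velocity (curve D) (\<theta> m)) (velocity (curve D) (\<theta> i)) > 0 then
          delta i l - qs * delta p l - qt * delta j l
        else delta i l - qsi * (1 - qt * qt) * delta p l + qsi * qt * qs * delta j l
      else delta i l - delta p l)"

lemma coloring_entry_eq: "coloring_entry n D k \<theta> i l = proj n (coloring_matrix D k \<theta> i l)"
proof -
  interpret R: ring "Sn n" by (rule ring_Sn)
  have e: "unit_row (Sn n) h l = proj n (delta h l)" for h
    by (auto simp: unit_row_def delta_def proj_hom)
  have t: "proj n qt [^]\<^bsub>Sn n\<^esub> (2::nat) = proj n (qt * qt)"
    using proj_closed[of n qt] by (simp add: proj_hom numeral_2_eq_2)
  show ?thesis
    unfolding coloring_entry_def coloring_matrix_def Let_def e proj_generators[symmetric] t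
    by (simp add: proj_hom proj_diff)
qed

lemma cyclic_coloring_matrix: "cyclic_matrix k (coloring_matrix D k \<theta>)"
proof -
  have unit: "is_unit_q qs" "is_unit_q qsi" "is_unit_q 1"
    using qs_inverse qsi_inverse by (auto simp: is_unit_q_def intro: exI[of _ 1])
  have tt: "tsmall (qt * x)" "tsmall (qsi * qt * x)" for x
    using tsmall_qt by (simp_all add: tdiv_mult_right tdiv_mult_left mult.assoc del: One_nat_def)
  have unit': "is_unit_q (qsi * (1 - qt * qt))"
    by (intro is_unit_q_mult unit is_unit_q_one_minus tt)
  have "tsmall (delta i l - coloring_matrix D k \<theta> i l)" if "l \<noteq> prev_arc k i" for i l
    using that tt tdiv_uminus[OF tt(2)[THEN spec]]
    by (auto simp: coloring_matrix_def Let_def delta_def tdiv_zero mult.assoc simp del: One_nat_def)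
  moreover have "is_unit_q (- coloring_matrix D k \<theta> i (prev_arc k i))" if "prev_arc k i \<noteq> i" for i
  proof -
    let ?p = "prev_arc k i" and ?j = "prev_arc k (partner D k \<theta> i)"
    have "is_unit_q (qt * delta ?j ?p + qs)" "is_unit_q (qsi * (1 - qt * qt) - qsi * qt * (qs * delta ?j ?p))"
      using is_unit_q_cong[OF unit(1), of "qt * delta ?j ?p + qs"] tt
        is_unit_q_cong[OF unit', of "qsi * (1 - qt * qt) - qsi * qt * (qs * delta ?j ?p)"]
        tdiv_uminus[OF tt(2)[THEN spec]]
      by (simp_all del: One_nat_def)
    then show ?thesis
      using that unit(3) by (simp add: coloring_matrix_def Let_def delta_def[of i] delta_def[of ?p] mult.assoc)
  qed
  ultimately show ?thesis
    unfolding cyclic_matrix_def by blast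
qed

lemma curve_period:
  assumes "is_diagram D"
  shows "curve D (x + of_int z) = curve D x"
proof -
  have "curve D (x + 1) = curve D x" for x
    using assms by (simp add: is_diagram_def generic_immersion_def immersed_circle_def)
  then have nat: "curve D (x + real n) = curve D x" for x n
    by (induction n) (simp_all add: add.assoc[symmetric] add.commute[of 1])
  show ?thesis
  proof (cases "z \<ge> 0")
    case True
    then show ?thesis using nat[of x "nat z"] by simp
  next
    case False
    then show ?thesis using nat[of "x + of_int z" "nat (- z)"] by simp
  qed
qed

lemma curve_has_velocity:
  assumes "is_diagram D"
  shows "(curve D has_vector_derivative velocity (curve D) x) (at x)"
  using assms unfolding velocity_def vector_derivative_works[symmetric]
  by (simp add: is_diagram_def generic_immersion_def immersed_circle_def C1_differentiable_on_eq)

lemma velocity_period: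
  assumes D: "is_diagram D"
  shows "velocity (curve D) (x + of_int z) = velocity (curve D) x"
proof -
  have "((curve D \<circ> (\<lambda>y. y + of_int z)) has_vector_derivative 1 *\<^sub>R velocity (curve D) (x + of_int z)) (at x)"
    by (intro vector_diff_chain_at curve_has_velocity[OF D]) (auto intro!: derivative_eq_intros)
  moreover have "curve D \<circ> (\<lambda>y. y + of_int z) = curve D"
    using curve_period[OF D] by auto
  ultimately show ?thesis
    unfolding velocity_def by (simp add: vector_derivative_at)
qed

lemma frac_eq_iff: "frac x = frac y \<longleftrightarrow> (\<exists>z::int. x = y + of_int z)" for x y :: real
proof
  assume "frac x = frac y"
  then show "\<exists>z::int. x = y + of_int z"
    by (intro exI[of _ "\<lfloor>x\<rfloor> - \<lfloor>y\<rfloor>"]) (simp add: frac_def)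
qed (auto simp: frac_def)

lemma curve_frac: "is_diagram D \<Longrightarrow> curve D (frac x) = curve D x"
  and velocity_frac: "is_diagram D \<Longrightarrow> velocity (curve D) (frac x) = velocity (curve D) x"
  using curve_period[of D x "- \<lfloor>x\<rfloor>"] velocity_period[of D x "- \<lfloor>x\<rfloor>"] by (simp_all add: frac_def)

lemma flat_preimages:
  assumes D: "is_diagram D" and x: "curve D x \<in> flat D"
  obtains y where "curve D y = curve D x" "frac y \<noteq> frac x"
    "\<And>w. curve D w = curve D x \<Longrightarrow> frac w = frac x \<or> frac w = frac y"
proof -
  let ?P = "preimages (curve D) (curve D x)"
  have "card ?P = 2"
    using D x by (auto simp: is_diagram_def generic_immersion_def)
  then obtain u v where uv: "?P = {u, v}" "u \<noteq> v"
    by (auto simp: card_2_iff)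
  have P: "frac w \<in> {u, v}" if "curve D w = curve D x" for w
    using that frac_lt_1[of w] unfolding uv(1)[symmetric] by (simp add: preimages_def curve_frac[OF D])
  have in_P: "u \<in> ?P" "v \<in> ?P" by (simp_all add: uv)
  then have fr: "frac u = u" "frac v = v" "curve D u = curve D x" "curve D v = curve D x"
    by (simp_all add: preimages_def frac_eq)
  show ?thesis
  proof (cases "frac x = u")
    case True
    then show ?thesis using that[of v] P uv(2) fr by auto
  next
    case False
    then show ?thesis using that[of u] P[of x] P uv(2) fr by auto
  qed
qed

lemma orient_commute: "orient v w = - orient w v"
  by (simp add: orient_def)

lemma crossing_transversal:
  assumes D: "is_diagram D" and xy: "curve D x = curve D y" "curve D x \<in> flat D" "frac x \<noteq> frac y"
  shows "orient (velocity (curve D) x) (velocity (curve D) y) \<noteq> 0"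
proof -
  have "curve D x \<in> multiple_points (curve D)"
    using D xy(2) by (auto simp: is_diagram_def)
  moreover have "frac x \<in> preimages (curve D) (curve D x)" "frac y \<in> preimages (curve D) (curve D x)"
    using xy frac_lt_1 by (simp_all add: preimages_def curve_frac[OF D])
  ultimately have "orient (velocity (curve D) (frac x)) (velocity (curve D) (frac y)) \<noteq> 0"
    using D xy(3) unfolding is_diagram_def generic_immersion_def by blast
  then show ?thesis by (simp add: velocity_frac[OF D])
qed

text \<open>The parameters of the vertices, in order, for some set of vertices that contains the flat
crossings. Unlike an arc labelling this does not record which plane points are vertices, so that
a single vertex can be placed on only one strand through a virtual crossing.\<close>

locale labelled =
  fixes D :: diagram and k :: nat and \<theta> :: "nat \<Rightarrow> real"
  assumes diagram: "is_diagram D" and k: "k \<ge> 1"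
    and mono: "strict_mono_on {1..k} \<theta>" and wrap: "\<theta> k < \<theta> 1 + 1"
    and flat_covered: "\<And>x. curve D x \<in> flat D \<Longrightarrow> \<exists>i\<in>{1..k}. \<exists>z::int. x = \<theta> i + of_int z"
begin

lemma frac_label_inj:
  assumes "i \<in> {1..k}" "j \<in> {1..k}" "frac (\<theta> i) = frac (\<theta> j)"
  shows "i = j"
proof -
  have bound: "\<theta> 1 \<le> \<theta> h" "\<theta> h < \<theta> 1 + 1" if "h \<in> {1..k}" for h
    using strict_mono_on_leD[OF mono, of 1 h] strict_mono_on_leD[OF mono, of h k] that wrap by auto
  obtain z :: int where z: "\<theta> i = \<theta> j + of_int z"
    using assms(3) frac_eq_iff by blast
  have "of_int z < (1::real)" "of_int z > (-1::real)"
    using bound[OF assms(1)] bound[OF assms(2)] z by linarith+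
  then have "z = 0" by linarith
  then show ?thesis
    using z strict_mono_on_eqD[OF mono] assms by auto
qed

lemma partner:
  assumes i: "i \<in> {1..k}" and fl: "curve D (\<theta> i) \<in> flat D"
  shows "partner D k \<theta> i \<in> {1..k}" "partner D k \<theta> i \<noteq> i"
    "curve D (\<theta> (partner D k \<theta> i)) = curve D (\<theta> i)"
    "\<And>j. j \<in> {1..k} \<Longrightarrow> j \<noteq> i \<Longrightarrow> curve D (\<theta> j) = curve D (\<theta> i) \<Longrightarrow> partner D k \<theta> i = j"
proof -
  obtain y where y: "curve D y = curve D (\<theta> i)" "frac y \<noteq> frac (\<theta> i)"
    "\<And>w. curve D w = curve D (\<theta> i) \<Longrightarrow> frac w = frac (\<theta> i) \<or> frac w = frac y"
    using flat_preimages[OF diagram fl] by metis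
  obtain m z where m: "m \<in> {1..k}" "y = \<theta> m + of_int z"
    using flat_covered[of y] y(1) fl by metis
  have fm: "frac y = frac (\<theta> m)"
    using m(2) by (auto simp: frac_eq_iff)
  have unique: "j = m" if "j \<in> {1..k}" "j \<noteq> i" "curve D (\<theta> j) = curve D (\<theta> i)" for j
    using y(3)[OF that(3)] that(1,2) i m(1) frac_label_inj unfolding fm by blast
  have ex: "m \<in> {1..k} \<and> m \<noteq> i \<and> curve D (\<theta> m) = curve D (\<theta> i)"
    using m y fm curve_period[OF diagram] by auto
  have pm: "partner D k \<theta> i = m"
    unfolding partner_def using ex unique by (intro the_equality) blast+
  show "partner D k \<theta> i \<in> {1..k}" "partner D k \<theta> i \<noteq> i"
    "curve D (\<theta> (partner D k \<theta> i)) = curve D (\<theta> i)"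
    using ex pm by auto
  show "partner D k \<theta> i = j" if "j \<in> {1..k}" "j \<noteq> i" "curve D (\<theta> j) = curve D (\<theta> i)" for j
    using unique[OF that] pm by simp
qed

lemma prev_arc_in: "i \<in> {1..k} \<Longrightarrow> prev_arc k i \<in> {1..k}"
  using k by (auto simp: prev_arc_def)

lemma row_sum:
  assumes i: "i \<in> {1..k}"
  shows "(\<Sum>l\<in>{1..k}. coloring_matrix D k \<theta> i l * x l) =
    (let p = prev_arc k i; m = partner D k \<theta> i; j = prev_arc k m in
      if curve D (\<theta> i) \<in> flat D then
        if orient (velocity (curve D) (\<theta> m)) (velocity (curve D) (\<theta> i)) > 0 then
          x i - (qs * x p + qt * x j)
        else x i - qsi * (x p - qt * (qs * x j + qt * x p))
      else x i - x p)"
proof -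
  have d: "(\<Sum>l\<in>{1..k}. c * delta h l * x l) = c * x h" if "h \<in> {1..k}" for c h
    using that by (simp add: mult.assoc sum_distrib_left[symmetric])
  have d': "(\<Sum>l\<in>{1..k}. delta h l * x l) = x h" if "h \<in> {1..k}" for h
    using that by simp
  note ds = d[OF prev_arc_in[OF i]] d[OF prev_arc_in[OF partner(1)[OF i]]] d'[OF i] d'[OF prev_arc_in[OF i]]
  show ?thesis
    unfolding coloring_matrix_def Let_def
    by (simp add: left_diff_distrib distrib_right sum_subtractf sum.distrib ds if_distrib[of "\<lambda>y. y * _"]
        del: One_nat_def)
      (simp add: algebra_simps)
qed

subsection \<open>Arcs indexed by the integers\<close>

text \<open>Unrolling the circle: \<open>time\<close> enumerates increasingly all real parameters of vertices, and
\<open>lab\<close> is the label in \<open>{1..k}\<close> of the arc that starts there.\<close>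

definition lab :: "int \<Rightarrow> nat" where "lab j = nat ((j - 1) mod int k) + 1"
definition time :: "int \<Rightarrow> real" where "time j = \<theta> (lab j) + of_int ((j - 1) div int k)"

lemma lab_in: "lab j \<in> {1..k}"
  using k by (simp add: lab_def Suc_le_eq nat_less_iff)

lemma lab_of_nat: "i \<in> {1..k} \<Longrightarrow> lab (int i) = i" and time_of_nat: "i \<in> {1..k} \<Longrightarrow> time (int i) = \<theta> i"
  by (cases i; auto simp: lab_def time_def)+

lemma lab_shift: "lab (j + int k * z) = lab j" and time_shift: "time (j + int k * z) = time j + of_int z"
proof -
  have "j + int k * z - 1 = j - 1 + int k * z" by simp
  then have *: "(j + int k * z - 1) mod int k = (j - 1) mod int k"
    "(j + int k * z - 1) div int k = (j - 1) div int k + z"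
    using k by (simp_all only: mod_mult_self2 div_mult_self2)
  show "lab (j + int k * z) = lab j"
    by (simp only: lab_def *)
  then show "time (j + int k * z) = time j + of_int z"
    by (simp add: time_def *)
qed

lemma lab_step: "(lab (j + 1) = lab j + 1 \<and> lab j < k \<and> j div int k = (j - 1) div int k)
    \<or> (lab (j + 1) = 1 \<and> lab j = k \<and> j div int k = (j - 1) div int k + 1)"
proof -
  define r where "r = (j - 1) mod int k"
  have r: "0 \<le> r" "r < int k"
    using k by (simp_all add: r_def)
  have "j = int k * ((j - 1) div int k) + (r + 1)"
    using mult_div_mod_eq[of "int k" "j - 1"] by (simp add: r_def)
  then have j: "j div int k = (j - 1) div int k + (r + 1) div int k" "j mod int k = (r + 1) mod int k"
    using k by (metis div_mult_self4 add.commute of_nat_0_eq_iff not_one_le_zero, metis mod_mult_self4)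
  show ?thesis
  proof (cases "r + 1 = int k")
    case True
    then have "j div int k = (j - 1) div int k + 1" "j mod int k = 0"
      using j k by auto
    moreover have "nat r + 1 = k"
      using True r by linarith
    ultimately show ?thesis
      by (auto simp: lab_def r_def[symmetric])
  next
    case False
    then have "j div int k = (j - 1) div int k" "j mod int k = r + 1"
      using j r by auto
    then show ?thesis
      using False r by (auto simp: lab_def r_def[symmetric] nat_add_distrib)
  qed
qed

lemma prev_arc_lab: "prev_arc k (lab (j + 1)) = lab j"
  using lab_step[of j] lab_in[of j] by (auto simp: prev_arc_def)

lemma time_step: "time j < time (j + 1)"
  using lab_step[of j]
proof
  assume *: "lab (j + 1) = lab j + 1 \<and> lab j < k \<and> j div int k = (j - 1) div int k"
  then have "\<theta> (lab j) < \<theta> (lab j + 1)"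
    using strict_mono_onD[OF mono, of "lab j" "lab j + 1"] lab_in[of j] by auto
  then show ?thesis
    using * by (simp add: time_def)
next
  assume *: "lab (j + 1) = 1 \<and> lab j = k \<and> j div int k = (j - 1) div int k + 1"
  then show ?thesis
    using wrap by (simp add: time_def)
qed

lemma time_less: "i < j \<Longrightarrow> time i < time j"
  by (induction j rule: int_gr_induct) (use time_step less_trans in blast)+

lemma time_le: "i \<le> j \<Longrightarrow> time i \<le> time j"
  using time_less[of i j] by (cases "i = j") auto

lemma time_less_iff: "time i < time j \<longleftrightarrow> i < j"
  using time_less[of i j] time_le[of j i] by linarith

lemma flat_time: "curve D x \<in> flat D \<Longrightarrow> \<exists>j. x = time j"
proof -
  assume "curve D x \<in> flat D"
  then obtain i z where "i \<in> {1..k}" "x = \<theta> i + of_int z"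
    using flat_covered by blast
  then have "x = time (int i + int k * z)"
    by (simp add: time_shift time_of_nat)
  then show ?thesis ..
qed

lemma curve_time: "curve D (time j) = curve D (\<theta> (lab j))"
  and velocity_time: "velocity (curve D) (time j) = velocity (curve D) (\<theta> (lab j))"
  by (simp_all add: time_def curve_period[OF diagram] velocity_period[OF diagram])

lemma time_interval: "\<exists>j. time j \<le> x \<and> x < time (j + 1)"
proof -
  define m where "m = \<lfloor>x - \<theta> 1\<rfloor>"
  have t: "time (1 + int k * z) = \<theta> 1 + of_int z" for z
    using time_of_nat[of 1] k by (simp add: time_shift)
  have m: "time (1 + int k * m) \<le> x" "x < time (1 + int k * (m + 1))"
    unfolding t m_def by linarith+
  have "\<exists>j. time j \<le> x \<and> x < time (j + 1)" if "a \<le> c" "time a \<le> x" "x < time c" for a c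
    using that
  proof (induction c rule: int_ge_induct)
    case (step c)
    then show ?case by (cases "x < time c") (auto intro: exI[of _ c])
  qed simp
  then show ?thesis
    using m by (metis less_le_not_le linorder_le_cases time_le order_trans)
qed

lemma time_interval_left: "\<exists>j. time j < x \<and> x \<le> time (j + 1)"
proof -
  obtain j where j: "time j \<le> x" "x < time (j + 1)"
    using time_interval by blast
  then show ?thesis
    using time_step[of "j - 1"] by (cases "time j = x") (auto intro: exI[of _ "j - 1"] exI[of _ j])
qed

end

section \<open>Defects and colorings\<close>

context labelled begin

lemma lab_window: "l \<in> {1..k} \<Longrightarrow> \<exists>j\<in>{a+1..a+int k}. lab j = l"
proof -
  assume l: "l \<in> {1..k}"
  define j where "j = a + 1 + (int l - (a + 1)) mod int k"
  have "j = int l + int k * (- ((int l - (a + 1)) div int k))"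
    using mult_div_mod_eq[of "int k" "int l - (a + 1)"] unfolding j_def mult_minus_right by linarith
  then have "lab j = l"
    using lab_of_nat[OF l] by (simp only: lab_shift)
  moreover have "0 \<le> (int l - (a + 1)) mod int k" "(int l - (a + 1)) mod int k < int k"
    using k by simp_all
  then have "j \<in> {a+1..a+int k}"
    unfolding j_def atLeastAtMost_iff by linarith
  ultimately show ?thesis by blast
qed

lemma lab_inj: "i \<in> {a+1..a+int k} \<Longrightarrow> j \<in> {a+1..a+int k} \<Longrightarrow> lab i = lab j \<Longrightarrow> i = j"
proof -
  assume ij: "i \<in> {a+1..a+int k}" "j \<in> {a+1..a+int k}" "lab i = lab j"
  have "(i - 1) mod int k = (j - 1) mod int k"
    using ij(3) k pos_mod_sign[of "int k" "i - 1"] pos_mod_sign[of "int k" "j - 1"]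
    by (simp add: lab_def eq_nat_nat_iff)
  then have "int k dvd i - j"
    by (simp add: mod_eq_dvd_iff)
  moreover have "\<bar>i - j\<bar> < int k"
    using ij by auto
  ultimately show ?thesis
    using dvd_imp_le_int[of "i - j" "int k"] by force
qed

lemma lab_a: "lab (a + int k) = lab a"
  using lab_shift[of a 1] by simp

lemma time_a: "time (a + int k) = time a + 1"
  using time_shift[of a 1] by simp

text \<open>The arc \<open>lab a\<close> contains \<open>b\<close> and gets the color \<open>1\<close> that it has after \<open>b\<close>; every other arc gets its
color in the coloring. The color of the preceding arc that enters each row is then the color
just before the vertex, so all rows vanish except that of \<open>lab a\<close>, whose arc starts with the color
\<open>g (b + 1)\<close> instead of \<open>1\<close>.\<close>

lemma coloring_defect:
  assumes c: "coloring D b f g" and fb: "f b = 1" and nb: "curve D b \<notin> flat D"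
  shows "\<exists>i\<in>{1..k}. defect k (coloring_matrix D k \<theta>) i (1 - g (b + 1))"
proof -
  obtain a where a: "time a \<le> b" "b < time (a + 1)"
    using time_interval by blast
  define W where "W = {a+1..a+int k}"
  have last: "a + int k \<in> W"
    using k by (simp add: W_def)
  have gap: "curve D z \<notin> flat D" if "time j < z" "z < time (j + 1)" for j z
  proof
    assume "curve D z \<in> flat D"
    then obtain i where "z = time i" using flat_time by blast
    then have "j < i" "i < j + 1" using that by (simp_all add: time_less_iff)
    then show False by simp
  qed
  have nb': "curve D (b + 1) \<notin> flat D"
    using nb curve_period[OF diagram, of b 1] by simp
  have win: "b < time j" "time j \<le> b + 1" if "j \<in> W" for j
    using a that time_le[of "a + 1" j] time_le[of j "a + int k"] time_a[of a] by (auto simp: W_def)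
  have win': "time j < b + 1" if "j \<in> W" "j < a + int k" for j
    using a that time_less[of j "a + int k"] time_a[of a] by auto
  have win_flat: "time j < b + 1" if "j \<in> W" "curve D (time j) \<in> flat D" for j
    using win(2)[OF that(1)] that(2) nb' by (cases "time j = b + 1") auto
  define x where "x l = (if l = lab a then 1 else f (time (SOME j. j \<in> W \<and> lab j = l)))" for l
  have x_lab: "x (lab j) = f (time j)" if j: "j \<in> W" "j < a + int k" for j
  proof -
    have "lab j \<noteq> lab a"
      using lab_inj[of j a "a + int k"] j last lab_a[of a] by (auto simp: W_def)
    moreover have "(SOME i. i \<in> W \<and> lab i = lab j) = j"
      using j lab_inj[of _ a j] by (intro some_equality) (auto simp: W_def)
    ultimately show ?thesis by (simp add: x_def)
  qed
  have g_prev: "x (lab (j - 1)) = g (time j)" if j: "j \<in> W" for j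
  proof (cases "j = a + 1")
    case True
    have "g (time (a + 1)) = f b"
      using win[OF j] a True by (intro coloring_constant[OF c] gap[of a]) auto
    then show ?thesis
      using True fb by (simp add: x_def)
  next
    case False
    then have j1: "j - 1 \<in> W" "j - 1 < a + int k" using j by (auto simp: W_def)
    have "g (time j) = f (time (j - 1))"
      using win[OF j] win[OF j1(1)] time_step[of "j - 1"] gap[of "j - 1"]
      by (intro coloring_constant[OF c]) auto
    then show ?thesis
      using x_lab[OF j1] by simp
  qed
  \<comment> \<open>The color that the vertex \<open>j\<close> assigns to its outgoing arc; if the vertex is \<open>b\<close> itself, at the
    end of the interval, only \<open>g\<close> is meaningful there.\<close>
  define out where "out j = (if time j < b + 1 then f (time j) else g (b + 1))" for j
  have row: "(\<Sum>l\<in>{1..k}. coloring_matrix D k \<theta> (lab j) l * x l) = x (lab j) - out j" if j: "j \<in> W" for j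
  proof (cases "curve D (time j) \<in> flat D")
    case True
    define m where "m = partner D k \<theta> (lab j)"
    have fl: "curve D (\<theta> (lab j)) \<in> flat D" using True by (simp add: curve_time)
    note m = partner[OF lab_in fl, folded m_def]
    obtain j' where j': "j' \<in> W" "lab j' = m"
      using lab_window[OF m(1)] unfolding W_def by blast
    have cur: "curve D (time j') = curve D (time j)"
      using m(3) by (simp add: curve_time j'(2))
    have in_j: "b < time j" "time j < b + 1" and in_j': "b < time j'" "time j' < b + 1"
      using win[OF j] win_flat[OF j True] win[OF j'(1)] win_flat[OF j'(1)] True cur by auto
    have p: "x (prev_arc k (lab j)) = g (time j)" "x (prev_arc k m) = g (time j')"
      using g_prev[OF j] g_prev[OF j'(1)] prev_arc_lab[of "j - 1"] prev_arc_lab[of "j' - 1"] j'(2) by simp_all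
    have out: "out j = f (time j)"
      using in_j by (simp add: out_def)
    have vel: "velocity (curve D) (\<theta> m) = velocity (curve D) (time j')"
        "velocity (curve D) (\<theta> (lab j)) = velocity (curve D) (time j)"
      by (simp_all add: velocity_time j'(2))
    show ?thesis
    proof (cases "orient (velocity (curve D) (time j')) (velocity (curve D) (time j)) > 0")
      case pos: True
      then have "crossing (g (time j')) (f (time j')) (g (time j)) (f (time j))"
        using coloring_crossing[OF c in_j' in_j] True cur by (simp add: crossing_pair_def)
      then have "f (time j) = qs * g (time j) + qt * g (time j')"
        unfolding crossing_def by (rule conjunct1)
      then show ?thesis
        unfolding row_sum[OF lab_in] Let_def m_def[symmetric] vel p out using pos fl by (simp only: if_True)
    next
      case neg: False
      have "frac (time j') \<noteq> frac (time j)"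
      proof -
        have "frac (\<theta> m) \<noteq> frac (\<theta> (lab j))"
          using frac_label_inj[OF m(1) lab_in] m(2) by blast
        moreover have "frac (time i) = frac (\<theta> (lab i))" for i
          unfolding frac_eq_iff time_def by blast
        ultimately show ?thesis by (simp add: j'(2))
      qed
      then have "orient (velocity (curve D) (time j')) (velocity (curve D) (time j)) \<noteq> 0"
        using True cur by (intro crossing_transversal[OF diagram cur]) simp_all
      then have "orient (velocity (curve D) (time j)) (velocity (curve D) (time j')) > 0"
        using neg orient_commute[of "velocity (curve D) (time j)" "velocity (curve D) (time j')"]
        by linarith
      then have "crossing (g (time j)) (f (time j)) (g (time j')) (f (time j'))"
        using coloring_crossing[OF c in_j in_j'] True cur by (simp add: crossing_pair_def)
      then have e: "f (time j') = qs * g (time j') + qt * g (time j)"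
          "g (time j) = qs * f (time j) + qt * f (time j')"
        unfolding crossing_def by (rule conjunct1, elim conjunct2)
      have "qsi * (g (time j) - qt * f (time j')) = f (time j)"
        by (subst e(2)) simp
      then have "qsi * (g (time j) - qt * (qs * g (time j') + qt * g (time j))) = f (time j)"
        unfolding e(1) .
      then show ?thesis
        unfolding row_sum[OF lab_in] Let_def m_def[symmetric] vel p out using neg fl by (simp only: if_True if_False)
    qed
  next
    case False
    then have fl: "curve D (\<theta> (lab j)) \<notin> flat D" by (simp add: curve_time)
    have "out j = g (time j)"
      using coloring_plain[OF c _ _ False] win[OF j] by (auto simp: out_def)
    then show ?thesis
      unfolding row_sum[OF lab_in] Let_def using fl g_prev[OF j] prev_arc_lab[of "j - 1"] by simp
  qed
  have out_last: "out (a + int k) = g (b + 1)"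
  proof (cases "time (a + int k) < b + 1")
    case True
    have "time (a + 1 + int k) = time (a + 1) + 1"
      using time_a by simp
    then have "g (b + 1) = f (time (a + int k))"
      using True win[OF last] a gap[of "a + int k"]
      by (intro coloring_constant[OF c]) (auto simp: algebra_simps)
    then show ?thesis using True by (simp add: out_def)
  qed (simp add: out_def)
  have "defect k (coloring_matrix D k \<theta>) (lab a) (1 - g (b + 1))"
    unfolding defect_def
  proof (intro exI[of _ x] conjI ballI)
    show "x (lab a) = 1" by (simp add: x_def)
    fix h assume "h \<in> {1..k}"
    then obtain j where j: "j \<in> W" "lab j = h"
      using lab_window unfolding W_def by blast
    show "(\<Sum>l\<in>{1..k}. coloring_matrix D k \<theta> h l * x l) = (if h = lab a then 1 - g (b + 1) else 0)"
    proof (cases "j = a + int k")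
      case True
      then show ?thesis
        using row[OF j(1)] j(2) out_last lab_a[of a] by (simp add: x_def)
    next
      case False
      then have lt: "j < a + int k" using j(1) by (auto simp: W_def)
      then have "h \<noteq> lab a"
        using lab_inj[of j a "a + int k"] j last lab_a[of a] by (auto simp: W_def)
      then show ?thesis
        using row[OF j(1)] x_lab[OF j(1) lt] win'[OF j(1) lt] j(2) by (simp add: out_def)
    qed
  qed
  then show ?thesis using lab_in by blast
qed

lemma coloring_exists:
  assumes b: "\<theta> 1 = b" and nb: "curve D b \<notin> flat D"
  shows "\<exists>f g. coloring D b f g \<and> f b = 1"
proof -
  have "1 \<in> {1..k}" using k by simp
  then obtain q where "defect k (coloring_matrix D k \<theta>) 1 q"
    using defect_exists[OF cyclic_coloring_matrix] by blast
  then obtain x where x1: "x 1 = 1"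
    and x: "\<And>h. h \<in> {1..k} \<Longrightarrow> (\<Sum>l\<in>{1..k}. coloring_matrix D k \<theta> h l * x l) = (if h = 1 then q else 0)"
    unfolding defect_def by blast
  define N where "N y = (SOME j. time j \<le> y \<and> y < time (j + 1))" for y
  define N' where "N' y = (SOME j. time j < y \<and> y \<le> time (j + 1))" for y
  have N: "time (N y) \<le> y" "y < time (N y + 1)" for y
    using someI_ex[OF time_interval[of y]] by (simp_all add: N_def)
  have N': "time (N' y) < y" "y \<le> time (N' y + 1)" for y
    using someI_ex[OF time_interval_left[of y]] by (simp_all add: N'_def)
  have N_eq: "N y = j" if "time j \<le> y" "y < time (j + 1)" for y j
    using time_less_iff[of j "N y + 1"] time_less_iff[of "N y" "j + 1"] N[of y] that by linarith
  have N'_eq: "N' y = j" if "time j < y" "y \<le> time (j + 1)" for y j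
    using time_less_iff[of j "N' y + 1"] time_less_iff[of "N' y" "j + 1"] N'[of y] that by linarith
  define f where "f y = x (lab (N y))" for y
  define g where "g y = x (lab (N' y))" for y
  have t1: "time 1 = b" "time (1 + int k) = b + 1"
    using time_of_nat[of 1] k b time_a[of 1] by simp_all
  have at_time: "f (time j) = x (lab j)" "g (time j) = x (lab (j - 1))" for j
    using N_eq[of j "time j"] N'_eq[of "j - 1" "time j"] time_step[of j] time_step[of "j - 1"]
    by (simp_all add: f_def g_def)
  have row: "f y = (let p = prev_arc k (lab j); m = partner D k \<theta> (lab j); i = prev_arc k m in
      if curve D y \<in> flat D then
        if orient (velocity (curve D) (\<theta> m)) (velocity (curve D) y) > 0 then qs * x p + qt * x i
        else qsi * (x p - qt * (qs * x i + qt * x p))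
      else x p)" if y: "b < y" "y < b + 1" "y = time j" for y j
  proof -
    have "1 < j" "j < 1 + int k"
      using y t1 time_less_iff[of 1 j] time_less_iff[of j "1 + int k"] by simp_all
    then have "lab j \<noteq> 1"
    proof -
      have "nat j \<in> {1..k}" "int (nat j) = j" "nat j \<noteq> 1"
        using \<open>1 < j\<close> \<open>j < 1 + int k\<close> by auto
      then show ?thesis using lab_of_nat[of "nat j"] by simp
    qed
    then have "(\<Sum>l\<in>{1..k}. coloring_matrix D k \<theta> (lab j) l * x l) = 0"
      using x[OF lab_in] by simp
    then show ?thesis
      unfolding row_sum[OF lab_in] y(3) at_time curve_time velocity_time Let_def
      by (simp split: if_splits)
  qed
  have "coloring D b f g"
    unfolding coloring_def
  proof (intro conjI ballI impI)
    fix y assume "y \<in> {b..<b+1}"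
    have "\<forall>\<^sub>F z in at_right y. z \<in> {y<..<time (N y + 1)}"
      using N(2) by (rule eventually_at_right_real)
    then show "\<forall>\<^sub>F z in at_right y. f z = f y \<and> g z = f y"
    proof (rule eventually_mono)
      fix z assume "z \<in> {y<..<time (N y + 1)}"
      then have "N z = N y" "N' z = N y"
        using N[of y] by (intro N_eq N'_eq; simp)+
      then show "f z = f y \<and> g z = f y" by (simp add: f_def g_def)
    qed
  next
    fix y assume "y \<in> {b<..b+1}"
    have "\<forall>\<^sub>F z in at_left y. z \<in> {time (N' y)<..<y}"
      using N'(1) by (rule eventually_at_left_real)
    then show "\<forall>\<^sub>F z in at_left y. f z = g y \<and> g z = g y"
    proof (rule eventually_mono)
      fix z assume "z \<in> {time (N' y)<..<y}"
      then have "N z = N' y" "N' z = N' y"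
        using N'[of y] by (intro N_eq N'_eq; simp)+
      then show "f z = g y \<and> g z = g y" by (simp add: f_def g_def)
    qed
  next
    fix y assume y: "y \<in> {b<..<b+1}" "curve D y \<notin> flat D"
    show "f y = g y"
    proof (cases "y = time (N y)")
      case True
      have "f y = x (prev_arc k (lab (N y)))"
        using row[OF _ _ True] y by (simp add: Let_def)
      moreover have "g y = x (lab (N y - 1))"
        using at_time(2)[of "N y"] True by simp
      ultimately show ?thesis
        using prev_arc_lab[of "N y - 1"] by simp
    next
      case False
      then have "N' y = N y"
        using N[of y] by (intro N'_eq) auto
      then show ?thesis by (simp add: f_def g_def)
    qed
  next
    fix y z assume yz: "y \<in> {b<..<b+1}" "z \<in> {b<..<b+1}" "crossing_pair D y z"
    then have cur: "curve D y = curve D z" "curve D y \<in> flat D" "curve D z \<in> flat D"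
      and pos: "orient (velocity (curve D) y) (velocity (curve D) z) > 0"
      by (auto simp: crossing_pair_def)
    obtain i j where i: "y = time i" and j: "z = time j"
      using flat_time cur by blast
    have ij: "i \<in> {1+1..1+int k}" "j \<in> {1+1..1+int k}"
      using yz t1 time_less_iff[of 1 i] time_less_iff[of i "1 + int k"]
        time_less_iff[of 1 j] time_less_iff[of j "1 + int k"] i j by auto
    have "y \<noteq> z"
      using pos by (auto simp: orient_def)
    then have lab_ne: "lab i \<noteq> lab j"
      using lab_inj[OF ij] i j by auto
    have fl: "curve D (\<theta> (lab i)) \<in> flat D" "curve D (\<theta> (lab j)) \<in> flat D"
      and cur': "curve D (\<theta> (lab i)) = curve D (\<theta> (lab j))"
      using cur i j curve_time by auto
    have pi: "partner D k \<theta> (lab i) = lab j" and pj: "partner D k \<theta> (lab j) = lab i"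
      using partner(4)[OF lab_in fl(1) lab_in] partner(4)[OF lab_in fl(2) lab_in] lab_ne cur' by auto
    have gp: "g y = x (prev_arc k (lab i))" "g z = x (prev_arc k (lab j))"
      using at_time(2) i j prev_arc_lab[of "i - 1"] prev_arc_lab[of "j - 1"] by auto
    have vel: "velocity (curve D) (\<theta> (lab i)) = velocity (curve D) y"
        "velocity (curve D) (\<theta> (lab j)) = velocity (curve D) z"
      using velocity_time i j by auto
    have neg: "\<not> orient (velocity (curve D) z) (velocity (curve D) y) > 0"
      using pos orient_commute[of "velocity (curve D) z"] by simp
    have fz: "f z = qs * g z + qt * g y"
      using row[OF _ _ j] yz(2) pos cur unfolding Let_def pj vel gp by simp
    have "f y = qsi * (g y - qt * (qs * g z + qt * g y))"
      using row[OF _ _ i] yz(1) neg cur unfolding Let_def pi vel gp by simp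
    then have "g y = qs * f y + qt * f z"
      unfolding fz by simp
    with fz show "crossing (g y) (f y) (g z) (f z)"
      unfolding crossing_def by (rule conjI)
  qed
  moreover have "f b = 1"
    using at_time(1)[of 1] t1 lab_of_nat[of 1] k x1 by simp
  ultimately show ?thesis by blast
qed

end

section \<open>The value of a diagram\<close>

lemma finite_flat_parameters:
  assumes D: "is_diagram D"
  shows "finite {x \<in> {b..<b+1}. curve D x \<in> flat D}" (is "finite ?S")
proof -
  have "finite (flat D)"
    using D finite_subset unfolding is_diagram_def generic_immersion_def by blast
  moreover have "finite (preimages (curve D) p)" if "p \<in> flat D" for p
  proof -
    have "card (preimages (curve D) p) = 2"
      using D that unfolding is_diagram_def generic_immersion_def by blast
    then show ?thesis by (intro card_ge_0_finite) simp
  qed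
  ultimately have "finite (\<Union>p\<in>flat D. preimages (curve D) p)" by blast
  moreover have "frac ` ?S \<subseteq> (\<Union>p\<in>flat D. preimages (curve D) p)"
    using frac_lt_1 by (auto simp: preimages_def curve_frac[OF D])
  ultimately have "finite (frac ` ?S)" by (rule finite_subset[rotated])
  moreover have "inj_on frac ?S"
  proof (rule inj_onI)
    fix x y assume xy: "x \<in> ?S" "y \<in> ?S" "frac x = frac y"
    then obtain z :: int where z: "x = y + of_int z" using frac_eq_iff by blast
    then have "of_int z < (1::real)" "of_int z > (-1::real)" using xy by auto
    then have "z = 0" by linarith
    then show "x = y" using z by simp
  qed
  ultimately show ?thesis by (rule finite_imageD)
qed

text \<open>One vertex at \<open>b\<close> and one at each parameter of a flat crossing.\<close>

lemma labelling_exists: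
  assumes D: "is_diagram D"
  shows "\<exists>k \<theta>. labelled D k \<theta> \<and> \<theta> 1 = b"
proof -
  define S where "S = insert b {x \<in> {b..<b+1}. curve D x \<in> flat D}"
  define xs where "xs = sorted_list_of_set S"
  define \<theta> where "\<theta> i = xs ! (i - 1)" for i :: nat
  have S: "finite S" "b \<in> S" "S \<subseteq> {b..<b+1}"
    using finite_flat_parameters[OF D] by (auto simp: S_def)
  have xs: "set xs = S" "sorted_wrt (<) xs"
    using S by (simp_all add: xs_def)
  have len: "length xs \<ge> 1"
    using xs(1) S(2) by (cases xs) auto
  have mem: "\<theta> i \<in> S" if "i \<in> {1..length xs}" for i
    using that xs(1) nth_mem[of "i - 1" xs] by (auto simp: \<theta>_def)
  have idx: "\<exists>i\<in>{1..length xs}. \<theta> i = x" if x: "x \<in> S" for x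
  proof -
    obtain i where "i < length xs" "xs ! i = x"
      using x xs(1) by (metis in_set_conv_nth)
    then show ?thesis
      by (intro bexI[of _ "Suc i"]) (auto simp: \<theta>_def)
  qed
  have mono: "strict_mono_on {1..length xs} \<theta>"
  proof (rule strict_mono_onI)
    fix i j assume "i \<in> {1..length xs}" "j \<in> {1..length xs}" "i < j"
    then show "\<theta> i < \<theta> j"
      using sorted_wrt_nth_less[OF xs(2), of "i - 1" "j - 1"] by (auto simp: \<theta>_def)
  qed
  have first: "\<theta> 1 = b"
  proof (rule antisym)
    obtain i where "i \<in> {1..length xs}" "\<theta> i = b" using idx S(2) by blast
    then show "\<theta> 1 \<le> b" using strict_mono_on_leD[OF mono, of 1 i] by auto
    show "b \<le> \<theta> 1" using mem[of 1] len S(3) by auto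
  qed
  have "labelled D (length xs) \<theta>"
  proof
    show "\<theta> (length xs) < \<theta> 1 + 1"
      using mem[of "length xs"] len S(3) first by auto
    fix x assume x: "curve D x \<in> flat D"
    define z where "z = \<lfloor>x - b\<rfloor>"
    have "x - of_int z \<in> {b..<b+1}"
      unfolding z_def by (auto; linarith)
    moreover have "curve D (x - of_int z) \<in> flat D"
      using x curve_period[OF D, of x "- z"] by simp
    ultimately have "x - of_int z \<in> S" by (simp add: S_def)
    then obtain i where "i \<in> {1..length xs}" "\<theta> i = x - of_int z" using idx by blast
    then show "\<exists>i\<in>{1..length xs}. \<exists>z::int. x = \<theta> i + of_int z"
      by (intro bexI[of _ i] exI[of _ z]) auto
  qed (use D len mono in auto)
  then show ?thesis using first by blast
qed

lemma coloring_exists: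
  assumes "is_diagram D" "curve D b \<notin> flat D"
  shows "\<exists>f g. coloring D b f g \<and> f b = 1"
  using labelling_exists[OF assms(1)] labelled.coloring_exists assms(2) by blast

lemma (in labelled) knot_value_defect:
  assumes "knot_value D q" "i \<in> {1..k}" "defect k (coloring_matrix D k \<theta>) i r"
  shows "q_equiv q r"
proof -
  obtain j where "j \<in> {1..k}" "defect k (coloring_matrix D k \<theta>) j q"
    using assms(1) coloring_defect unfolding knot_value_def by blast
  then show ?thesis
    using defect_equiv[OF cyclic_coloring_matrix] assms(2,3) by blast
qed

text \<open>Two colorings with different base points are compared through the defects of one matrix.\<close>

lemma knot_value_unique:
  assumes D: "is_diagram D" and q: "knot_value D q" "knot_value D q'"
  shows "q_equiv q q'"
proof -
  obtain k \<theta> where L: "labelled D k \<theta>" using labelling_exists[OF D] by blast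
  then have "1 \<in> {1..k}" using labelled.k by auto
  then obtain r where "defect k (coloring_matrix D k \<theta>) 1 r"
    using defect_exists[OF cyclic_coloring_matrix] by blast
  then show ?thesis
    using labelled.knot_value_defect[OF L] q \<open>1 \<in> {1..k}\<close> q_equiv_sym q_equiv_trans by blast
qed

lemma quasidet_knot_value:
  assumes D: "is_diagram D" and A: "is_coloring_matrix n D V k A" and q: "knot_value D q"
  shows "\<exists>r. q_equiv q r \<and> quasidet (Sn n) k A k k = proj n r"
proof -
  obtain \<theta> where V: "is_vertex_set D V" and \<theta>: "arc_labelling D V k \<theta>"
    and Ae: "\<And>i l. i \<in> {1..k} \<Longrightarrow> l \<in> {1..k} \<Longrightarrow> A i l = coloring_entry n D k \<theta> i l"
    using A unfolding is_coloring_matrix_def by blast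
  interpret labelled D k \<theta>
  proof
    fix x assume "curve D x \<in> flat D"
    then have "x \<in> {x. curve D x \<in> V}" using V by (auto simp: is_vertex_set_def)
    then have "x \<in> {\<theta> i + of_int z | i z. i \<in> {1..k}}"
      using \<theta> unfolding arc_labelling_def by blast
    then show "\<exists>i\<in>{1..k}. \<exists>z::int. x = \<theta> i + of_int z"
      by blast
  qed (use D \<theta> in \<open>auto simp: arc_labelling_def\<close>)
  have kk: "k \<in> {1..k}" using k by simp
  obtain r where r: "defect k (coloring_matrix D k \<theta>) k r"
    using defect_exists[OF cyclic_coloring_matrix kk] by blast
  have "quasidet (Sn n) k A k k = proj n r"
    by (rule quasidet_eq_defect[OF cyclic_coloring_matrix k r]) (simp add: Ae coloring_entry_eq)
  then show ?thesis
    using knot_value_defect[OF q kk r] by blast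
qed

lemma q_equiv_proj:
  assumes "q_equiv q q'"
  shows "\<exists>U\<in>Units (Sn n). \<exists>W\<in>Units (Sn n). pi0 (U \<otimes>\<^bsub>Sn n\<^esub> W) = \<one>\<^bsub>Sn 0\<^esub> \<and>
    proj n q' = U \<otimes>\<^bsub>Sn n\<^esub> proj n q \<otimes>\<^bsub>Sn n\<^esub> W"
proof -
  obtain u w where u: "is_unit_q u" "is_unit_q w" "tsmall (u * w - 1)" "q' = u * q * w"
    using assms by (auto simp: q_equiv_def)
  have unit: "proj n v \<in> Units (Sn n)" if v: "is_unit_q v" for v
  proof -
    obtain v' where "v * v' = 1" "v' * v = 1" using v by (auto simp: is_unit_q_def)
    then have "proj n v \<otimes>\<^bsub>Sn n\<^esub> proj n v' = \<one>\<^bsub>Sn n\<^esub>" "proj n v' \<otimes>\<^bsub>Sn n\<^esub> proj n v = \<one>\<^bsub>Sn n\<^esub>"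
      by (simp_all add: proj_hom[symmetric])
    then show ?thesis
      unfolding Units_def using proj_closed by blast
  qed
  have "pi0 (proj n u \<otimes>\<^bsub>Sn n\<^esub> proj n w) = \<one>\<^bsub>Sn 0\<^esub>"
    unfolding proj_hom(2)[symmetric] using u(3) by (intro pi0_proj_eq_one) blast
  moreover have "proj n q' = proj n u \<otimes>\<^bsub>Sn n\<^esub> proj n q \<otimes>\<^bsub>Sn n\<^esub> proj n w"
    unfolding u(4) proj_hom(2) ..
  ultimately show ?thesis
    by (intro bexI[of _ "proj n u"] bexI[of _ "proj n w"] conjI unit u(1,2))
qed

section \<open>Tangles in the square\<close>

text \<open>The parameters \<open>-1/2\<close>, \<open>0\<close>, \<open>1/2\<close>: in all pictures of the moves crossings occur only there.\<close>

definition tick :: "nat \<Rightarrow> real" where "tick k = (real k - 1) / 2"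

definition strand_velocity :: "(real \<Rightarrow> complex) \<Rightarrow> real \<Rightarrow> complex" where
  "strand_velocity p u = vector_derivative p (at u)"

text \<open>A coloring of a picture: \<open>c j 0, \<dots>, c j 3\<close> are the colors of strand \<open>j\<close> between consecutive ticks,
in the order of traversal, which is from left to right if \<open>\<sigma> j = 1\<close> and from right to left if
\<open>\<sigma> j = -1\<close>. A tick that is not a flat crossing does not change the color.\<close>

definition traversal_coloring ::
  "(real \<Rightarrow> complex) list \<Rightarrow> complex set \<Rightarrow> (nat \<Rightarrow> real) \<Rightarrow> (nat \<Rightarrow> nat \<Rightarrow> sring) \<Rightarrow> bool" where
  "traversal_coloring ps F \<sigma> c \<longleftrightarrow>
     (\<forall>j<length ps. \<forall>k<3. (ps ! j) (\<sigma> j * tick k) \<notin> F \<longrightarrow> c j k = c j (Suc k)) \<and>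
     (\<forall>i<length ps. \<forall>j<length ps. \<forall>k<3. \<forall>m<3.
        (ps ! i) (\<sigma> i * tick k) = (ps ! j) (\<sigma> j * tick m) \<longrightarrow> (ps ! i) (\<sigma> i * tick k) \<in> F \<longrightarrow>
        \<sigma> i * \<sigma> j * orient (strand_velocity (ps ! i) (\<sigma> i * tick k)) (strand_velocity (ps ! j) (\<sigma> j * tick m)) > 0 \<longrightarrow>
        crossing (c i k) (c i (Suc k)) (c j m) (c j (Suc m)))"

definition tame_picture :: "(real \<Rightarrow> complex) list \<Rightarrow> complex set \<Rightarrow> bool" where
  "tame_picture ps F \<longleftrightarrow>
     (\<forall>j<length ps. \<forall>u\<in>{-1..1}. (ps ! j) differentiable at u \<and> (ps ! j) u \<in> square \<and>
        ((ps ! j) u \<in> F \<longrightarrow> u \<in> {-1/2, 0, 1/2}))"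

lemma tame_pictureD:
  assumes "tame_picture ps F" "j < length ps" "\<bar>u\<bar> \<le> 1"
  shows "(ps ! j) differentiable at u" "(ps ! j) u \<in> square" "(ps ! j) u \<in> F \<Longrightarrow> u \<in> {-1/2, 0, 1/2}"
proof -
  have "u \<in> {-1..1}" using assms(3) by auto
  then show "(ps ! j) differentiable at u" "(ps ! j) u \<in> square" "(ps ! j) u \<in> F \<Longrightarrow> u \<in> {-1/2, 0, 1/2}"
    using assms(1,2) unfolding tame_picture_def by blast+
qed

text \<open>The part of a diagram in the square. The interval of parameters from \<open>b\<close> to \<open>b + 1\<close> contains the
passages through the square without cutting them.\<close>

locale tangle =
  fixes D :: diagram and b :: real and ps :: "(real \<Rightarrow> complex) list" and F :: "complex set"
    and e r :: "nat \<Rightarrow> real"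
  assumes diagram: "is_diagram D" and tame: "tame_picture ps F"
    and r: "j < length ps \<Longrightarrow> r j \<noteq> 0"
    and window: "j < length ps \<Longrightarrow> \<bar>u\<bar> \<le> 1 \<Longrightarrow> b < e j + r j * u \<and> e j + r j * u < b + 1"
    and disjoint: "i < length ps \<Longrightarrow> j < length ps \<Longrightarrow> \<bar>u\<bar> \<le> 1 \<Longrightarrow> \<bar>v\<bar> \<le> 1 \<Longrightarrow>
      e i + r i * u = e j + r j * v \<Longrightarrow> i = j"
    and strand: "j < length ps \<Longrightarrow> \<bar>u\<bar> \<le> 1 \<Longrightarrow> curve D (e j + r j * u) = (ps ! j) u"
    and flat_square: "flat D \<inter> square = F"
    and cover: "b < x \<Longrightarrow> x < b + 1 \<Longrightarrow> curve D x \<in> square \<Longrightarrow> \<exists>j<length ps. \<exists>u. \<bar>u\<bar> \<le> 1 \<and> x = e j + r j * u"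
begin

definition pt :: "nat \<Rightarrow> real \<Rightarrow> real" where "pt j v = e j + \<bar>r j\<bar> * v"
abbreviation \<sigma> :: "nat \<Rightarrow> real" where "\<sigma> j \<equiv> sgn (r j)"

lemma pt_eq: "pt j v = e j + r j * (\<sigma> j * v)"
  by (simp add: pt_def abs_sgn mult.assoc)

lemma pt_less: "j < length ps \<Longrightarrow> pt j v < pt j w \<longleftrightarrow> v < w"
  using r[of j] by (simp add: pt_def)

lemma abs_sigma: "\<bar>v\<bar> \<le> 1 \<Longrightarrow> \<bar>\<sigma> j * v\<bar> \<le> 1"
  by (simp add: abs_mult abs_sgn_eq)

lemma pt_window: "j < length ps \<Longrightarrow> \<bar>v\<bar> \<le> 1 \<Longrightarrow> b < pt j v" "j < length ps \<Longrightarrow> \<bar>v\<bar> \<le> 1 \<Longrightarrow> pt j v < b + 1"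
  using window[of j "\<sigma> j * v"] abs_sigma unfolding pt_eq by auto

lemma pt_strand: "j < length ps \<Longrightarrow> \<bar>v\<bar> \<le> 1 \<Longrightarrow> curve D (pt j v) = (ps ! j) (\<sigma> j * v)"
  unfolding pt_eq using strand abs_sigma by simp

lemma pt_flat: "j < length ps \<Longrightarrow> \<bar>v\<bar> \<le> 1 \<Longrightarrow> curve D (pt j v) \<in> flat D \<longleftrightarrow> (ps ! j) (\<sigma> j * v) \<in> F"
  using pt_strand[of j v] tame_pictureD(2)[OF tame _ abs_sigma, of j v] flat_square by auto

lemma pt_flat_tick:
  assumes j: "j < length ps" and v: "\<bar>v\<bar> \<le> 1" and fl: "curve D (pt j v) \<in> flat D"
  shows "\<exists>k<3. v = tick k"
proof -
  have s: "\<sigma> j * v \<in> {-1/2, 0, 1/2}"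
    using pt_flat[OF j v] fl tame_pictureD(3)[OF tame j abs_sigma[OF v]] by blast
  have "v = -1/2 \<or> v = 0 \<or> v = 1/2"
    using s r[OF j] by (auto simp: sgn_if split: if_splits)
  then show ?thesis
    by (auto simp: tick_def intro: exI[of _ 0] exI[of _ "Suc 0"] exI[of _ 2])
qed

lemma tick_le: "k < 3 \<Longrightarrow> \<bar>tick k\<bar> < 1"
  by (auto simp: tick_def)

lemma pt_velocity:
  assumes j: "j < length ps" and v: "\<bar>v\<bar> < 1"
  shows "velocity (curve D) (pt j v) = strand_velocity (ps ! j) (\<sigma> j * v) /\<^sub>R r j"
proof -
  define u where "u = \<sigma> j * v"
  have u: "\<bar>u\<bar> < 1" using v r[OF j] by (simp add: u_def abs_mult abs_sgn_eq)
  have rj: "r j \<noteq> 0" by (rule r[OF j])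
  have "((ps ! j) has_vector_derivative strand_velocity (ps ! j) u) (at u)"
    using tame_pictureD(1)[OF tame j, of u] u unfolding strand_velocity_def vector_derivative_works[symmetric]
    by simp
  moreover have "((\<lambda>x. (x - e j) / r j) has_vector_derivative inverse (r j)) (at (pt j v))"
    unfolding has_real_derivative_iff_has_vector_derivative[symmetric]
    by (auto intro!: derivative_eq_intros simp: rj field_simps)
  moreover have "(pt j v - e j) / r j = u"
    unfolding pt_eq u_def using rj by simp
  ultimately have "((ps ! j \<circ> (\<lambda>x. (x - e j) / r j)) has_vector_derivative (strand_velocity (ps ! j) u /\<^sub>R r j)) (at (pt j v))"
    using vector_diff_chain_at[of "\<lambda>x. (x - e j) / r j" "inverse (r j)" "pt j v" "ps ! j"] by simp
  moreover have "open {x. \<bar>(x - e j) / r j\<bar> < 1}"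
    by (intro open_Collect_less continuous_intros) (simp add: rj)
  moreover have "pt j v \<in> {x. \<bar>(x - e j) / r j\<bar> < 1}"
    using u \<open>(pt j v - e j) / r j = u\<close> by simp
  moreover have "(ps ! j \<circ> (\<lambda>x. (x - e j) / r j)) x = curve D x"
    if "x \<in> {x. \<bar>(x - e j) / r j\<bar> < 1}" for x
  proof -
    have "e j + r j * ((x - e j) / r j) = x" using rj by simp
    then show ?thesis
      using strand[OF j, of "(x - e j) / r j"] that by simp
  qed
  ultimately have "(curve D has_vector_derivative (strand_velocity (ps ! j) u /\<^sub>R r j)) (at (pt j v))"
    by (rule has_vector_derivative_transform_within_open)
  then show ?thesis
    unfolding velocity_def u_def by (rule vector_derivative_at)
qed

lemma pt_crossing_pair:
  assumes ij: "i < length ps" "j < length ps" "k < 3" "m < 3"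
  shows "crossing_pair D (pt i (tick k)) (pt j (tick m)) \<longleftrightarrow>
    (ps ! i) (\<sigma> i * tick k) = (ps ! j) (\<sigma> j * tick m) \<and> (ps ! i) (\<sigma> i * tick k) \<in> F \<and>
    \<sigma> i * \<sigma> j * orient (strand_velocity (ps ! i) (\<sigma> i * tick k)) (strand_velocity (ps ! j) (\<sigma> j * tick m)) > 0"
proof -
  have t: "\<bar>tick k\<bar> < 1" "\<bar>tick m\<bar> < 1" using tick_le ij by auto
  have "orient (x /\<^sub>R r i) (y /\<^sub>R r j) > 0 \<longleftrightarrow> \<sigma> i * \<sigma> j * orient x y > 0" for x y
  proof -
    have "orient (x /\<^sub>R r i) (y /\<^sub>R r j) = orient x y / (r i * r j)"
      by (simp add: orient_def divide_inverse algebra_simps)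
    then show ?thesis
      using r[OF ij(1)] r[OF ij(2)]
      by (auto simp: sgn_if zero_less_divide_iff zero_less_mult_iff mult_less_0_iff)
  qed
  then show ?thesis
    unfolding crossing_pair_def pt_velocity[OF ij(1) t(1)] pt_velocity[OF ij(2) t(2)]
    using pt_strand[OF ij(1), of "tick k"] pt_strand[OF ij(2), of "tick m"] pt_flat[OF ij(1), of "tick k"] t
    by auto
qed

lemma traversal_coloring_of_coloring:
  assumes c: "coloring D b f g"
  shows "\<exists>c. traversal_coloring ps F \<sigma> c \<and> (\<forall>j<length ps. c j 0 = f (pt j (-1)) \<and> c j 0 = g (pt j (-1)) \<and>
    c j 3 = f (pt j 1) \<and> c j 3 = g (pt j 1))"
proof -
  define c where "c j k = (if k = 0 then f (pt j (-1)) else f (pt j (tick (k - 1))))" for j k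
  have end_plain: "f (pt j v) = g (pt j v)" if j: "j < length ps" and v: "\<bar>v\<bar> \<le> 1" "\<And>k. k < 3 \<Longrightarrow> v \<noteq> tick k" for j v
    using pt_flat_tick[OF j v(1)] v(2) pt_window[OF j v(1)]
    by (intro coloring_plain[OF c]) auto
  have const: "g (pt j w) = f (pt j v)"
    if j: "j < length ps" and v: "-1 \<le> v" "v < w" "w \<le> 1" and no: "\<And>k. k < 3 \<Longrightarrow> \<not> (v < tick k \<and> tick k < w)" for j v w
  proof (rule coloring_constant[OF c])
    show "b \<le> pt j v" "pt j v < pt j w" "pt j w \<le> b + 1"
    proof -
      have "\<bar>v\<bar> \<le> 1" "\<bar>w\<bar> \<le> 1" using v by auto
      then show "b \<le> pt j v" "pt j v < pt j w" "pt j w \<le> b + 1"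
        using pt_window(1)[OF j, of v] pt_window(2)[OF j, of w] pt_less[OF j] v(2) by auto
    qed
    fix z assume z: "pt j v < z" "z < pt j w"
    define y where "y = (z - e j) / \<bar>r j\<bar>"
    have zy: "z = pt j y" using r[OF j] by (simp add: y_def pt_def)
    then have "v < y" "y < w" using z pt_less[OF j] by auto
    then show "curve D z \<notin> flat D"
      using pt_flat_tick[OF j, of y] no v unfolding zy by (metis abs_le_iff less_eq_real_def minus_le_iff order_trans)
  qed
  have at_tick: "g (pt j (tick k)) = c j k" if j: "j < length ps" and k: "k < 3" for j k
  proof (cases k)
    case 0
    then show ?thesis
      using const[OF j, of "-1" "tick 0"] by (simp add: c_def tick_def)
  next
    case (Suc k')
    have "g (pt j (tick k)) = f (pt j (tick k'))"
      using k Suc by (intro const[OF j]) (auto simp: tick_def)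
    then show ?thesis using Suc by (simp add: c_def)
  qed
  have f_tick: "f (pt j (tick k)) = c j (Suc k)" for j k
    by (simp add: c_def)
  have "traversal_coloring ps F \<sigma> c"
    unfolding traversal_coloring_def
  proof (intro conjI allI impI)
    fix j k assume j: "j < length ps" and k: "k < (3::nat)" and "(ps ! j) (\<sigma> j * tick k) \<notin> F"
    then have "f (pt j (tick k)) = g (pt j (tick k))"
      using pt_flat[OF j, of "tick k"] tick_le[OF k] pt_window[OF j, of "tick k"]
      by (intro coloring_plain[OF c]) auto
    then show "c j k = c j (Suc k)"
      using at_tick[OF j k] f_tick by simp
  next
    fix i j k m
    assume ij: "i < length ps" "j < length ps" "k < (3::nat)" "m < (3::nat)"
      and "(ps ! i) (\<sigma> i * tick k) = (ps ! j) (\<sigma> j * tick m)" "(ps ! i) (\<sigma> i * tick k) \<in> F"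
        "0 < \<sigma> i * \<sigma> j * orient (strand_velocity (ps ! i) (\<sigma> i * tick k)) (strand_velocity (ps ! j) (\<sigma> j * tick m))"
    then have "crossing_pair D (pt i (tick k)) (pt j (tick m))"
      by (simp add: pt_crossing_pair)
    then have "crossing (g (pt i (tick k))) (f (pt i (tick k))) (g (pt j (tick m))) (f (pt j (tick m)))"
      using pt_window[OF ij(1), of "tick k"] pt_window[OF ij(2), of "tick m"] tick_le[OF ij(3)] tick_le[OF ij(4)]
      by (intro coloring_crossing[OF c]) auto
    then show "crossing (c i k) (c i (Suc k)) (c j m) (c j (Suc m))"
      using at_tick f_tick ij by simp
  qed
  moreover have "c j 0 = f (pt j (-1)) \<and> c j 0 = g (pt j (-1)) \<and> c j 3 = f (pt j 1) \<and> c j 3 = g (pt j 1)"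
    if j: "j < length ps" for j
  proof -
    have "g (pt j 1) = f (pt j (tick 2))"
    proof (rule const[OF j])
      fix k :: nat assume "k < 3"
      then show "\<not> (tick 2 < tick k \<and> tick k < 1)" by (auto simp: tick_def)
    qed (auto simp: tick_def)
    moreover have "f (pt j 1) = g (pt j 1)" "f (pt j (-1)) = g (pt j (-1))"
      using tick_le by (intro end_plain[OF j]; force)+
    ultimately show ?thesis by (simp add: c_def)
  qed
  ultimately show ?thesis by blast
qed

text \<open>The color functions of a strand with given colors between the ticks, differing at the ticks
themselves.\<close>

definition step_after :: "(nat \<Rightarrow> sring) \<Rightarrow> real \<Rightarrow> sring" where
  "step_after c v = (if v < tick 0 then c 0 else if v < tick 1 then c 1 else if v < tick 2 then c 2 else c 3)"
definition step_before :: "(nat \<Rightarrow> sring) \<Rightarrow> real \<Rightarrow> sring" where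
  "step_before c v = (if v \<le> tick 0 then c 0 else if v \<le> tick 1 then c 1 else if v \<le> tick 2 then c 2 else c 3)"

lemma step_right: "\<exists>d>v. \<forall>w. v < w \<longrightarrow> w < d \<longrightarrow> step_after c w = step_after c v \<and> step_before c w = step_after c v"
proof -
  have t: "tick 0 = -1/2" "tick 1 = 0" "tick 2 = 1/2" by (simp_all add: tick_def)
  consider "v < -1/2" | "-1/2 \<le> v" "v < 0" | "0 \<le> v" "v < 1/2" | "1/2 \<le> v" by linarith
  then show ?thesis
  proof cases
    case 1 then show ?thesis by (intro exI[of _ "-1/2"]) (auto simp: step_after_def step_before_def t simp del: One_nat_def)
  next
    case 2 then show ?thesis by (intro exI[of _ 0]) (auto simp: step_after_def step_before_def t simp del: One_nat_def)
  next
    case 3 then show ?thesis by (intro exI[of _ "1/2"]) (auto simp: step_after_def step_before_def t simp del: One_nat_def)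
  next
    case 4 then show ?thesis by (intro exI[of _ "v + 1"]) (auto simp: step_after_def step_before_def t simp del: One_nat_def)
  qed
qed

lemma step_left: "\<exists>d<v. \<forall>w. d < w \<longrightarrow> w < v \<longrightarrow> step_after c w = step_before c v \<and> step_before c w = step_before c v"
proof -
  have t: "tick 0 = -1/2" "tick 1 = 0" "tick 2 = 1/2" by (simp_all add: tick_def)
  consider "v \<le> -1/2" | "-1/2 < v" "v \<le> 0" | "0 < v" "v \<le> 1/2" | "1/2 < v" by linarith
  then show ?thesis
  proof cases
    case 1 then show ?thesis by (intro exI[of _ "v - 1"]) (auto simp: step_after_def step_before_def t simp del: One_nat_def)
  next
    case 2 then show ?thesis by (intro exI[of _ "-1/2"]) (auto simp: step_after_def step_before_def t simp del: One_nat_def)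
  next
    case 3 then show ?thesis by (intro exI[of _ 0]) (auto simp: step_after_def step_before_def t simp del: One_nat_def)
  next
    case 4 then show ?thesis by (intro exI[of _ "1/2"]) (auto simp: step_after_def step_before_def t simp del: One_nat_def)
  qed
qed

lemma step_tick: "k < 3 \<Longrightarrow> step_after c (tick k) = c (Suc k)" "k < 3 \<Longrightarrow> step_before c (tick k) = c k"
  by (auto simp: step_after_def step_before_def tick_def less_Suc_eq numeral_3_eq_3 numeral_2_eq_2)

lemma step_plain: "(\<And>k. k < 3 \<Longrightarrow> v \<noteq> tick k) \<Longrightarrow> step_after c v = step_before c v"
proof -
  assume *: "\<And>k. k < 3 \<Longrightarrow> v \<noteq> tick k"
  from *[of 0] *[of 1] *[of 2] show ?thesis
    by (auto simp: step_after_def step_before_def)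
qed

lemma step_ends: "step_after c (-1) = c 0" "step_before c (-1) = c 0" "step_after c 1 = c 3" "step_before c 1 = c 3"
  by (simp_all add: step_after_def step_before_def tick_def)

definition inside :: "real \<Rightarrow> bool" where
  "inside x \<longleftrightarrow> (\<exists>j<length ps. \<bar>x - e j\<bar> \<le> \<bar>r j\<bar>)"

lemma inside_iff: "inside x \<longleftrightarrow> (\<exists>j<length ps. \<exists>v. \<bar>v\<bar> \<le> 1 \<and> x = pt j v)"
proof
  assume "inside x"
  then obtain j where j: "j < length ps" "\<bar>x - e j\<bar> \<le> \<bar>r j\<bar>" by (auto simp: inside_def)
  then have "x = pt j ((x - e j) / \<bar>r j\<bar>)" "\<bar>(x - e j) / \<bar>r j\<bar>\<bar> \<le> 1"
    using r[OF j(1)] by (simp_all add: pt_def abs_divide)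
  then show "\<exists>j<length ps. \<exists>v. \<bar>v\<bar> \<le> 1 \<and> x = pt j v" using j(1) by blast
next
  assume "\<exists>j<length ps. \<exists>v. \<bar>v\<bar> \<le> 1 \<and> x = pt j v"
  then obtain j v where j: "j < length ps" "\<bar>v\<bar> \<le> 1" "x = pt j v" by blast
  then have "\<bar>x - e j\<bar> \<le> \<bar>r j\<bar>"
    by (simp add: pt_def abs_mult mult_left_le)
  then show "inside x" using j(1) by (auto simp: inside_def)
qed

lemma closed_intervals: "closed {x. \<bar>x - e j\<bar> \<le> \<bar>r j\<bar>}"
  by (intro closed_Collect_le continuous_intros)

lemma eventually_outside: "\<not> inside x \<Longrightarrow> \<forall>\<^sub>F y in nhds x. \<not> inside y"
proof -
  assume "\<not> inside x"
  have "{y. inside y} = (\<Union>j<length ps. {x. \<bar>x - e j\<bar> \<le> \<bar>r j\<bar>})"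
    by (auto simp: inside_def)
  moreover have "closed (\<Union>j<length ps. {x. \<bar>x - e j\<bar> \<le> \<bar>r j\<bar>})"
    by (intro closed_UN ballI finite_lessThan closed_intervals)
  ultimately have "closed {y. inside y}" by simp
  then have "open (- {y. inside y})" by (simp add: open_Compl)
  from eventually_nhds_in_open[OF this, of x] \<open>\<not> inside x\<close> show ?thesis by simp
qed

lemma pt_unique:
  assumes "i < length ps" "j < length ps" "\<bar>v\<bar> \<le> 1" "\<bar>w\<bar> \<le> 1" "pt i v = pt j w"
  shows "i = j" "v = w"
proof -
  show "i = j"
    using disjoint[OF assms(1,2) abs_sigma[OF assms(3)] abs_sigma[OF assms(4)]] assms(5) unfolding pt_eq by blast
  then show "v = w"
    using assms(5) r[OF assms(1)] by (simp add: pt_def)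
qed

lemma eventually_only_strand:
  assumes j: "j < length ps" and v: "\<bar>v\<bar> \<le> 1"
  shows "\<forall>\<^sub>F y in nhds (pt j v). inside y \<longrightarrow> \<bar>y - e j\<bar> \<le> \<bar>r j\<bar>"
proof -
  have "closed (\<Union>i\<in>{..<length ps} - {j}. {x. \<bar>x - e i\<bar> \<le> \<bar>r i\<bar>})"
    using closed_intervals by (intro closed_UN) auto
  then have op: "open (- (\<Union>i\<in>{..<length ps} - {j}. {x. \<bar>x - e i\<bar> \<le> \<bar>r i\<bar>}))"
    by (rule open_Compl)
  have "pt j v \<notin> (\<Union>i\<in>{..<length ps} - {j}. {x. \<bar>x - e i\<bar> \<le> \<bar>r i\<bar>})"
  proof
    assume "pt j v \<in> (\<Union>i\<in>{..<length ps} - {j}. {x. \<bar>x - e i\<bar> \<le> \<bar>r i\<bar>})"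
    then obtain i where i: "i < length ps" "i \<noteq> j" "\<bar>pt j v - e i\<bar> \<le> \<bar>r i\<bar>" by auto
    then have "pt j v = pt i ((pt j v - e i) / \<bar>r i\<bar>)" "\<bar>(pt j v - e i) / \<bar>r i\<bar>\<bar> \<le> 1"
      using r[OF i(1)] by (simp_all add: pt_def[of i] abs_divide)
    then show False using pt_unique(1)[OF j i(1) v] i(2) by blast
  qed
  then have "\<forall>\<^sub>F y in nhds (pt j v). y \<in> - (\<Union>i\<in>{..<length ps} - {j}. {x. \<bar>x - e i\<bar> \<le> \<bar>r i\<bar>})"
    using eventually_nhds_in_open[OF op] by simp
  then show ?thesis
    by (rule eventually_mono) (auto simp: inside_def)
qed

lemma eventually_at_side:
  fixes x :: real
  assumes "\<forall>\<^sub>F y in nhds x. P y"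
  shows "\<forall>\<^sub>F y in at_right x. P y" "\<forall>\<^sub>F y in at_left x. P y"
  using assms by (auto simp: eventually_at_filter elim: eventually_mono)

text \<open>A coloring of a diagram \<open>D0\<close> that agrees with \<open>D\<close> outside the square becomes a coloring of \<open>D\<close>
when it is replaced inside by a coloring of the picture with the same end colors. All conditions
on a coloring are local, so outside the closed intervals nothing changes, and at their ends the
two definitions agree on both sides.\<close>

lemma coloring_of_traversal_coloring:
  assumes c: "coloring D0 b f g"
    and flat_out: "\<And>x. b < x \<Longrightarrow> x < b + 1 \<Longrightarrow> \<not> inside x \<Longrightarrow> curve D x \<notin> flat D \<Longrightarrow> curve D0 x \<notin> flat D0"
    and pair_out: "\<And>x y. b < x \<Longrightarrow> x < b + 1 \<Longrightarrow> b < y \<Longrightarrow> y < b + 1 \<Longrightarrow> \<not> inside x \<Longrightarrow> \<not> inside y \<Longrightarrow>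
      crossing_pair D x y \<Longrightarrow> crossing_pair D0 x y"
    and pair_mixed: "\<And>x y. b < x \<Longrightarrow> x < b + 1 \<Longrightarrow> b < y \<Longrightarrow> y < b + 1 \<Longrightarrow> inside x \<noteq> inside y \<Longrightarrow> curve D x \<noteq> curve D y"
    and lc: "traversal_coloring ps F \<sigma> a"
    and ends: "\<And>j. j < length ps \<Longrightarrow> a j 0 = g (pt j (-1)) \<and> a j 3 = f (pt j 1)"
  shows "\<exists>f' g'. coloring D b f' g' \<and> f' b = f b \<and> g' (b + 1) = g (b + 1)"
proof -
  define J where "J x = (SOME j. j < length ps \<and> \<bar>x - e j\<bar> \<le> \<bar>r j\<bar>)" for x
  define f' where "f' x = (if inside x then step_after (a (J x)) ((x - e (J x)) / \<bar>r (J x)\<bar>) else f x)" for x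
  define g' where "g' x = (if inside x then step_before (a (J x)) ((x - e (J x)) / \<bar>r (J x)\<bar>) else g x)" for x
  have J: "J (pt j v) = j" if jv: "j < length ps" "\<bar>v\<bar> \<le> 1" for j v
    unfolding J_def
  proof (rule some_equality)
    show "j < length ps \<and> \<bar>pt j v - e j\<bar> \<le> \<bar>r j\<bar>"
      using jv by (simp add: pt_def abs_mult mult_left_le)
    fix i assume i: "i < length ps \<and> \<bar>pt j v - e i\<bar> \<le> \<bar>r i\<bar>"
    then have "pt j v = pt i ((pt j v - e i) / \<bar>r i\<bar>)" "\<bar>(pt j v - e i) / \<bar>r i\<bar>\<bar> \<le> 1"
      using r[of i] by (simp_all add: pt_def[of i] abs_divide)
    then show "i = j" using pt_unique(1)[OF jv(1) _ jv(2)] i by blast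
  qed
  have fg_in: "f' (pt j v) = step_after (a j) v" "g' (pt j v) = step_before (a j) v"
    if "j < length ps" "\<bar>v\<bar> \<le> 1" for j v
    using that J[OF that] r[OF that(1)] inside_iff by (auto simp: f'_def g'_def pt_def)
  have fg_out: "f' x = f x" "g' x = g x" if "\<not> inside x" for x
    using that by (simp_all add: f'_def g'_def)
  have beyond: "\<not> \<bar>pt j v - e j\<bar> \<le> \<bar>r j\<bar>" if "j < length ps" "\<bar>v\<bar> > 1" for j v
    using that r[of j] by (simp add: pt_def abs_mult)
  have pt_ex: "\<exists>w. y = pt j w" if "j < length ps" for j y
    using r[OF that] by (intro exI[of _ "(y - e j) / \<bar>r j\<bar>"]) (simp add: pt_def)
  have "coloring D b f' g'"
    unfolding coloring_def
  proof (intro conjI ballI impI)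
    fix x assume x: "x \<in> {b..<b+1}"
    show "\<forall>\<^sub>F y in at_right x. f' y = f' x \<and> g' y = f' x"
    proof (cases "inside x")
      case False
      have "\<forall>\<^sub>F y in at_right x. f y = f x \<and> g y = f x"
        using coloring_right[OF c] x by auto
      with eventually_at_side(1)[OF eventually_outside[OF False]] show ?thesis
        by eventually_elim (simp add: fg_out False)
    next
      case True
      then obtain j v where j: "j < length ps" and v: "\<bar>v\<bar> \<le> 1" and xv: "x = pt j v"
        using inside_iff by blast
      show ?thesis
      proof (cases "v = 1")
        case True
        have "\<forall>\<^sub>F y in at_right x. \<not> inside y"
          using eventually_at_side(1)[OF eventually_only_strand[OF j v]] eventually_at_right_less[of x]
          unfolding xv
        proof eventually_elim
          fix y assume y: "inside y \<longrightarrow> \<bar>y - e j\<bar> \<le> \<bar>r j\<bar>" "pt j v < y"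
          obtain w where w: "y = pt j w" using pt_ex[OF j] by blast
          then have "1 < w" using y(2) True pt_less[OF j] by simp
          then show "\<not> inside y" using y(1) beyond[OF j, of w] w by auto
        qed
        moreover have "\<forall>\<^sub>F y in at_right x. f y = f x \<and> g y = f x"
          using coloring_right[OF c] x by auto
        ultimately show ?thesis
          by eventually_elim (simp add: fg_out xv True fg_in[OF j] step_ends ends[OF j])
      next
        case False
        then have v1: "v < 1" using v by auto
        obtain d where d: "d > v" "\<And>w. v < w \<Longrightarrow> w < d \<Longrightarrow> step_after (a j) w = step_after (a j) v \<and> step_before (a j) w = step_after (a j) v"
          using step_right by blast
        have "pt j v < pt j (min d 1)" using d(1) v1 pt_less[OF j] by simp
        from eventually_at_right_real[OF this] show ?thesis
          unfolding xv
        proof (rule eventually_mono)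
          fix y assume y: "y \<in> {pt j v<..<pt j (min d 1)}"
          obtain w where w: "y = pt j w" using pt_ex[OF j] by blast
          then have "v < w" "w < d" "w < 1" using y pt_less[OF j] by auto
          then show "f' y = f' (pt j v) \<and> g' y = f' (pt j v)"
            using d(2)[of w] v by (simp add: w fg_in[OF j])
        qed
      qed
    qed
  next
    fix x assume x: "x \<in> {b<..b+1}"
    show "\<forall>\<^sub>F y in at_left x. f' y = g' x \<and> g' y = g' x"
    proof (cases "inside x")
      case False
      have "\<forall>\<^sub>F y in at_left x. f y = g x \<and> g y = g x"
        using coloring_left[OF c] x by auto
      with eventually_at_side(2)[OF eventually_outside[OF False]] show ?thesis
        by eventually_elim (simp add: fg_out False)
    next
      case True
      then obtain j v where j: "j < length ps" and v: "\<bar>v\<bar> \<le> 1" and xv: "x = pt j v"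
        using inside_iff by blast
      show ?thesis
      proof (cases "v = -1")
        case True
        have "\<forall>\<^sub>F y in at_left x. \<not> inside y"
          using eventually_at_side(2)[OF eventually_only_strand[OF j v]] eventually_at_left_real[of "x - 1" x, simplified]
          unfolding xv
        proof eventually_elim
          fix y assume y: "inside y \<longrightarrow> \<bar>y - e j\<bar> \<le> \<bar>r j\<bar>" "pt j v - 1 < y \<and> y < pt j v"
          obtain w where w: "y = pt j w" using pt_ex[OF j] by blast
          then have "w < -1" using y(2) True pt_less[OF j] by simp
          then show "\<not> inside y" using y(1) beyond[OF j, of w] w by auto
        qed
        moreover have "\<forall>\<^sub>F y in at_left x. f y = g x \<and> g y = g x"
          using coloring_left[OF c] x by auto
        ultimately show ?thesis
          by eventually_elim (simp add: fg_out xv True fg_in[OF j] step_ends ends[OF j])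
      next
        case False
        then have v1: "-1 < v" using v by auto
        obtain d where d: "d < v" "\<And>w. d < w \<Longrightarrow> w < v \<Longrightarrow> step_after (a j) w = step_before (a j) v \<and> step_before (a j) w = step_before (a j) v"
          using step_left by blast
        have "pt j (max d (-1)) < pt j v" using d(1) v1 pt_less[OF j] by simp
        from eventually_at_left_real[OF this] show ?thesis
          unfolding xv
        proof (rule eventually_mono)
          fix y assume y: "y \<in> {pt j (max d (-1))<..<pt j v}"
          obtain w where w: "y = pt j w" using pt_ex[OF j] by blast
          then have "w < v" "d < w" "-1 < w" using y pt_less[OF j] by auto
          then show "f' y = g' (pt j v) \<and> g' y = g' (pt j v)"
            using d(2)[of w] v by (simp add: w fg_in[OF j])
        qed
      qed
    qed
  next
    fix x assume x: "x \<in> {b<..<b+1}" "curve D x \<notin> flat D"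
    show "f' x = g' x"
    proof (cases "inside x")
      case False
      then show ?thesis
        using coloring_plain[OF c] flat_out x by (simp add: fg_out)
    next
      case True
      then obtain j v where j: "j < length ps" and v: "\<bar>v\<bar> \<le> 1" and xv: "x = pt j v"
        using inside_iff by blast
      show ?thesis
      proof (cases "\<exists>k<3. v = tick k")
        case True
        then obtain k where k: "k < 3" "v = tick k" by blast
        then have "a j k = a j (Suc k)"
          using lc x(2) pt_flat[OF j v] j unfolding xv traversal_coloring_def by blast
        then show ?thesis
          unfolding xv fg_in[OF j v] using k by (simp add: step_tick)
      next
        case False
        then show ?thesis
          unfolding xv fg_in[OF j v] by (intro step_plain) blast
      qed
    qed
  next
    fix x y assume x: "x \<in> {b<..<b+1}" and y: "y \<in> {b<..<b+1}" and pair: "crossing_pair D x y"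
    have cur: "curve D x = curve D y" "curve D x \<in> flat D" "curve D y \<in> flat D"
      using pair by (auto simp: crossing_pair_def)
    show "crossing (g' x) (f' x) (g' y) (f' y)"
    proof (cases "inside x")
      case False
      then have "\<not> inside y" using pair_mixed[of x y] cur x y by auto
      then show ?thesis
        using False coloring_crossing[OF c] pair_out[OF _ _ _ _ False _ pair] x y by (simp add: fg_out)
    next
      case True
      then have "inside y" using pair_mixed[of x y] cur x y by auto
      then obtain i j v w where i: "i < length ps" "\<bar>v\<bar> \<le> 1" "x = pt i v" and j: "j < length ps" "\<bar>w\<bar> \<le> 1" "y = pt j w"
        using True inside_iff by metis
      obtain k m where k: "k < 3" "v = tick k" and m: "m < 3" "w = tick m"
        using pt_flat_tick[OF i(1,2)] pt_flat_tick[OF j(1,2)] cur i(3) j(3) by metis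
      have "crossing (a i k) (a i (Suc k)) (a j m) (a j (Suc m))"
        using pair lc i(1) j(1) k(1) m(1) unfolding i(3) j(3) k(2) m(2) pt_crossing_pair[OF i(1) j(1) k(1) m(1)]
          traversal_coloring_def by blast
      then show ?thesis
        unfolding i(3) j(3) fg_in[OF i(1,2)] fg_in[OF j(1,2)] using k m by (simp add: step_tick)
    qed
  qed
  moreover have "\<not> inside b" "\<not> inside (b + 1)"
    using inside_iff pt_window by force+
  ultimately show ?thesis using fg_out by blast
qed

end

section \<open>Colorings of pictures\<close>

lemma crossing_reverse: "\<exists>p q. crossing p p' q q'"
  by (rule exI[of _ "qs * p' + qt * q'"], rule exI[of _ "qsi * (q' - qt * (qs * p' + qt * q'))"])
    (simp add: crossing_def)

lemma crossing_backward: "\<exists>p q'. crossing p p' q q'"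
proof -
  have "is_unit_q (1 - qt * qt)"
    using tsmall_qt by (intro is_unit_q_one_minus) (simp add: tdiv_mult_left del: One_nat_def)
  then obtain u where u: "u * (1 - qt * qt) = 1" "(1 - qt * qt) * u = 1"
    by (auto simp: is_unit_q_def)
  show ?thesis
    unfolding crossing_def
    using solve_crossing[OF u, where p' = "qs * p'" and q = "qs * q"] by (intro exI conjI)
qed

text \<open>The crossing relation in terms of the colors left and right of the crossing. The first strand
is strand 1 if both strands run from left to right; reversing a strand exchanges its incoming and
outgoing color and also the roles of the two strands.\<close>

definition dcross :: "real \<Rightarrow> real \<Rightarrow> sring \<Rightarrow> sring \<Rightarrow> sring \<Rightarrow> sring \<Rightarrow> bool" where
  "dcross \<sigma> \<tau> l r l' r' \<longleftrightarrow>
     (if \<sigma> > 0 then if \<tau> > 0 then crossing l r l' r' else crossing r' l' l r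
      else if \<tau> > 0 then crossing l' r' r l else crossing r l r' l')"

lemma dcross_kink: "\<exists>m. dcross \<sigma> \<sigma> m a a m"
  using crossing_kink_strand1_first crossing_kink_strand2_first by (auto simp: dcross_def)

lemma dcross_bigon: "\<exists>x y. dcross \<tau> \<sigma> c y a x \<and> dcross \<sigma> \<tau> x a y c"
proof -
  have "\<exists>x y. dcross \<tau> \<sigma> c y a x"
  proof (cases "\<tau> > 0")
    case True
    then show ?thesis
      using crossing_forward[of c a] crossing_backward[of a c] by (cases "\<sigma> > 0") (auto simp: dcross_def)
  next
    case False
    then show ?thesis
      using crossing_sideways[of a c] crossing_reverse[of c a] by (cases "\<sigma> > 0") (auto simp: dcross_def)
  qed
  moreover have "dcross \<tau> \<sigma> c y a x \<Longrightarrow> dcross \<sigma> \<tau> x a y c" for x y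
    using crossing_bigon by (auto simp: dcross_def split: if_splits)
  ultimately show ?thesis by blast
qed

text \<open>All eight orientations of the third move. The strands are cyclic with respect to the roles 1
and 2 at the crossings if \<open>\<sigma>0\<close> and \<open>\<sigma>1\<close> agree and \<open>\<sigma>2\<close> differs, and acyclic otherwise.\<close>

lemma dcross_triangle:
  assumes "dcross \<sigma>1 \<sigma>2 l1 m1 l2 m2" "dcross \<sigma>1 \<sigma>0 m1 r1 l0 m0" "dcross \<sigma>2 \<sigma>0 m2 r2 m0 r0"
  shows "\<exists>n0 n1 n2. dcross \<sigma>2 \<sigma>0 l2 n2 l0 n0 \<and> dcross \<sigma>1 \<sigma>0 l1 n1 n0 r0 \<and> dcross \<sigma>1 \<sigma>2 n1 r1 n2 r2"
proof -
  consider "\<sigma>0 > 0" "\<sigma>1 > 0" "\<sigma>2 > 0" | "\<sigma>0 > 0" "\<sigma>1 > 0" "\<not> \<sigma>2 > 0"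
    | "\<sigma>0 > 0" "\<not> \<sigma>1 > 0" "\<sigma>2 > 0" | "\<sigma>0 > 0" "\<not> \<sigma>1 > 0" "\<not> \<sigma>2 > 0"
    | "\<not> \<sigma>0 > 0" "\<sigma>1 > 0" "\<sigma>2 > 0" | "\<not> \<sigma>0 > 0" "\<sigma>1 > 0" "\<not> \<sigma>2 > 0"
    | "\<not> \<sigma>0 > 0" "\<not> \<sigma>1 > 0" "\<sigma>2 > 0" | "\<not> \<sigma>0 > 0" "\<not> \<sigma>1 > 0" "\<not> \<sigma>2 > 0"
    by blast
  then show ?thesis
  proof cases
    case 1
    then show ?thesis
      using assms acyclic_triangle[of l1 l2 r1 l0 r2 r0] unfolding dcross_def by (simp only: if_True if_False) blast
  next
    case 2
    then show ?thesis
      using assms cyclic_triangle[of r1 l0 r0 r2 l2 l1] unfolding dcross_def by (simp only: if_True if_False) blast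
  next
    case 3
    then show ?thesis
      using assms acyclic_triangle[of l2 l0 r2 r1 r0 l1] unfolding dcross_def by (simp only: if_True if_False) blast
  next
    case 4
    then show ?thesis
      using assms acyclic_triangle[of l0 r1 r0 r2 l1 l2] unfolding dcross_def by (simp only: if_True if_False) blast
  next
    case 5
    then show ?thesis
      using assms acyclic_triangle[of r0 l1 l0 l2 r1 r2] unfolding dcross_def by (simp only: if_True if_False) blast
  next
    case 6
    then show ?thesis
      using assms acyclic_triangle[of r2 r0 l2 l1 l0 r1] unfolding dcross_def by (simp only: if_True if_False) blast
  next
    case 7
    then show ?thesis
      using assms cyclic_triangle[of l1 r0 l0 l2 r2 r1] unfolding dcross_def by (simp only: if_True if_False) blast
  next
    case 8
    then show ?thesis
      using assms acyclic_triangle[of r1 r2 l1 r0 l2 l0] unfolding dcross_def by (simp only: if_True if_False) blast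
  qed
qed

text \<open>As \<open>traversal_coloring\<close>, but with the colors of each strand listed from left to right; the
conditions then refer to the picture at fixed parameters, whatever the orientations are.\<close>

definition picture_coloring ::
  "(real \<Rightarrow> complex) list \<Rightarrow> complex set \<Rightarrow> (nat \<Rightarrow> real) \<Rightarrow> (nat \<Rightarrow> nat \<Rightarrow> sring) \<Rightarrow> bool" where
  "picture_coloring ps F \<sigma> d \<longleftrightarrow>
     (\<forall>j<length ps. \<forall>p<3. (ps ! j) (tick p) \<notin> F \<longrightarrow> d j p = d j (Suc p)) \<and>
     (\<forall>i<length ps. \<forall>j<length ps. \<forall>p<3. \<forall>q<3.
        (ps ! i) (tick p) = (ps ! j) (tick q) \<longrightarrow> (ps ! i) (tick p) \<in> F \<longrightarrow>
        orient (strand_velocity (ps ! i) (tick p)) (strand_velocity (ps ! j) (tick q)) > 0 \<longrightarrow>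
        dcross (\<sigma> i) (\<sigma> j) (d i p) (d i (Suc p)) (d j q) (d j (Suc q)))"

definition reverse_where_negative :: "(nat \<Rightarrow> real) \<Rightarrow> (nat \<Rightarrow> nat \<Rightarrow> 'a) \<Rightarrow> nat \<Rightarrow> nat \<Rightarrow> 'a" where
  "reverse_where_negative \<sigma> c j p = (if \<sigma> j > 0 then c j p else c j (3 - p))"

lemma tick_reverse: "p < 3 \<Longrightarrow> - tick p = tick (2 - p)"
  by (auto simp: tick_def)

lemma three_minus: "p < 3 \<Longrightarrow> 3 - p = Suc (2 - p)" "p < 3 \<Longrightarrow> 3 - Suc p = 2 - p" "p < 3 \<Longrightarrow> 2 - (2 - p) = (p::nat)"
  "p < 3 \<Longrightarrow> 2 - p < (3::nat)"
  by auto

lemma picture_coloring_of_traversal: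
  assumes c: "traversal_coloring ps F \<sigma> c" and \<sigma>: "\<And>j. j < length ps \<Longrightarrow> \<sigma> j = 1 \<or> \<sigma> j = -1"
  shows "picture_coloring ps F \<sigma> (reverse_where_negative \<sigma> c)"
proof -
  have plain: "c j k = c j (Suc k)" if "j < length ps" "k < 3" "(ps ! j) (\<sigma> j * tick k) \<notin> F" for j k
    using c that unfolding traversal_coloring_def by blast
  have cr: "crossing (c i k) (c i (Suc k)) (c j m) (c j (Suc m))"
    if "i < length ps" "j < length ps" "k < 3" "m < 3"
      "(ps ! i) (\<sigma> i * tick k) = (ps ! j) (\<sigma> j * tick m)" "(ps ! i) (\<sigma> i * tick k) \<in> F"
      "\<sigma> i * \<sigma> j * orient (strand_velocity (ps ! i) (\<sigma> i * tick k)) (strand_velocity (ps ! j) (\<sigma> j * tick m)) > 0"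
    for i j k m
    using c that unfolding traversal_coloring_def by blast
  show ?thesis
    unfolding picture_coloring_def
  proof (intro conjI allI impI)
    fix j p assume jp: "j < length ps" "p < (3::nat)" "(ps ! j) (tick p) \<notin> F"
    then show "reverse_where_negative \<sigma> c j p = reverse_where_negative \<sigma> c j (Suc p)"
      using \<sigma>[OF jp(1)] plain[of j p] plain[of j "2 - p"]
      by (auto simp: reverse_where_negative_def tick_reverse three_minus)
  next
    fix i j p q
    assume ij: "i < length ps" "j < length ps" "p < (3::nat)" "q < (3::nat)"
      and eq: "(ps ! i) (tick p) = (ps ! j) (tick q)" "(ps ! i) (tick p) \<in> F"
        "orient (strand_velocity (ps ! i) (tick p)) (strand_velocity (ps ! j) (tick q)) > 0"
    have neg: "orient (strand_velocity (ps ! j) (tick q)) (strand_velocity (ps ! i) (tick p)) < 0"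
      using eq(3) by (simp add: orient_def mult.commute)
    show "dcross (\<sigma> i) (\<sigma> j) (reverse_where_negative \<sigma> c i p) (reverse_where_negative \<sigma> c i (Suc p))
         (reverse_where_negative \<sigma> c j q) (reverse_where_negative \<sigma> c j (Suc q))"
      using \<sigma>[OF ij(1)] \<sigma>[OF ij(2)]
    proof (elim disjE)
      assume s: "\<sigma> i = 1" "\<sigma> j = 1"
      show ?thesis
        using cr[OF ij] eq s by (simp add: dcross_def reverse_where_negative_def)
    next
      assume s: "\<sigma> i = 1" "\<sigma> j = -1"
      show ?thesis
        using cr[OF ij(2,1) three_minus(4)[OF ij(4)] ij(3)] eq neg s ij
        by (simp add: dcross_def reverse_where_negative_def tick_reverse three_minus)
    next
      assume s: "\<sigma> i = -1" "\<sigma> j = 1"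
      show ?thesis
        using cr[OF ij(2,1) ij(4) three_minus(4)[OF ij(3)]] eq neg s ij
        by (simp add: dcross_def reverse_where_negative_def tick_reverse three_minus)
    next
      assume s: "\<sigma> i = -1" "\<sigma> j = -1"
      show ?thesis
        using cr[OF ij(1,2) three_minus(4)[OF ij(3)] three_minus(4)[OF ij(4)]] eq s ij
        by (simp add: dcross_def reverse_where_negative_def tick_reverse three_minus)
    qed
  qed
qed

lemma traversal_of_picture_coloring:
  assumes d: "picture_coloring ps F \<sigma> d" and \<sigma>: "\<And>j. j < length ps \<Longrightarrow> \<sigma> j = 1 \<or> \<sigma> j = -1"
  shows "traversal_coloring ps F \<sigma> (reverse_where_negative \<sigma> d)"
proof -
  have plain: "d j p = d j (Suc p)" if "j < length ps" "p < 3" "(ps ! j) (tick p) \<notin> F" for j p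
    using d that unfolding picture_coloring_def by blast
  have cr: "dcross (\<sigma> i) (\<sigma> j) (d i p) (d i (Suc p)) (d j q) (d j (Suc q))"
    if "i < length ps" "j < length ps" "p < 3" "q < 3"
      "(ps ! i) (tick p) = (ps ! j) (tick q)" "(ps ! i) (tick p) \<in> F"
      "orient (strand_velocity (ps ! i) (tick p)) (strand_velocity (ps ! j) (tick q)) > 0"
    for i j p q
    using d that unfolding picture_coloring_def by blast
  show ?thesis
    unfolding traversal_coloring_def
  proof (intro conjI allI impI)
    fix j p assume jp: "j < length ps" "p < (3::nat)" "(ps ! j) (\<sigma> j * tick p) \<notin> F"
    then show "reverse_where_negative \<sigma> d j p = reverse_where_negative \<sigma> d j (Suc p)"
      using \<sigma>[OF jp(1)] plain[of j p] plain[of j "2 - p"]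
      by (auto simp: reverse_where_negative_def tick_reverse three_minus)
  next
    fix i j p q
    assume ij: "i < length ps" "j < length ps" "p < (3::nat)" "q < (3::nat)"
      and eq: "(ps ! i) (\<sigma> i * tick p) = (ps ! j) (\<sigma> j * tick q)" "(ps ! i) (\<sigma> i * tick p) \<in> F"
        "0 < \<sigma> i * \<sigma> j * orient (strand_velocity (ps ! i) (\<sigma> i * tick p)) (strand_velocity (ps ! j) (\<sigma> j * tick q))"
    have neg: "0 < - (\<sigma> i * \<sigma> j * orient (strand_velocity (ps ! j) (\<sigma> j * tick q)) (strand_velocity (ps ! i) (\<sigma> i * tick p)))"
      using eq(3) orient_commute[of "strand_velocity (ps ! i) (\<sigma> i * tick p)"] by simp
    show "crossing (reverse_where_negative \<sigma> d i p) (reverse_where_negative \<sigma> d i (Suc p))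
         (reverse_where_negative \<sigma> d j q) (reverse_where_negative \<sigma> d j (Suc q))"
      using \<sigma>[OF ij(1)] \<sigma>[OF ij(2)]
    proof (elim disjE)
      assume s: "\<sigma> i = 1" "\<sigma> j = 1"
      show ?thesis
        using cr[OF ij] eq s by (simp add: dcross_def reverse_where_negative_def)
    next
      assume s: "\<sigma> i = 1" "\<sigma> j = -1"
      show ?thesis
        using cr[OF ij(2,1) three_minus(4)[OF ij(4)] ij(3)] eq neg s ij
        by (simp add: dcross_def reverse_where_negative_def tick_reverse three_minus)
    next
      assume s: "\<sigma> i = -1" "\<sigma> j = 1"
      show ?thesis
        using cr[OF ij(2,1) ij(4) three_minus(4)[OF ij(3)]] eq neg s ij
        by (simp add: dcross_def reverse_where_negative_def tick_reverse three_minus)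
    next
      assume s: "\<sigma> i = -1" "\<sigma> j = -1"
      show ?thesis
        using cr[OF ij(1,2) three_minus(4)[OF ij(3)] three_minus(4)[OF ij(4)]] eq s ij
        by (simp add: dcross_def reverse_where_negative_def tick_reverse three_minus)
    qed
  qed
qed

section \<open>Pictures\<close>

section \<open>The pictures of the moves\<close>

lemma strand_velocity_Complex:
  assumes "(h has_real_derivative x) (at u)" "(k has_real_derivative y) (at u)"
  shows "strand_velocity (\<lambda>u. Complex (h u) (k u)) u = Complex x y" "(\<lambda>u. Complex (h u) (k u)) differentiable at u"
proof -
  have "((\<lambda>u. of_real (h u) + \<i> * of_real (k u)) has_vector_derivative of_real x + \<i> * of_real y) (at u)"
    using assms
    by (intro has_vector_derivative_add has_vector_derivative_mult_right has_vector_derivative_of_real)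
  then have d: "((\<lambda>u. Complex (h u) (k u)) has_vector_derivative Complex x y) (at u)"
    by (simp add: Complex_eq)
  then show "strand_velocity (\<lambda>u. Complex (h u) (k u)) u = Complex x y"
    unfolding strand_velocity_def by (rule vector_derivative_at)
  show "(\<lambda>u. Complex (h u) (k u)) differentiable at u"
    using d by (rule differentiableI_vector)
qed

lemma bump_derivative: "(bump has_real_derivative - 2 * u * (1 - u\<^sup>2)) (at u)"
  unfolding bump_def by (auto intro!: derivative_eq_intros simp: power2_eq_square field_simps)

lemma bump_bounds: "\<bar>u\<bar> \<le> 1 \<Longrightarrow> 0 \<le> bump u \<and> bump u \<le> 1 / 2"
  by (simp add: bump_def power_le_one abs_square_le_1)

lemma bump_eq: "\<bar>u\<bar> \<le> 1 \<Longrightarrow> bump u = 9 / 32 \<longleftrightarrow> u = -1/2 \<or> u = 1/2"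
proof -
  assume u: "\<bar>u\<bar> \<le> 1"
  then have nn: "0 \<le> 1 - u\<^sup>2" by (simp add: abs_square_le_1)
  have "bump u = 9 / 32 \<longleftrightarrow> (1 - u\<^sup>2)\<^sup>2 = (3/4)\<^sup>2"
  proof -
    have "(3/4)\<^sup>2 = (9/16 :: real)" by (simp add: power2_eq_square)
    then show ?thesis unfolding bump_def by auto
  qed
  also have "\<dots> \<longleftrightarrow> 1 - u\<^sup>2 = 3/4"
    using nn by (simp add: power2_eq_iff_nonneg)
  also have "\<dots> \<longleftrightarrow> u\<^sup>2 = (1/2)\<^sup>2"
    by (auto simp: power2_eq_square)
  also have "\<dots> \<longleftrightarrow> u = -1/2 \<or> u = 1/2"
    by (auto simp: power2_eq_iff)
  finally show ?thesis .
qed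

lemmas graph_strand = strand_velocity_Complex[OF DERIV_ident]

lemma graph_lines:
  "strand_velocity (\<lambda>u. Complex u c) u = Complex 1 0" "(\<lambda>u. Complex u c) differentiable at u"
  "strand_velocity (\<lambda>u. Complex u (c * u)) u = Complex 1 c" "(\<lambda>u. Complex u (c * u)) differentiable at u"
  "strand_velocity (\<lambda>u. Complex u (bump u)) u = Complex 1 (- 2 * u * (1 - u\<^sup>2))"
  "(\<lambda>u. Complex u (bump u)) differentiable at u"
  "strand_velocity (\<lambda>u. Complex u (- bump u)) u = Complex 1 (2 * u * (1 - u\<^sup>2))"
  "(\<lambda>u. Complex u (- bump u)) differentiable at u"
  "strand_velocity (\<lambda>u. Complex u (c - bump u)) u = Complex 1 (2 * u * (1 - u\<^sup>2))"
  "(\<lambda>u. Complex u (c - bump u)) differentiable at u"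
proof -
  note b = bump_derivative[of u]
  have 1: "((\<lambda>u. c) has_real_derivative 0) (at u)" and 2: "((\<lambda>u. c * u) has_real_derivative c) (at u)"
    and 3: "((\<lambda>u. - bump u) has_real_derivative 2 * u * (1 - u\<^sup>2)) (at u)"
    and 4: "((\<lambda>u. c - bump u) has_real_derivative 2 * u * (1 - u\<^sup>2)) (at u)"
    by (auto intro!: derivative_eq_intros b)
  show "strand_velocity (\<lambda>u. Complex u c) u = Complex 1 0" "(\<lambda>u. Complex u c) differentiable at u"
    "strand_velocity (\<lambda>u. Complex u (c * u)) u = Complex 1 c" "(\<lambda>u. Complex u (c * u)) differentiable at u"
    "strand_velocity (\<lambda>u. Complex u (bump u)) u = Complex 1 (- 2 * u * (1 - u\<^sup>2))"
    "(\<lambda>u. Complex u (bump u)) differentiable at u"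
    "strand_velocity (\<lambda>u. Complex u (- bump u)) u = Complex 1 (2 * u * (1 - u\<^sup>2))"
    "(\<lambda>u. Complex u (- bump u)) differentiable at u"
    "strand_velocity (\<lambda>u. Complex u (c - bump u)) u = Complex 1 (2 * u * (1 - u\<^sup>2))"
    "(\<lambda>u. Complex u (c - bump u)) differentiable at u"
    using graph_strand[OF 1] graph_strand[OF 2] graph_strand[OF b] graph_strand[OF 3] graph_strand[OF 4]
    by simp_all
qed

lemma kink_derivative:
  "strand_velocity kink u = Complex (1 - 32/9 * bump u + 64/9 * u\<^sup>2 * (1 - u\<^sup>2)) (- 2 * u * (1 - u\<^sup>2))"
  "kink differentiable at u"
proof -
  have "((\<lambda>u. u * (1 - 32/9 * bump u)) has_real_derivative (1 - 32/9 * bump u + 64/9 * u\<^sup>2 * (1 - u\<^sup>2))) (at u)"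
    by (auto intro!: derivative_eq_intros bump_derivative simp: power2_eq_square)
  note strand_velocity_Complex[OF this bump_derivative]
  moreover have "kink = (\<lambda>u. Complex (u * (1 - 32/9 * bump u)) (bump u))"
    by (rule ext) (simp add: kink_def)
  ultimately show "strand_velocity kink u = Complex (1 - 32/9 * bump u + 64/9 * u\<^sup>2 * (1 - u\<^sup>2)) (- 2 * u * (1 - u\<^sup>2))"
    "kink differentiable at u" by simp_all
qed

lemma tick_values: "tick 0 = - (1/2)" "tick (Suc 0) = 0" "tick 2 = 1/2"
  by (simp_all add: tick_def)

lemma all_less_3: "(\<forall>p<3. P p) \<longleftrightarrow> P 0 \<and> P (Suc 0) \<and> P (2::nat)"
  by (auto simp: less_Suc_eq numeral_3_eq_3 numeral_2_eq_2)

lemma all_less_2: "(\<forall>p<2. P p) \<longleftrightarrow> P 0 \<and> P (Suc (0::nat))"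
  by (auto simp: less_Suc_eq numeral_2_eq_2)

lemma bump_at_ticks: "bump (- (1/2)) = 9/32" "bump 0 = 1/2" "bump (1/2) = 9/32"
  by (simp_all add: bump_def power2_eq_square)

lemma tame_pic1_before: "tame_picture pic1_before {}"
  by (auto simp: tame_picture_def pic1_before_def graph_lines square_def)

lemma kink_in_square: "\<bar>u\<bar> \<le> 1 \<Longrightarrow> kink u \<in> square"
proof -
  assume u: "\<bar>u\<bar> \<le> 1"
  have "\<bar>1 - 32/9 * bump u\<bar> \<le> 1" using bump_bounds[OF u] by auto
  then have "\<bar>u * (1 - 32/9 * bump u)\<bar> \<le> 1 * 1"
    unfolding abs_mult using u by (intro mult_mono) auto
  then show ?thesis using bump_bounds[OF u] by (simp add: kink_def square_def)
qed

lemma abs_le_1: "u \<in> {-1..1} \<Longrightarrow> \<bar>u\<bar> \<le> (1::real)" by auto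

lemma tame_pic1_after: "F \<subseteq> {crossing1} \<Longrightarrow> tame_picture pic1_after F"
proof -
  assume F: "F \<subseteq> {crossing1}"
  have "u = - 1/2 \<or> u = 1/2" if "\<bar>u\<bar> \<le> 1" "kink u = crossing1" for u
    using that bump_eq by (auto simp: kink_def crossing1_def)
  then show ?thesis
    using F kink_in_square abs_le_1 by (force simp: tame_picture_def pic1_after_def kink_derivative)
qed

lemma tame_graphs:
  assumes "\<And>p u. p \<in> set ps \<Longrightarrow> \<bar>u\<bar> \<le> 1 \<Longrightarrow> p differentiable at u \<and> Re (p u) = u \<and> \<bar>Im (p u)\<bar> \<le> 1"
    and "Re ` F \<subseteq> {-1/2, 0, 1/2}"
  shows "tame_picture ps F"
  unfolding tame_picture_def
proof (intro allI impI ballI conjI)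
  fix j u assume j: "j < length ps" and u: "u \<in> {-1..1::real}"
  note * = assms(1)[OF nth_mem[OF j] abs_le_1[OF u]]
  show "(ps ! j) differentiable at u" using * by blast
  show "(ps ! j) u \<in> square" using * abs_le_1[OF u] by (simp add: square_def)
  show "u \<in> {-1/2, 0, 1/2}" if "(ps ! j) u \<in> F"
    using * that assms(2) by (metis image_eqI subsetD)
qed

lemma abs_9_16: "\<bar>u\<bar> \<le> 1 \<Longrightarrow> \<bar>9 * u / 16\<bar> \<le> (1::real)" by auto

lemma bump_abs: "\<bar>u\<bar> \<le> 1 \<Longrightarrow> \<bar>bump u\<bar> \<le> 1" "\<bar>u\<bar> \<le> 1 \<Longrightarrow> \<bar>9/32 - bump u\<bar> \<le> 1"
  using bump_bounds[of u] by auto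

lemma graph_line_9_16: "strand_velocity (\<lambda>u. Complex u (9 * u / 16)) u = Complex 1 (9/16)"
  "strand_velocity (\<lambda>u. Complex u (- (9 * u / 16))) u = Complex 1 (-9/16)"
  "(\<lambda>u. Complex u (9 * u / 16)) differentiable at u"
  "(\<lambda>u. Complex u (- (9 * u / 16))) differentiable at u"
  using graph_lines(3,4)[of "9/16" u] graph_lines(3,4)[of "-9/16" u] by simp_all

lemma tame_pic2_before: "tame_picture pic2_before {}"
  by (rule tame_graphs) (auto simp: pic2_before_def graph_lines)

lemma tame_pic2_after: "F \<subseteq> crossings2 \<Longrightarrow> tame_picture pic2_after F"
  by (rule tame_graphs) (auto simp: pic2_after_def crossings2_def graph_lines bump_abs)

lemma tame_pic3_before: "F \<subseteq> crossings3_before \<Longrightarrow> tame_picture pic3_before F"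
  by (rule tame_graphs) (auto simp: pic3_before_def crossings3_before_def graph_lines graph_line_9_16 bump_abs abs_9_16)

lemma tame_pic3_after: "F \<subseteq> crossings3_after \<Longrightarrow> tame_picture pic3_after F"
  by (rule tame_graphs) (auto simp: pic3_after_def crossings3_after_def graph_lines graph_line_9_16 bump_abs abs_9_16)

section \<open>Reidemeister moves\<close>

lemma picture_coloring_no_crossings:
  "picture_coloring ps {} \<sigma> d \<longleftrightarrow> (\<forall>j<length ps. d j 0 = d j 1 \<and> d j 1 = d j 2 \<and> d j 2 = d j 3)"
  by (simp add: picture_coloring_def all_less_3 numeral_2_eq_2[symmetric])

lemma pic1_after_coloring:
  assumes "d 0 1 = d 0 2" "dcross (\<sigma> 0) (\<sigma> 0) (d 0 2) (d 0 3) (d 0 0) (d 0 1)"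
  shows "picture_coloring pic1_after {crossing1} \<sigma> d"
proof -
  have k: "kink (- (1/2)) = crossing1" "kink 0 \<noteq> crossing1" "kink (1/2) = crossing1"
    by (simp_all add: kink_def crossing1_def bump_at_ticks)
  have v: "strand_velocity kink (- (1/2)) = Complex (4/3) (3/4)" "strand_velocity kink (1/2) = Complex (4/3) (-3/4)"
    by (simp_all add: kink_derivative bump_at_ticks power2_eq_square)
  show ?thesis
    using assms k v
    by (simp add: picture_coloring_def pic1_after_def all_less_3 tick_values orient_def numeral_2_eq_2[symmetric])
qed

lemma pic2_after_coloring:
  assumes "d 0 1 = d 0 2" "d 1 1 = d 1 2"
    and "dcross (\<sigma> 1) (\<sigma> 0) (d 1 0) (d 1 1) (d 0 0) (d 0 1)"
    and "dcross (\<sigma> 0) (\<sigma> 1) (d 0 2) (d 0 3) (d 1 2) (d 1 3)"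
  shows "picture_coloring pic2_after crossings2 \<sigma> d"
  using assms
  by (simp add: picture_coloring_def pic2_after_def crossings2_def all_less_3 all_less_2 tick_values bump_at_ticks
      graph_lines orient_def power2_eq_square numeral_2_eq_2[symmetric])

lemma pic3_before_coloring:
  "picture_coloring pic3_before crossings3_before \<sigma> d \<longleftrightarrow>
    d 0 0 = d 0 1 \<and> d 1 2 = d 1 3 \<and> d 2 1 = d 2 2 \<and>
    dcross (\<sigma> 1) (\<sigma> 2) (d 1 0) (d 1 1) (d 2 0) (d 2 1) \<and>
    dcross (\<sigma> 1) (\<sigma> 0) (d 1 1) (d 1 2) (d 0 1) (d 0 2) \<and>
    dcross (\<sigma> 2) (\<sigma> 0) (d 2 2) (d 2 3) (d 0 2) (d 0 3)"
  by (auto simp: picture_coloring_def pic3_before_def crossings3_before_def all_less_3 tick_values bump_at_ticks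
      graph_lines graph_line_9_16 orient_def power2_eq_square numeral_2_eq_2[symmetric] complex_eq_iff)

lemma pic3_after_coloring:
  "picture_coloring pic3_after crossings3_after \<sigma> d \<longleftrightarrow>
    d 0 2 = d 0 3 \<and> d 1 0 = d 1 1 \<and> d 2 1 = d 2 2 \<and>
    dcross (\<sigma> 2) (\<sigma> 0) (d 2 0) (d 2 1) (d 0 0) (d 0 1) \<and>
    dcross (\<sigma> 1) (\<sigma> 0) (d 1 1) (d 1 2) (d 0 1) (d 0 2) \<and>
    dcross (\<sigma> 1) (\<sigma> 2) (d 1 2) (d 1 3) (d 2 2) (d 2 3)"
  by (auto simp: picture_coloring_def pic3_after_def crossings3_after_def all_less_3 tick_values bump_at_ticks
      graph_lines graph_line_9_16 orient_def power2_eq_square numeral_2_eq_2[symmetric] complex_eq_iff)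

lemma pic3_mixed_coloring:
  "picture_coloring pic3_before {0} \<sigma> d \<longleftrightarrow> picture_coloring pic3_after {0} \<sigma> d"
  by (simp add: picture_coloring_def pic3_before_def pic3_after_def all_less_3 tick_values bump_at_ticks
      graph_lines graph_line_9_16 orient_def power2_eq_square numeral_2_eq_2[symmetric] complex_eq_iff)

text \<open>Colorings extend across a move without change at the boundary of the square.\<close>

definition picture_related :: "(real \<Rightarrow> complex) list \<Rightarrow> complex set \<Rightarrow> (real \<Rightarrow> complex) list \<Rightarrow> complex set \<Rightarrow> bool" where
  "picture_related ps F ps' F' \<longleftrightarrow> length ps' = length ps \<and> tame_picture ps F \<and> tame_picture ps' F' \<and>
     (\<forall>\<sigma> d. picture_coloring ps F \<sigma> d \<longrightarrow>
        (\<exists>d'. picture_coloring ps' F' \<sigma> d' \<and> (\<forall>j<length ps. d' j 0 = d j 0 \<and> d' j 3 = d j 3)))"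

lemma move_picture_related:
  assumes "move (ps, F) (ps', F')"
  shows "picture_related ps F ps' F'"
  using assms
proof cases
  case FR1
  have "\<exists>d'. picture_coloring pic1_after {crossing1} \<sigma> d' \<and> (\<forall>j<length pic1_before. d' j 0 = d j 0 \<and> d' j 3 = d j 3)"
    if d: "picture_coloring pic1_before {} \<sigma> d" for \<sigma> d
  proof -
    obtain m where m: "dcross (\<sigma> 0) (\<sigma> 0) m (d 0 0) (d 0 0) m" using dcross_kink by blast
    have "d 0 3 = d 0 0" using d by (simp add: picture_coloring_no_crossings pic1_before_def)
    then show ?thesis
      using m by (intro exI[of _ "\<lambda>_. (!) [d 0 0, m, m, d 0 0]"] conjI pic1_after_coloring) (simp_all add: pic1_before_def)
  qed
  then show ?thesis
    unfolding picture_related_def using FR1 tame_pic1_before tame_pic1_after[of "{crossing1}"]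
    by (simp add: pic1_before_def pic1_after_def)
next
  case FR2
  have "\<exists>d'. picture_coloring pic2_after crossings2 \<sigma> d' \<and> (\<forall>j<length pic2_before. d' j 0 = d j 0 \<and> d' j 3 = d j 3)"
    if d: "picture_coloring pic2_before {} \<sigma> d" for \<sigma> d
  proof -
    obtain x y where xy: "dcross (\<sigma> 1) (\<sigma> 0) (d 1 0) y (d 0 0) x" "dcross (\<sigma> 0) (\<sigma> 1) x (d 0 0) y (d 1 0)"
      using dcross_bigon by blast
    have e: "d 0 3 = d 0 0" "d 1 3 = d 1 0"
      using d by (simp_all add: picture_coloring_no_crossings pic2_before_def all_less_2)
    then show ?thesis
      using xy by (intro exI[of _ "\<lambda>j. (!) ([[d 0 0, x, x, d 0 0], [d 1 0, y, y, d 1 0]] ! j)"] conjI pic2_after_coloring)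
        (simp_all add: pic2_before_def all_less_2 numeral_2_eq_2[symmetric])
  qed
  then show ?thesis
    unfolding picture_related_def using FR2 tame_pic2_before tame_pic2_after[of crossings2]
    by (simp add: pic2_before_def pic2_after_def)
next
  case FR3
  have "\<exists>d'. picture_coloring pic3_after crossings3_after \<sigma> d' \<and> (\<forall>j<length pic3_before. d' j 0 = d j 0 \<and> d' j 3 = d j 3)"
    if d: "picture_coloring pic3_before crossings3_before \<sigma> d" for \<sigma> d
  proof -
    have e: "d 0 0 = d 0 1" "d 1 2 = d 1 3" "d 2 1 = d 2 2"
      and c: "dcross (\<sigma> 1) (\<sigma> 2) (d 1 0) (d 1 1) (d 2 0) (d 2 1)"
        "dcross (\<sigma> 1) (\<sigma> 0) (d 1 1) (d 1 2) (d 0 1) (d 0 2)"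
        "dcross (\<sigma> 2) (\<sigma> 0) (d 2 2) (d 2 3) (d 0 2) (d 0 3)"
      using d unfolding pic3_before_coloring by blast+
    obtain n0 n1 n2 where n: "dcross (\<sigma> 2) (\<sigma> 0) (d 2 0) n2 (d 0 0) n0"
        "dcross (\<sigma> 1) (\<sigma> 0) (d 1 0) n1 n0 (d 0 3)" "dcross (\<sigma> 1) (\<sigma> 2) n1 (d 1 3) n2 (d 2 3)"
      using dcross_triangle[OF c(1)] c(2,3) e by metis
    then show ?thesis
      unfolding pic3_after_coloring
      by (intro exI[of _ "\<lambda>j. (!) ([[d 0 0, n0, d 0 3, d 0 3], [d 1 0, d 1 0, n1, d 1 3], [d 2 0, n2, n2, d 2 3]] ! j)"])
        (simp add: pic3_before_def all_less_3 numeral_2_eq_2[symmetric] numeral_3_eq_3[symmetric])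
  qed
  then show ?thesis
    unfolding picture_related_def using FR3 tame_pic3_before[of crossings3_before] tame_pic3_after[of crossings3_after]
    by (simp add: pic3_before_def pic3_after_def)
next
  case FR4
  have "{0} \<subseteq> crossings3_before" "{0} \<subseteq> crossings3_after"
    by (simp_all add: crossings3_before_def crossings3_after_def)
  then show ?thesis
    unfolding picture_related_def using FR4 tame_pic3_before tame_pic3_after pic3_mixed_coloring
    by (auto simp: pic3_before_def pic3_after_def)
next
  case VR1
  show ?thesis
    unfolding VR1 picture_related_def picture_coloring_no_crossings
    using tame_pic1_before tame_pic1_after[of "{}"] by (auto simp: pic1_before_def pic1_after_def)
next
  case VR2
  show ?thesis
    unfolding VR2 picture_related_def picture_coloring_no_crossings
    using tame_pic2_before tame_pic2_after[of "{}"] by (auto simp: pic2_before_def pic2_after_def)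
next
  case VR3
  show ?thesis
    unfolding VR3 picture_related_def picture_coloring_no_crossings
    using tame_pic3_before[of "{}"] tame_pic3_after[of "{}"] by (auto simp: pic3_before_def pic3_after_def)
qed

lemma move_before_graph:
  assumes "move (ps, F) (ps', F')"
  shows "ps \<noteq> []" "Re ((ps ! 0) u) = u"
  using assms by (cases; simp add: pic1_before_def pic2_before_def pic3_before_def)+

lemma closed_square: "closed square"
  unfolding square_def by (intro closed_Collect_conj closed_Collect_le continuous_intros)

lemma open_outside_square:
  assumes "is_diagram D"
  shows "open {x. curve D x \<notin> square}"
proof -
  have "continuous_on UNIV (curve D)"
    using curve_has_velocity[OF assms] has_vector_derivative_continuous
    by (simp add: continuous_on_eq_continuous_at) blast
  from continuous_open_preimage[OF this open_UNIV, of "- square"] closed_square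
  show ?thesis by (simp add: vimage_def open_Compl)
qed

lemma generic_point:
  assumes D: "is_diagram D" and U: "open U" "x \<in> U"
  shows "\<exists>y\<in>U. curve D y \<notin> flat D"
proof -
  obtain e where e: "e > 0" "ball x e \<subseteq> U" using U open_contains_ball by blast
  have "infinite {x<..<x + min e 1}" using e(1) by (intro infinite_Ioo) simp
  then obtain y where y: "y \<in> {x<..<x + min e 1}" "y \<notin> {z \<in> {x..<x+1}. curve D z \<in> flat D}"
    using finite_flat_parameters[OF D, of x] by (meson finite_subset subsetI)
  have "y < x + e" using y(1) by (auto simp: min_def split: if_splits)
  then have "y \<in> ball x e" using y(1) by (simp add: dist_real_def)
  then show ?thesis using y e(2) by auto
qed

text \<open>A strand that is a graph over \<open>[-1,1]\<close> leaves the square at its right end because its horizontal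
velocity there is 1.\<close>

lemma escape_square:
  assumes D: "is_diagram D" and r: "r \<noteq> 0"
    and graph: "\<And>u. \<bar>u\<bar> \<le> 1 \<Longrightarrow> Re (curve D (c + r * u)) = u"
  shows "\<exists>x. curve D x \<notin> square"
proof -
  define h where "h u = Re (curve D (c + r * u))" for u
  obtain d where d: "(h has_real_derivative d) (at 1)"
  proof -
    have "((\<lambda>u. c + r * u) has_vector_derivative r) (at 1)"
      unfolding has_real_derivative_iff_has_vector_derivative[symmetric] by (auto intro!: derivative_eq_intros)
    from vector_diff_chain_at[OF this curve_has_velocity[OF D]]
    have "((\<lambda>u. Re ((curve D \<circ> (\<lambda>u. c + r * u)) u)) has_vector_derivative Re (r *\<^sub>R velocity (curve D) (c + r * 1))) (at 1)"
      by (rule bounded_linear.has_vector_derivative[OF bounded_linear_Re])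
    then show ?thesis
      using that unfolding h_def has_real_derivative_iff_has_vector_derivative comp_def by blast
  qed
  have "(h has_vector_derivative d) (at 1 within cbox 0 1)"
    using d unfolding has_real_derivative_iff_has_vector_derivative by (rule has_vector_derivative_at_within)
  moreover have "(h has_vector_derivative 1) (at 1 within cbox 0 1)"
  proof (rule has_vector_derivative_transform_within[of "\<lambda>u. u" _ _ _ 1])
    show "((\<lambda>u. u) has_vector_derivative 1) (at 1 within cbox 0 (1::real))"
      by (rule has_vector_derivative_id)
    fix u :: real assume "u \<in> cbox 0 1"
    then show "u = h u" using graph[of u] by (simp add: h_def)
  qed auto
  ultimately have "d = 1"
    using vector_derivative_unique_within_closed_interval[of 0 1 1 h d 1] by simp
  then obtain \<epsilon> where e: "\<epsilon> > 0" "\<And>x. 0 < x \<Longrightarrow> x < \<epsilon> \<Longrightarrow> h 1 < h (1 + x)"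
    using has_real_derivative_pos_inc_right[OF d] by auto
  have "h 1 < h (1 + \<epsilon> / 2)" using e by simp
  moreover have "h 1 = 1" using graph[of 1] by (simp add: h_def)
  ultimately have "curve D (c + r * (1 + \<epsilon> / 2)) \<notin> square"
    by (simp add: h_def square_def)
  then show ?thesis ..
qed

lemma related_tangles:
  assumes D: "is_diagram D" and D': "is_diagram D'" and rel: "reidemeister_related D D'"
  shows "\<exists>ps F ps' F' e r b. picture_related ps F ps' F' \<and> curve D b \<notin> square \<and> curve D b \<notin> flat D \<and>
    tangle D b ps F e r \<and> tangle D' b ps' F' e r \<and>
    (\<forall>x. curve D x \<notin> square \<longrightarrow> curve D' x = curve D x) \<and> flat D - square = flat D' - square"
proof -
  obtain ps F ps' F' c r where mv: "move (ps, F) (ps', F')"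
    and r: "\<And>j. j < length ps \<Longrightarrow> r j \<noteq> 0"
    and bij: "bij_betw (\<lambda>(j, u). frac (c j + r j * u)) ({..<length ps} \<times> {-1..1}) {x \<in> {0..<1}. curve D x \<in> square}"
    and strands: "\<And>j u. j < length ps \<Longrightarrow> u \<in> {-1..1} \<Longrightarrow>
        curve D (c j + r j * u) = (ps ! j) u \<and> curve D' (c j + r j * u) = (ps' ! j) u"
    and out: "\<And>x. curve D x \<notin> square \<Longrightarrow> curve D' x = curve D x"
    and fl: "flat D \<inter> square = F" "flat D' \<inter> square = F'" "flat D - square = flat D' - square"
    using rel unfolding reidemeister_related_def by (elim exE conjE) (rule that; blast)
  have pr: "picture_related ps F ps' F'" by (rule move_picture_related[OF mv])
  then have tame: "tame_picture ps F" "tame_picture ps' F'" and len: "length ps' = length ps"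
    by (simp_all add: picture_related_def)
  have iv: "u \<in> {-1..1}" if "\<bar>u\<bar> \<le> 1" for u :: real using that by auto
  have in_sq: "curve D (c j + r j * u) \<in> square" if "j < length ps" "\<bar>u\<bar> \<le> 1" for j u
    using strands[OF that(1) iv[OF that(2)]] tame_pictureD(2)[OF tame(1) that] by simp
  have "0 < length ps" using move_before_graph(1)[OF mv] by simp
  then obtain b0 where "curve D b0 \<notin> square"
    using escape_square[OF D r, of 0 "c 0"] strands[of 0] iv move_before_graph(2)[OF mv] by metis
  then obtain b where b: "curve D b \<notin> square" and nb: "curve D b \<notin> flat D"
    using generic_point[OF D open_outside_square[OF D], of b0] by auto
  have b1: "curve D (b + 1) \<notin> square"
    using b curve_period[OF D, of b 1] by simp
  \<comment> \<open>Integer translates that bring the passages into the interval from \<open>b\<close> to \<open>b + 1\<close>. They stay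
    inside it because the curve is outside the square at \<open>b\<close>.\<close>
  define z where "z j = \<lfloor>b - c j\<rfloor> + 1" for j
  define e where "e j = c j + of_int (z j)" for j
  have per: "curve D (e j + r j * u) = curve D (c j + r j * u)" "curve D' (e j + r j * u) = curve D' (c j + r j * u)" for j u
    using curve_period[OF D, of "c j + r j * u" "z j"] curve_period[OF D', of "c j + r j * u" "z j"]
    by (simp_all add: e_def algebra_simps)
  have centre: "b < e j" "e j < b + 1" if j: "j < length ps" for j
  proof -
    show "b < e j" unfolding e_def z_def by linarith
    have "e j \<le> b + 1" unfolding e_def z_def by linarith
    moreover have "e j \<noteq> b + 1"
      using in_sq[OF j, of 0] per(1)[of j 0] b1 by auto
    ultimately show "e j < b + 1" by simp
  qed
  have avoid: "\<not> (\<bar>x - e j\<bar> \<le> \<bar>r j * u\<bar>)" if j: "j < length ps" and u: "\<bar>u\<bar> \<le> 1" and x: "curve D x \<notin> square" for j u x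
  proof
    assume *: "\<bar>x - e j\<bar> \<le> \<bar>r j * u\<bar>"
    also have "\<dots> \<le> \<bar>r j\<bar>" using u by (simp add: abs_mult mult_left_le)
    finally have w: "\<bar>(x - e j) / r j\<bar> \<le> 1" using r[OF j] by (simp add: abs_divide)
    have "curve D (e j + r j * ((x - e j) / r j)) \<in> square"
      unfolding per(1) by (rule in_sq[OF j w])
    then show False using x r[OF j] by simp
  qed
  have window: "b < e j + r j * u \<and> e j + r j * u < b + 1" if j: "j < length ps" and u: "\<bar>u\<bar> \<le> 1" for j u
    using avoid[OF j u b] avoid[OF j u b1] centre[OF j] by linarith
  have disjoint: "i = j" if "i < length ps" "j < length ps" "\<bar>u\<bar> \<le> 1" "\<bar>v\<bar> \<le> 1"
    "e i + r i * u = e j + r j * v" for i j u v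
  proof -
    have "c i + r i * u = c j + r j * v + of_int (z j - z i)"
      using that(5) by (simp add: e_def algebra_simps)
    then have "frac (c i + r i * u) = frac (c j + r j * v)"
      unfolding frac_eq_iff by blast
    then have "(i, u) = (j, v)"
      using inj_onD[OF bij_betw_imp_inj_on[OF bij], of "(i, u)" "(j, v)"] that(1,2) iv[OF that(3)] iv[OF that(4)]
      by simp
    then show "i = j" by simp
  qed
  have cover: "\<exists>j<length ps. \<exists>u. \<bar>u\<bar> \<le> 1 \<and> x = e j + r j * u"
    if x: "b < x" "x < b + 1" "curve D x \<in> square" for x
  proof -
    have "frac x \<in> (\<lambda>(j, u). frac (c j + r j * u)) ` ({..<length ps} \<times> {-1..1})"
      unfolding bij_betw_imp_surj_on[OF bij] using x(3) frac_lt_1[of x] by (simp add: curve_frac[OF D])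
    then obtain j u where ju: "j < length ps" "u \<in> {-1..1}" "frac x = frac (c j + r j * u)" by auto
    then obtain w :: int where "x = c j + r j * u + of_int w" using frac_eq_iff by blast
    then have x_eq: "x = e j + r j * u + of_int (w - z j)" by (simp add: e_def)
    have u: "\<bar>u\<bar> \<le> 1" using ju(2) by (rule abs_le_1)
    have "of_int (w - z j) < (1::real)" "of_int (w - z j) > (-1::real)"
      using window[OF ju(1) u] x x_eq by linarith+
    then have "w - z j = 0" by linarith
    then show ?thesis using x_eq ju(1) u by auto
  qed
  have "tangle D b ps F e r"
  proof
    show "curve D (e j + r j * u) = (ps ! j) u" if "j < length ps" "\<bar>u\<bar> \<le> 1" for j u
      using strands[OF that(1) iv[OF that(2)]] per by simp
  qed (use D tame r window disjoint fl cover in blast)+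
  moreover have "tangle D' b ps' F' e r"
  proof
    show "curve D' (e j + r j * u) = (ps' ! j) u" if "j < length ps'" "\<bar>u\<bar> \<le> 1" for j u
      using strands[OF _ iv[OF that(2)]] that(1) len per by simp
    show "\<exists>j<length ps'. \<exists>u. \<bar>u\<bar> \<le> 1 \<and> x = e j + r j * u" if "b < x" "x < b + 1" "curve D' x \<in> square" for x
      unfolding len using cover[OF that(1,2)] out[of x] that(3) by metis
  qed (use D' tame r window disjoint fl len in \<open>simp_all only:; blast\<close>)+
  ultimately show ?thesis
    using pr b nb out fl(3) by blast
qed

lemma knot_value_reidemeister:
  assumes D: "is_diagram D" and D': "is_diagram D'" and rel: "reidemeister_related D D'"
  shows "\<exists>q. knot_value D q \<and> knot_value D' q"
proof -
  obtain ps F ps' F' e r b where pr: "picture_related ps F ps' F'" and b: "curve D b \<notin> square"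
    and nb: "curve D b \<notin> flat D" and T: "tangle D b ps F e r" and T': "tangle D' b ps' F' e r"
    and out: "\<And>x. curve D x \<notin> square \<Longrightarrow> curve D' x = curve D x"
    and fl: "flat D - square = flat D' - square"
    using related_tangles[OF assms] by blast
  interpret T: tangle D b ps F e r by (rule T)
  interpret T': tangle D' b ps' F' e r by (rule T')
  have len: "length ps' = length ps" using pr by (simp add: picture_related_def)
  have same: "T'.inside = T.inside"
    by (simp add: fun_eq_iff T.inside_def T'.inside_def len)
  have sg: "sgn (r j) = 1 \<or> sgn (r j) = -1" if "j < length ps" for j
    using T.r[OF that] by (auto simp: sgn_if)
  have nb': "curve D' b \<notin> flat D'" using nb fl b out[OF b] by auto
  obtain f g where c: "coloring D b f g" and fb: "f b = 1" using coloring_exists[OF D nb] by blast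
  obtain a where a: "traversal_coloring ps F T.\<sigma> a"
    and a_ends: "\<And>j. j < length ps \<Longrightarrow> a j 0 = f (T.pt j (-1)) \<and> a j 0 = g (T.pt j (-1)) \<and>
      a j 3 = f (T.pt j 1) \<and> a j 3 = g (T.pt j 1)"
    using T.traversal_coloring_of_coloring[OF c] by blast
  obtain d' where d': "picture_coloring ps' F' T.\<sigma> d'"
    and d'_ends: "\<And>j. j < length ps \<Longrightarrow> d' j 0 = reverse_where_negative T.\<sigma> a j 0 \<and> d' j 3 = reverse_where_negative T.\<sigma> a j 3"
    using pr picture_coloring_of_traversal[OF a sg] unfolding picture_related_def by blast
  define a' where "a' = reverse_where_negative T.\<sigma> d'"
  have a': "traversal_coloring ps' F' T.\<sigma> a'"
    unfolding a'_def using traversal_of_picture_coloring[OF d'] sg len by simp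
  have a'_ends: "a' j 0 = a j 0" "a' j 3 = a j 3" if "j < length ps" for j
    using d'_ends[OF that] by (auto simp: a'_def reverse_where_negative_def)
  have outside: "curve D x \<notin> square" if x: "b < x" "x < b + 1" "\<not> T.inside x" for x
  proof
    assume "curve D x \<in> square"
    then obtain j u where ju: "j < length ps" "\<bar>u\<bar> \<le> 1" "x = e j + r j * u" using T.cover[OF x(1,2)] by blast
    then have "\<bar>x - e j\<bar> \<le> \<bar>r j\<bar>" by (simp add: abs_mult mult_left_le)
    then show False using x(3) ju(1) by (auto simp: T.inside_def)
  qed
  have inside: "curve D' x \<in> square" if "T.inside x" for x
  proof -
    have "T'.inside x" unfolding same by (rule that)
    then obtain j v where "j < length ps'" "\<bar>v\<bar> \<le> 1" "x = T'.pt j v"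
      unfolding T'.inside_iff by blast
    then show ?thesis
      using T'.pt_strand tame_pictureD(2)[OF T'.tame] T'.abs_sigma by simp
  qed
  have vel: "velocity (curve D') x = velocity (curve D) x" if "curve D x \<notin> square" for x
  proof -
    have "(curve D' has_vector_derivative velocity (curve D) x) (at x)"
    proof (rule has_vector_derivative_transform_within_open[OF curve_has_velocity[OF D] open_outside_square[OF D]])
      show "x \<in> {x. curve D x \<notin> square}" using that by simp
      show "curve D y = curve D' y" if "y \<in> {x. curve D x \<notin> square}" for y
        using out[of y] that by simp
    qed
    then show ?thesis unfolding velocity_def by (rule vector_derivative_at)
  qed
  have "\<exists>f' g'. coloring D' b f' g' \<and> f' b = f b \<and> g' (b + 1) = g (b + 1)"
  proof (rule T'.coloring_of_traversal_coloring[OF c, unfolded same, OF _ _ _ a'])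
    fix x assume x: "b < x" "x < b + 1" "\<not> T.inside x" "curve D' x \<notin> flat D'"
    show "curve D x \<notin> flat D"
    proof -
      have sq: "curve D x \<notin> square" by (rule outside[OF x(1-3)])
      have "curve D x \<notin> flat D'" using x(4) unfolding out[OF sq] .
      then show ?thesis using sq fl by blast
    qed
  next
    fix x y assume xy: "b < x" "x < b + 1" "b < y" "y < b + 1" "\<not> T.inside x" "\<not> T.inside y" "crossing_pair D' x y"
    have sq: "curve D x \<notin> square" "curve D y \<notin> square" using outside xy by blast+
    show "crossing_pair D x y"
    proof -
      have "curve D x \<in> flat D' \<longleftrightarrow> curve D x \<in> flat D" using sq(1) fl by blast
      then show ?thesis
        using xy(7) unfolding crossing_pair_def vel[OF sq(1)] vel[OF sq(2)] out[OF sq(1)] out[OF sq(2)] by blast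
    qed
  next
    fix x y assume xy: "b < x" "x < b + 1" "b < y" "y < b + 1" "T.inside x \<noteq> T.inside y"
    show "curve D' x \<noteq> curve D' y"
    proof (cases "T.inside x")
      case True
      then have "\<not> T.inside y" using xy(5) by blast
      then have sq: "curve D y \<notin> square" using outside xy(3,4) by blast
      show ?thesis using inside[OF True] sq unfolding out[OF sq] by metis
    next
      case False
      then have sq: "curve D x \<notin> square" using outside xy(1,2) by blast
      have "curve D' y \<in> square" using inside False xy(5) by blast
      then show ?thesis using sq unfolding out[OF sq] by metis
    qed
  next
    fix j assume "j < length ps'"
    then have j: "j < length ps" using len by simp
    show "a' j 0 = g (T.pt j (-1)) \<and> a' j 3 = f (T.pt j 1)"
      using a'_ends[OF j] a_ends[OF j] by metis
  qed
  then obtain f' g' where c': "coloring D' b f' g'" "f' b = f b" "g' (b + 1) = g (b + 1)" by blast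
  have "knot_value D (1 - g (b + 1))"
    unfolding knot_value_def using nb c fb by blast
  moreover have "knot_value D' (1 - g (b + 1))"
    unfolding knot_value_def using nb' c' fb by metis
  ultimately show ?thesis by blast
qed

section \<open>Invariance\<close>

lemma knot_value_exists:
  assumes D: "is_diagram D"
  shows "\<exists>q. knot_value D q"
proof -
  obtain b where "curve D b \<notin> flat D"
    using generic_point[OF D, of UNIV] by auto
  then show ?thesis
    using coloring_exists[OF D] unfolding knot_value_def by blast
qed

lemma flat_step_common_value:
  assumes s: "flat_step D D'"
  shows "\<exists>q. knot_value D q \<and> knot_value D' q"
proof -
  have D: "is_diagram D" and D': "is_diagram D'"
    and step: "reparametrised D D' \<or> planar_isotopic D D' \<or> reidemeister_related D D'"
    using s by (simp_all add: flat_step_def)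
  from step show ?thesis
  proof (elim disjE)
    assume r: "reparametrised D D'"
    obtain b where "curve D' b \<notin> flat D'"
      using generic_point[OF D', of UNIV] by auto
    from knot_value_reparametrised[OF D r coloring_exists[OF D] this] show ?thesis .
  next
    assume p: "planar_isotopic D D'"
    obtain q where "knot_value D q"
      using knot_value_exists[OF D] by blast
    with knot_value_planar_isotopic[OF D p] show ?thesis by blast
  next
    assume "reidemeister_related D D'"
    with knot_value_reidemeister[OF D D'] show ?thesis .
  qed
qed

lemma knot_value_equivclp:
  assumes "equivclp flat_step D D'" and D: "is_diagram D" and q: "knot_value D q"
  shows "is_diagram D' \<and> (\<forall>q'. knot_value D' q' \<longrightarrow> q_equiv q q')"
  using assms(1)
proof (induction rule: equivclp_induct)
  case base
  then show ?case using D q knot_value_unique by blast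
next
  case (step E E')
  then have E: "is_diagram E" "is_diagram E'" by (auto simp: flat_step_def)
  obtain r where "knot_value E r" "knot_value E' r"
    using step flat_step_common_value by blast
  then show ?case
    using step.IH E knot_value_unique[OF E(2)] q_equiv_trans by blast
qed

theorem claim6p4:
  fixes n k k' :: nat
    and \<alpha> :: "diagram set"
    and D D' :: diagram
    and V V' :: "complex set"
    and A A' :: "nat \<Rightarrow> nat \<Rightarrow> free_ring set"
  assumes "\<alpha> \<in> flat_virtual_knots"
    and "D \<in> \<alpha>" and "D' \<in> \<alpha>"
    and "is_coloring_matrix n D V k A"
    and "is_coloring_matrix n D' V' k' A'"
  shows "\<exists>U\<in>Units (Sn n). \<exists>W\<in>Units (Sn n).
           pi0 (U \<otimes>\<^bsub>Sn n\<^esub> W) = \<one>\<^bsub>Sn 0\<^esub> \<and>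
           quasidet (Sn n) k' A' k' k' =
             U \<otimes>\<^bsub>Sn n\<^esub> quasidet (Sn n) k A k k \<otimes>\<^bsub>Sn n\<^esub> W"
proof -
  obtain E where E: "equivclp flat_step E D" "equivclp flat_step E D'" and D: "is_diagram D" and D': "is_diagram D'"
    using assms(1-3) unfolding flat_virtual_knots_def quotient_def by auto
  have DD': "equivclp flat_step D D'"
    using equivclp_trans[OF equivclp_sym[OF E(1)] E(2)] .
  obtain q where q: "knot_value D q" using knot_value_exists[OF D] by blast
  obtain q' where q': "knot_value D' q'" using knot_value_exists[OF D'] by blast
  obtain r where r: "q_equiv q r" "quasidet (Sn n) k A k k = proj n r"
    using quasidet_knot_value[OF D assms(4) q] by blast
  obtain r' where r': "q_equiv q' r'" "quasidet (Sn n) k' A' k' k' = proj n r'"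
    using quasidet_knot_value[OF D' assms(5) q'] by blast
  have "q_equiv q q'"
    using knot_value_equivclp[OF DD' D q] q' by blast
  then have "q_equiv r r'"
    using r(1) r'(1) q_equiv_sym q_equiv_trans by blast
  then show ?thesis
    unfolding r(2) r'(2) by (rule q_equiv_proj)
qed

end
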